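(* Let $\alpha,h:\mathbb{R}\to\mathbb{R}$ be real-analytic and let $U=e^{i(-\alpha+h)}$ on $\mathbb{R}$. Suppose $\alpha$ is a regular locally doubling weight satisfying $$1\lesssim\alpha'(x)\lesssim\langle x\rangle^{K_0}\quad\text{for some }K_0\ge0,$$ and that $h\in L^\infty(\mathbb{R})$ satisfies $$|h'(x)|\lesssim\langle x\rangle^{K_1}\quad\text{for some }K_1\ge0.$$ Let $\Lambda\subset\mathbb{R}$ be $\alpha$-uniformly separated with $D_\alpha^+(\Lambda)<\frac1{2\pi}$. Then there exist $T\in N^\infty(U)$ and $N\geq 0$ such that $$T(\lambda)=0\quad\text{for all }\lambda\in\Lambda,$$ and $$\langle\lambda\rangle^{-N}\lesssim|T'(\lambda)|\quad\text{for all }\lambda\in\Lambda.$$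
   Context: Notation: $\langle x\rangle=(1+x^2)^{1/2}$; for nonnegative functions $f,g$, $f\lesssim g$ means there is a constant $C>0$, independent of the variable, with $f\le Cg$. For strictly increasing $\alpha$, $d_\alpha(x,y)=|\alpha(x)-\alpha(y)|$, and for an interval $I$, $\alpha(I)=\int_I\alpha'(x)\,dx$. A smooth strictly increasing map $\alpha:\mathbb{R}\to\mathbb{R}$ is a regular locally doubling weight if: (i) there are constants $M,m>0$ and $R>0$ with $m\alpha'(y)\le\alpha'(x)\le M\alpha'(y)$ for all $x,y$ with $d_\alpha(x,y)\le1$ and $|x|,|y|\ge R$; and (ii) there are constants $C>0$ and $R>0$ with $|\alpha''(x)|\le C\alpha'(x)^2$ for $|x|\ge R$. A set $\Lambda\subset\mathbb{R}$ is $\alpha$-uniformly separated if there is $\delta>0$ with $d_\alpha(\lambda,\lambda')>\delta$ for all distinct $\lambda,\lambda'\in\Lambda$. The upper $\alpha$-density is $$D_\alpha^+(\Lambda)=\lim_{r\to\infty}\sup_{\alpha(I)=r}\frac{\#(\Lambda\cap I)}{r},$$ the supremum being over intervals $I$ with $\alpha(I)=r$. $H^\infty$ is the space of bounded analytic functions in the upper half-plane $\mathbb{C}_+$, identified with their boundary values on $\mathbb{R}$. For unimodular $U$ on $\mathbb{R}$, $N^\infty(U)=\{f\in H^\infty:\overline{Uf}\in H^\infty\}$, where $\overline{Uf}\in H^\infty$ means that the function $\overline{Uf}$ on $\mathbb{R}$ is the boundary function of an element of $H^\infty$. When $U=e^{i\gamma}$ with $\gamma$ real-analytic, all elements of $N^\infty(U)$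 have real-analytic boundary functions on $\mathbb{R}$, so pointwise values and derivatives on $\mathbb{R}$ make sense. *)

theory Defs
  imports "HOL-Complex_Analysis.Complex_Analysis"
begin

definition real_analytic :: "(real \<Rightarrow> 'a::real_normed_vector) \<Rightarrow> bool" where
  "real_analytic f \<longleftrightarrow>
     (\<forall>x. \<exists>r>0. \<exists>a. \<forall>y. \<bar>y - x\<bar> < r \<longrightarrow> (\<lambda>n. (y - x) ^ n *\<^sub>R a n) sums f y)"

definition jbracket :: "real \<Rightarrow> real" where
  "jbracket x = sqrt (1 + x\<^sup>2)"

definition lesssim_on :: "'a set \<Rightarrow> ('a \<Rightarrow> real) \<Rightarrow> ('a \<Rightarrow> real) \<Rightarrow> bool" where
  "lesssim_on S f g \<longleftrightarrow> (\<exists>C>0. \<forall>x\<in>S. f x \<le> C * g x)"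

definition weight_dist :: "(real \<Rightarrow> real) \<Rightarrow> real \<Rightarrow> real \<Rightarrow> real" where
  "weight_dist \<alpha> x y = \<bar>\<alpha> x - \<alpha> y\<bar>"

definition regular_locally_doubling :: "(real \<Rightarrow> real) \<Rightarrow> bool" where
  "regular_locally_doubling \<alpha> \<longleftrightarrow>
     (\<forall>n. (deriv ^^ n) \<alpha> differentiable_on UNIV) \<and>
     strict_mono \<alpha> \<and>
     (\<exists>M>0. \<exists>m>0. \<exists>R>0. \<forall>x y. weight_dist \<alpha> x y \<le> 1 \<and> \<bar>x\<bar> \<ge> R \<and> \<bar>y\<bar> \<ge> R \<longrightarrow>
        m * deriv \<alpha> y \<le> deriv \<alpha> x \<and> deriv \<alpha> x \<le> M * deriv \<alpha> y) \<and>
     (\<exists>C>0. \<exists>R>0. \<forall>x. \<bar>x\<bar> \<ge> R \<longrightarrow> \<bar>deriv (deriv \<alpha>) x\<bar> \<le> C * (deriv \<alpha> x)\<^sup>2)"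

definition uniformly_separated :: "(real \<Rightarrow> real) \<Rightarrow> real set \<Rightarrow> bool" where
  "uniformly_separated \<alpha> \<Lambda> \<longleftrightarrow>
     (\<exists>\<delta>>0. \<forall>x\<in>\<Lambda>. \<forall>y\<in>\<Lambda>. x \<noteq> y \<longrightarrow> weight_dist \<alpha> x y > \<delta>)"

definition weight_length :: "(real \<Rightarrow> real) \<Rightarrow> real set \<Rightarrow> real" where
  "weight_length \<alpha> I = (LBINT x:I. deriv \<alpha> x)"

text \<open>Points are counted by counting measure, so that infinite intersections count as
  \<open>\<infinity>\<close> (whereas \<^const>\<open>card\<close> would give 0).\<close>

definition upper_density :: "(real \<Rightarrow> real) \<Rightarrow> real set \<Rightarrow> ennreal" where
  "upper_density \<alpha> \<Lambda> =
     Lim at_top (\<lambda>r::real.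
       SUP I \<in> {I. is_interval I \<and> weight_length \<alpha> I = r}.
         emeasure (count_space UNIV) (\<Lambda> \<inter> I) / ennreal r)"

definition L_infty :: "(real \<Rightarrow> real) set" where
  "L_infty = {f \<in> borel_measurable lebesgue. \<exists>B. AE x in lebesgue. \<bar>f x\<bar> \<le> B}"

definition nontangential_limit :: "(complex \<Rightarrow> complex) \<Rightarrow> complex \<Rightarrow> real \<Rightarrow> bool" where
  "nontangential_limit F w x \<longleftrightarrow>
     (\<forall>\<kappa>>0. (F \<longlongrightarrow> w)
        (at (complex_of_real x) within {z. Im z > 0 \<and> \<bar>Re z - x\<bar> < \<kappa> * Im z}))"

text \<open>Elements of \<open>H\<^sup>\<infinity>\<close> are represented by their boundary functions on \<open>\<real>\<close>,
  which are determined only almost everywhere: the sets \<open>H_infty\<close> and \<open>N_infty U\<close> contain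
  every representative of each almost-everywhere class. Pointwise statements about an element
  therefore have to refer to its real-analytic representative (unique, if there is one).\<close>

definition H_infty :: "(real \<Rightarrow> complex) set" where
  "H_infty = {f. \<exists>F. F holomorphic_on {z. Im z > 0} \<and> bounded (F ` {z. Im z > 0}) \<and>
                   (AE x in lebesgue. nontangential_limit F (f x) x)}"

definition N_infty :: "(real \<Rightarrow> complex) \<Rightarrow> (real \<Rightarrow> complex) set" where
  "N_infty U = {f \<in> H_infty. (\<lambda>x. cnj (U x * f x)) \<in> H_infty}"

end

theory Submission
  imports Defs "HOL-Library.Nat_Bijection"
begin

text \<open>Choose \<open>m\<close> such that every interval of \<open>\<alpha>\<close>-length \<open>2 \<pi> m\<close> contains fewer than \<open>m\<close> points of
  \<open>\<Lambda>\<close>, and enlarge \<open>\<Lambda>\<close> to a separated set \<open>L\<close> with exactly \<open>m\<close> points in each block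
  of \<open>\<alpha>\<close>-length \<open>2 \<pi> m\<close>. With summable weights \<open>w\<close> of polynomial decay, the
  Herglotz function \<open>R z = \<Sum>\<^sub>\<infinity>l\<in>L. w l / (l - z)\<close> gives a function \<open>q = 1 / (R + \<i>)\<close> that is bounded
  in the upper half-plane, vanishes on \<open>L\<close>, and satisfies \<open>q = exp (\<i> j) cnj q\<close> on the line, where the
  phase \<open>j\<close> grows by \<open>2 \<pi>\<close> from each point of \<open>L\<close> to the next. Hence \<open>\<theta> = (\<alpha> - h - j) / 2\<close> is
  bounded, with a derivative of polynomial growth, and its Schwarz integral \<open>G\<close> extends across the
  line with \<open>Re G = \<theta>\<close> there and \<open>G\<close> growing at most logarithmically. So \<open>f = exp (\<i> G) q\<close> satisfies
  \<open>cnj (U f) = f\<close> on the line, and dividing \<open>f\<close> by a polynomial whose roots are finitely many added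
  points of \<open>L - \<Lambda>\<close> makes it bounded without destroying this symmetry.\<close>

section \<open>The Schwarz integral of a bounded phase\<close>

text \<open>A function fixed by the map taking \<open>f\<close> to the conjugate of
  \<open>U * f\<close> lies in \<open>N_infty U\<close> as soon as it lies in
  \<open>H_infty\<close>, so one bounded symmetric function is enough. The obstacle is that the
  harmonic conjugate of a bounded phase need not be bounded. It grows at most logarithmically,
  because the Hoelder constant of \<theta> has polynomial growth; after exponentiation this is a
  polynomial loss, which division by real roots repairs. The degree needed is known only after
  \<open>L\<close> has been fixed, so \<open>L - \<Lambda>\<close> has to be infinite: the strict
  density inequality leaves a free place in every block. Equal numbers of points in all blocks keep
  the count of \<open>L\<close> within a bounded distance of \<open>\<alpha> / (2 * pi)\<close>,
  hence \<theta> bounded. The weights meet two opposite demands: \<open>w \<le> 1\<close> keeps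
  \<open>1 / w\<close>, the modulus of the derivative of \<open>q\<close> on \<open>L\<close>, away
  from 0, while the polynomial bound on \<open>1 / w\<close> controls the derivative of
  \<open>j\<close> and with it the Hoelder constant of \<theta>.\<close>

abbreviation UHP :: "complex set" where "UHP \<equiv> {z. Im z > 0}"

abbreviation cUHP :: "complex set" where "cUHP \<equiv> {z. Im z \<ge> 0}"

abbreviation rball :: "real \<Rightarrow> real \<Rightarrow> complex set" where "rball x \<equiv> ball (complex_of_real x)"

abbreviation extends_at :: "real \<Rightarrow> (complex \<Rightarrow> complex) \<Rightarrow> bool" where
  "extends_at x f \<equiv> \<exists>r>0. \<exists>F. F holomorphic_on rball x r \<and> (\<forall>z \<in> rball x r. Im z \<ge> 0 \<longrightarrow> F z = f z)"

abbreviation real_extends_at :: "real \<Rightarrow> (real \<Rightarrow> real) \<Rightarrow> bool" where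
  "real_extends_at x f \<equiv> \<exists>r>0. \<exists>F. F holomorphic_on rball x r \<and>
     (\<forall>t. \<bar>t - x\<bar> < r \<longrightarrow> F (of_real t) = of_real (f t))"

text \<open>Bounds uniform in the truncation length come from majorants with explicit
  antiderivatives, so no improper integral has to be evaluated.\<close>

lemma norm_integral_le_antiderivative:
  fixes f :: "real \<Rightarrow> complex"
  assumes "a \<le> b" "continuous_on {a..b} f"
    and "\<And>t. t \<in> {a..b} \<Longrightarrow> (\<phi> has_real_derivative \<phi>' t) (at t)"
    and "\<And>t. t \<in> {a..b} \<Longrightarrow> norm (f t) \<le> \<phi>' t"
  shows "norm (integral {a..b} f) \<le> \<phi> b - \<phi> a"
proof -
  have "(\<phi>' has_integral (\<phi> b - \<phi> a)) {a..b}"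
    using assms(1,3) by (intro fundamental_theorem_of_calculus)
      (auto simp: has_real_derivative_iff_has_vector_derivative intro: has_vector_derivative_at_within)
  then show ?thesis
    using integral_norm_bound_integral[of f "{a..b}" \<phi>'] assms(2,4)
    by (metis atLeastAtMost_iff box_real(2) has_integral_iff integrable_continuous_real)
qed

text \<open>The right-hand side has the antiderivative \<open>- 4 / sqrt (s + y)\<close>.\<close>

lemma sqrt_kernel_le:
  fixes s y :: real
  assumes "s \<ge> 0" "y > 0"
  shows "sqrt s / (s\<^sup>2 + y\<^sup>2) \<le> 2 / ((s + y) * sqrt (s + y))"
proof -
  have "sqrt s * ((s + y) * sqrt (s + y)) \<le> sqrt (s + y) * ((s + y) * sqrt (s + y))"
    using assms by (intro mult_right_mono) auto
  also have "\<dots> = (s + y)\<^sup>2"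
    using assms by (simp add: power2_eq_square)
  also have "\<dots> \<le> 2 * (s\<^sup>2 + y\<^sup>2)"
    using sum_squares_bound[of s y] by (simp add: power2_sum)
  finally show ?thesis
    using assms by (simp add: divide_simps add_nonneg_pos sum_power2_gt_zero_iff)
qed

text \<open>The interval is split at \<open>x\<close>, and each half contributes at most
  \<open>4 * H / sqrt y\<close>, whatever \<open>a\<close> and \<open>b\<close> are. This handles
  Hoelder differences of exponent 1/2 against kernels of Poisson type.\<close>

lemma norm_integral_sqrt_kernel_le:
  fixes f :: "real \<Rightarrow> complex"
  assumes "a \<le> x" "x \<le> b" "y > 0" "H \<ge> 0" and cont: "continuous_on {a..b} f"
    and bd: "\<And>t. t \<in> {a..b} \<Longrightarrow> norm (f t) \<le> H * sqrt \<bar>t - x\<bar> / ((t - x)\<^sup>2 + y\<^sup>2)"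
  shows "norm (integral {a..b} f) \<le> 8 * H / sqrt y"
proof -
  have bd': "norm (f t) \<le> 2 * H / ((\<bar>t - x\<bar> + y) * sqrt (\<bar>t - x\<bar> + y))" if "t \<in> {a..b}" for t
  proof -
    have "H * (sqrt \<bar>t - x\<bar> / (\<bar>t - x\<bar>\<^sup>2 + y\<^sup>2)) \<le> H * (2 / ((\<bar>t - x\<bar> + y) * sqrt (\<bar>t - x\<bar> + y)))"
      using assms by (intro mult_left_mono sqrt_kernel_le) auto
    with bd[OF that] show ?thesis by (simp add: mult.commute)
  qed
  have D1: "((\<lambda>t. - 4 * H / sqrt (t - x + y)) has_real_derivative 2 * H / ((t - x + y) * sqrt (t - x + y))) (at t)"
    if "t \<ge> x" for t
    using that assms(3) by (auto intro!: derivative_eq_intros simp: field_simps)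
  have D2: "((\<lambda>t. 4 * H / sqrt (x - t + y)) has_real_derivative 2 * H / ((x - t + y) * sqrt (x - t + y))) (at t)"
    if "t \<le> x" for t
    using that assms(3) by (auto intro!: derivative_eq_intros simp: field_simps)
  have "norm (integral {x..b} f) \<le> - 4 * H / sqrt (b - x + y) - (- 4 * H / sqrt (x - x + y))"
  proof (intro norm_integral_le_antiderivative[OF _ _ D1])
    fix t assume t: "t \<in> {x..b}"
    then have "\<bar>t - x\<bar> = t - x" by auto
    with bd'[of t] t assms show "norm (f t) \<le> 2 * H / ((t - x + y) * sqrt (t - x + y))" by auto
  qed (use assms in \<open>auto intro: continuous_on_subset[OF cont]\<close>)
  also have "\<dots> \<le> 4 * H / sqrt y"
    using assms by simp
  finally have 1: "norm (integral {x..b} f) \<le> 4 * H / sqrt y" .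
  have "norm (integral {a..x} f) \<le> 4 * H / sqrt (x - x + y) - 4 * H / sqrt (x - a + y)"
  proof (intro norm_integral_le_antiderivative[OF _ _ D2])
    fix t assume t: "t \<in> {a..x}"
    then have "\<bar>t - x\<bar> = x - t" by auto
    with bd'[of t] t assms show "norm (f t) \<le> 2 * H / ((x - t + y) * sqrt (x - t + y))" by auto
  qed (use assms in \<open>auto intro: continuous_on_subset[OF cont]\<close>)
  also have "\<dots> \<le> 4 * H / sqrt y"
    using assms by simp
  finally have 2: "norm (integral {a..x} f) \<le> 4 * H / sqrt y" .
  have "integral {a..b} f = integral {a..x} f + integral {x..b} f"
    using assms by (simp add: Henstock_Kurzweil_Integration.integral_combine integrable_continuous_real)
  then have "norm (integral {a..b} f) \<le> norm (integral {a..x} f) + norm (integral {x..b} f)"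
    by (simp add: norm_triangle_ineq)
  with 1 2 show ?thesis by simp
qed

section \<open>Truncated Schwarz integrals, with estimates uniform in the cutoff\<close>

definition schwarz_kernel :: "real \<Rightarrow> complex \<Rightarrow> complex" where
  "schwarz_kernel t z = 1 / (of_real t - z) - of_real (t / (1 + t\<^sup>2))"

text \<open>The subtracted term of the kernel is real and leaves its imaginary part, the Poisson
  kernel up to the factor \<open>pi\<close>, unchanged; it is there to make the integral converge
  for bounded \<theta>. Dividing by \<open>pi * \<i>\<close> turns the real part into the truncated
  Poisson integral of \<theta>.\<close>

definition schwarz_trunc :: "(real \<Rightarrow> real) \<Rightarrow> nat \<Rightarrow> complex \<Rightarrow> complex" where
  "schwarz_trunc \<theta> n z = integral {- real n..real n} (\<lambda>t. of_real (\<theta> t) * schwarz_kernel t z) / (pi * \<i>)"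

abbreviation schwarz_trunc' :: "(real \<Rightarrow> real) \<Rightarrow> nat \<Rightarrow> complex \<Rightarrow> complex" where
  "schwarz_trunc' \<theta> n z \<equiv> integral {- real n..real n} (\<lambda>t. of_real (\<theta> t) / (of_real t - z)\<^sup>2) / (pi * \<i>)"

lemma real_minus_upper_nonzero: "Im z > 0 \<Longrightarrow> complex_of_real t - z \<noteq> 0"
  by (auto simp: complex_eq_iff)

lemma one_plus_square_nonzero: "1 + t\<^sup>2 \<noteq> (0::real)"
  by (smt (verit) zero_le_power2)

lemma continuous_on_schwarz_integrand:
  assumes "continuous_on UNIV \<theta>" "Im z > 0"
  shows "continuous_on S (\<lambda>t. complex_of_real (\<theta> t) * schwarz_kernel t z)"
proof -
  have "continuous_on S \<theta>" using assms(1) by (rule continuous_on_subset) simp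
  then show ?thesis
    unfolding schwarz_kernel_def
    using real_minus_upper_nonzero[OF assms(2)] one_plus_square_nonzero
    by (intro continuous_intros) auto
qed

lemma continuous_on_schwarz_deriv_integrand:
  assumes "continuous_on UNIV \<theta>" "Im z > 0"
  shows "continuous_on S (\<lambda>t. complex_of_real (\<theta> t) / (of_real t - z)\<^sup>2)"
proof -
  have "continuous_on S \<theta>" using assms(1) by (rule continuous_on_subset) simp
  then show ?thesis
    using real_minus_upper_nonzero[OF assms(2)]
    by (intro continuous_intros) auto
qed

lemma schwarz_trunc_deriv:
  assumes \<theta>: "continuous_on UNIV \<theta>" and z: "Im z > 0"
  shows "(schwarz_trunc \<theta> n has_field_derivative
      schwarz_trunc' \<theta> n z) (at z)"
proof -
  define U where "U = UHP"
  have U: "open U" "convex U" "z \<in> U"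
    using z by (auto simp: U_def open_halfspace_Im_gt convex_halfspace_Im_gt)
  have "((\<lambda>z. integral (cbox (- real n) (real n)) (\<lambda>t. of_real (\<theta> t) * schwarz_kernel t z)) has_field_derivative
      integral (cbox (- real n) (real n)) (\<lambda>t. of_real (\<theta> t) / (of_real t - z)\<^sup>2)) (at z within U)"
  proof (rule leibniz_rule_field_derivative)
    fix x t assume "x \<in> U"
    then have "complex_of_real t - x \<noteq> 0"
      by (auto simp: U_def real_minus_upper_nonzero)
    then show "((\<lambda>z. of_real (\<theta> t) * schwarz_kernel t z) has_field_derivative of_real (\<theta> t) / (of_real t - x)\<^sup>2) (at x within U)"
      unfolding schwarz_kernel_def
      by (auto intro!: derivative_eq_intros simp: power2_eq_square)
  next
    fix x assume "x \<in> U"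
    then show "(\<lambda>t. of_real (\<theta> t) * schwarz_kernel t x) integrable_on cbox (- real n) (real n)"
      by (intro integrable_continuous continuous_on_schwarz_integrand) (auto simp: U_def \<theta>)
  next
    show "continuous_on (U \<times> cbox (- real n) (real n)) (\<lambda>(x, t). complex_of_real (\<theta> t) / (complex_of_real t - x)\<^sup>2)"
      unfolding split_beta
      using real_minus_upper_nonzero
      by (intro continuous_intros continuous_on_compose2[OF \<theta> continuous_on_snd[OF continuous_on_id]])
        (auto simp: U_def)
  qed (use U in auto)
  from DERIV_cdivide[OF this, of "pi * \<i>"] show ?thesis
    by (simp add: at_within_open[OF U(3,1)] schwarz_trunc_def[abs_def])
qed

lemma norm_real_minus_sq: "(norm (complex_of_real t - z))\<^sup>2 = (t - Re z)\<^sup>2 + (Im z)\<^sup>2"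
  by (simp add: cmod_power2)

lemma arctan_kernel_deriv:
  assumes "y > 0"
  shows "((\<lambda>t. arctan ((t - x) / y)) has_real_derivative y / ((t - x)\<^sup>2 + y\<^sup>2)) (at t)"
proof -
  have "(t - x)\<^sup>2 + y\<^sup>2 \<noteq> 0" using assms by (simp add: sum_power2_eq_zero_iff)
  then show ?thesis
    using assms by (auto intro!: derivative_eq_intros simp: divide_simps) (simp_all add: power2_eq_square algebra_simps)
qed

text \<open>The modulus of \<open>1 / (t - z)^2\<close> has total integral \<open>pi / Im z\<close>
  over the line, and this \<open>pi\<close> cancels the one in the normalisation.\<close>

lemma schwarz_trunc_deriv_bound:
  assumes \<theta>: "continuous_on UNIV \<theta>" "\<And>t. \<bar>\<theta> t\<bar> \<le> B" and z: "Im z > 0"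
  shows "norm (schwarz_trunc' \<theta> n z) \<le> B / Im z"
proof -
  let ?\<phi> = "\<lambda>t. B / Im z * arctan ((t - Re z) / Im z)"
  have B: "B \<ge> 0" using \<theta>(2)[of 0] by linarith
  have "norm (integral {- real n..real n} (\<lambda>t. complex_of_real (\<theta> t) / (of_real t - z)\<^sup>2)) \<le> ?\<phi> (real n) - ?\<phi> (- real n)"
  proof (rule norm_integral_le_antiderivative)
    fix t
    show "(?\<phi> has_real_derivative B / Im z * (Im z / ((t - Re z)\<^sup>2 + (Im z)\<^sup>2))) (at t)"
      by (intro DERIV_cmult arctan_kernel_deriv z)
    show "norm (complex_of_real (\<theta> t) / (of_real t - z)\<^sup>2) \<le> B / Im z * (Im z / ((t - Re z)\<^sup>2 + (Im z)\<^sup>2))"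
      using \<theta>(2) z by (auto simp: norm_divide norm_power norm_real_minus_sq intro!: divide_right_mono)
  qed (auto intro: continuous_on_schwarz_deriv_integrand \<theta> z)
  also have "\<dots> = B / Im z * (arctan ((real n - Re z) / Im z) - arctan ((- real n - Re z) / Im z))"
    by (simp add: algebra_simps)
  also have "\<dots> \<le> B / Im z * pi"
    using B z arctan_ubound[of "(real n - Re z) / Im z"] arctan_lbound[of "(- real n - Re z) / Im z"]
    by (intro mult_left_mono) auto
  finally show ?thesis
    using z by (simp add: norm_divide norm_mult divide_simps)
qed

lemma eight_mult_le_pi: "0 \<le> h \<Longrightarrow> 8 * h \<le> 3 * h * pi"
  using mult_left_mono[of 3 pi h] pi_gt3 by simp

text \<open>Subtract the constant \<open>\<theta> (Re z)\<close>. Its own contribution is exact and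
  consists of boundary terms at \<open>n\<close> and \<open>- n\<close>, which vanish as the cutoff
  grows; the rest obeys the square root kernel bound. Unlike \<open>B / Im z\<close>, the resulting
  majorant is integrable down to the real line.\<close>

lemma schwarz_trunc_deriv_bound_hoelder:
  assumes \<theta>: "continuous_on UNIV \<theta>" "\<And>t. \<bar>\<theta> t\<bar> \<le> B" and z: "Im z > 0"
    and H: "H \<ge> 0" "\<And>t. \<bar>\<theta> t - \<theta> (Re z)\<bar> \<le> H * sqrt \<bar>t - Re z\<bar>" and n: "real n > \<bar>Re z\<bar>"
  shows "norm (schwarz_trunc' \<theta> n z)
     \<le> 3 * H / sqrt (Im z) + B / (n - \<bar>Re z\<bar>)"
proof -
  define x where "x = Re z"
  define I where "I = {- real n..real n}"
  have B: "B \<ge> 0" using \<theta>(2)[of 0] by linarith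
  have nz: "complex_of_real t - z \<noteq> 0" for t
    using z by (rule real_minus_upper_nonzero)
  have c: "continuous_on I (\<lambda>t. complex_of_real (\<theta> t) / (of_real t - z)\<^sup>2)" 
    by (intro continuous_on_schwarz_deriv_integrand \<theta> z)
  have c1: "continuous_on I (\<lambda>t. complex_of_real (\<theta> x) / (of_real t - z)\<^sup>2)" 
    using nz by (auto intro!: continuous_intros)
  have 1: "((\<lambda>t. of_real (\<theta> x) / (complex_of_real t - z)\<^sup>2) has_integral
      (- of_real (\<theta> x) / (complex_of_real n - z) - - of_real (\<theta> x) / (complex_of_real (- real n) - z))) I"
    unfolding I_def
  proof (rule fundamental_theorem_of_calculus)
    fix t 
    have "((\<lambda>w. - of_real (\<theta> x) / (w - z)) has_field_derivative of_real (\<theta> x) / (complex_of_real t - z)\<^sup>2) (at (complex_of_real t))"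
      using nz[of t] by (auto intro!: derivative_eq_intros simp: power2_eq_square)
    from has_vector_derivative_real_field[OF this]
    show "((\<lambda>t. - of_real (\<theta> x) / (complex_of_real t - z)) has_vector_derivative of_real (\<theta> x) / (complex_of_real t - z)\<^sup>2) (at t within {- real n..real n})"
      by simp
  qed simp
  have 2: "norm (integral I (\<lambda>t. complex_of_real (\<theta> t) / (of_real t - z)\<^sup>2 - complex_of_real (\<theta> x) / (of_real t - z)\<^sup>2))
     \<le> 8 * H / sqrt (Im z)"
    unfolding I_def
  proof (rule norm_integral_sqrt_kernel_le[where x = x])
    fix t
    have "norm (complex_of_real (\<theta> t) / (of_real t - z)\<^sup>2 - complex_of_real (\<theta> x) / (of_real t - z)\<^sup>2) = 
       \<bar>\<theta> t - \<theta> x\<bar> / ((t - x)\<^sup>2 + (Im z)\<^sup>2)"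
      by (simp add: diff_divide_distrib[symmetric] norm_divide norm_power norm_real_minus_sq x_def
            flip: of_real_diff)
    also have "\<dots> \<le> H * sqrt \<bar>t - x\<bar> / ((t - x)\<^sup>2 + (Im z)\<^sup>2)"
      using H(2)[of t] by (intro divide_right_mono) (auto simp: x_def)
    finally show "norm (complex_of_real (\<theta> t) / (of_real t - z)\<^sup>2 - complex_of_real (\<theta> x) / (of_real t - z)\<^sup>2) \<le> \<dots>" .
  qed (use n H z c c1 in \<open>auto simp: x_def I_def intro!: continuous_on_diff\<close>)
  have 3: "norm (1 / (complex_of_real n - z)) \<le> 1 / (n - \<bar>x\<bar>)" "norm (1 / (complex_of_real (- real n) - z)) \<le> 1 / (n - \<bar>x\<bar>)"
  proof -
    have "n - \<bar>x\<bar> \<le> norm (complex_of_real n - z)" "n - \<bar>x\<bar> \<le> norm (complex_of_real (- real n) - z)"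
      using abs_Re_le_cmod[of "complex_of_real n - z"] abs_Re_le_cmod[of "complex_of_real (- real n) - z"]
      by (auto simp: x_def)
    then show "norm (1 / (complex_of_real n - z)) \<le> 1 / (n - \<bar>x\<bar>)" "norm (1 / (complex_of_real (- real n) - z)) \<le> 1 / (n - \<bar>x\<bar>)"
      using n by (simp_all add: norm_divide x_def frac_le)
  qed
  have 4: "norm (integral I (\<lambda>t. complex_of_real (\<theta> x) / (of_real t - z)\<^sup>2)) \<le> B * (2 / (n - \<bar>x\<bar>))"
  proof -
    have "integral I (\<lambda>t. complex_of_real (\<theta> x) / (of_real t - z)\<^sup>2) =
       of_real (\<theta> x) * (1 / (complex_of_real (- real n) - z) - 1 / (complex_of_real n - z))"
      using integral_unique[OF 1] by (simp add: algebra_simps)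
    then have "norm (integral I (\<lambda>t. complex_of_real (\<theta> x) / (of_real t - z)\<^sup>2)) =
       \<bar>\<theta> x\<bar> * norm (1 / (complex_of_real (- real n) - z) - 1 / (complex_of_real n - z))"
      by (simp add: norm_mult del: of_real_minus)
    also have "\<dots> \<le> B * (1 / (n - \<bar>x\<bar>) + 1 / (n - \<bar>x\<bar>))"
      using 3 \<theta>(2)[of x] B by (intro mult_mono order.trans[OF norm_triangle_ineq4] add_mono) auto
    finally show ?thesis by simp
  qed
  have "integral I (\<lambda>t. complex_of_real (\<theta> t) / (of_real t - z)\<^sup>2) =
    integral I (\<lambda>t. complex_of_real (\<theta> t) / (of_real t - z)\<^sup>2 - complex_of_real (\<theta> x) / (of_real t - z)\<^sup>2) +
    integral I (\<lambda>t. complex_of_real (\<theta> x) / (of_real t - z)\<^sup>2)"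
    using c c1 by (subst integral_diff) (auto simp: I_def intro!: integrable_continuous_real)
  then have "norm (integral I (\<lambda>t. complex_of_real (\<theta> t) / (of_real t - z)\<^sup>2)) \<le> 8 * H / sqrt (Im z) + B * (2 / (n - \<bar>x\<bar>))"
    by (simp only: order.trans[OF norm_triangle_ineq add_mono[OF 2 4]])
  also have "\<dots> \<le> (3 * H / sqrt (Im z) + B / (n - \<bar>x\<bar>)) * pi"
  proof -
    have "8 * H / sqrt (Im z) \<le> 3 * H / sqrt (Im z) * pi" 
    proof -
      have "0 \<le> H / sqrt (Im z)" using H(1) z by simp
      then show ?thesis
        using eight_mult_le_pi[of "H / sqrt (Im z)"] by simp
    qed
    moreover have "B * (2 / (n - \<bar>x\<bar>)) \<le> B / (n - \<bar>x\<bar>) * pi"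
      using pi_gt3 B n unfolding x_def by (simp add: divide_simps mult_left_mono)
    ultimately show ?thesis by (simp only: distrib_right)
  qed
  finally show ?thesis
    by (simp add: I_def x_def norm_divide norm_mult pos_divide_le_eq)
qed

lemma Im_schwarz_kernel: "Im (schwarz_kernel t z) = Im z / ((t - Re z)\<^sup>2 + (Im z)\<^sup>2)"
  by (simp add: schwarz_kernel_def Im_divide)

text \<open>The comparison value is the truncated Poisson integral of the constant
  \<open>\<theta> (Re z)\<close>, written with arctangents. The difference is again covered by the
  square root kernel bound, now with an additional factor \<open>Im z\<close>.\<close>

lemma schwarz_trunc_Re_bound:
  assumes \<theta>: "continuous_on UNIV \<theta>" and z: "Im z > 0"
    and H: "H \<ge> 0" "\<And>t. \<bar>\<theta> t - \<theta> (Re z)\<bar> \<le> H * sqrt \<bar>t - Re z\<bar>" and n: "real n > \<bar>Re z\<bar>"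
  shows "\<bar>Re (schwarz_trunc \<theta> n z) - \<theta> (Re z) / pi * (arctan ((real n - Re z) / Im z) - arctan ((- real n - Re z) / Im z))\<bar>
     \<le> 3 * H * sqrt (Im z)"
proof -
  define x y where "x = Re z" and "y = Im z"
  define I where "I = {- real n..real n}"
  let ?p = "\<lambda>t. y / ((t - x)\<^sup>2 + y\<^sup>2)"
  have y: "y > 0" using z by (simp add: y_def)
  then have nz: "(t - x)\<^sup>2 + y\<^sup>2 \<noteq> 0" for t by (simp add: sum_power2_eq_zero_iff)
  have cont\<theta>: "continuous_on I \<theta>" using \<theta> by (rule continuous_on_subset) simp
  have contp: "continuous_on I ?p" by (intro continuous_intros) (use nz in auto)
  have "((\<lambda>t. of_real (\<theta> t) * schwarz_kernel t z) has_integral (schwarz_trunc \<theta> n z * (pi * \<i>))) I"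
    unfolding schwarz_trunc_def I_def
    using integrable_continuous_real[OF continuous_on_schwarz_integrand[OF \<theta> z]]
    by (simp add: has_integral_integral)
  from has_integral_linear[OF this bounded_linear_Im]
  have 1: "((\<lambda>t. \<theta> t * ?p t) has_integral (pi * Re (schwarz_trunc \<theta> n z))) I"
    by (simp add: o_def Im_schwarz_kernel x_def y_def mult.commute)
  have 2: "((\<lambda>t. \<theta> x * ?p t) has_integral \<theta> x * (arctan ((real n - x) / y) - arctan ((- real n - x) / y))) I"
    unfolding I_def
    using arctan_kernel_deriv[OF y]
    by (intro has_integral_mult_right fundamental_theorem_of_calculus)
       (auto simp: has_real_derivative_iff_has_vector_derivative intro: has_vector_derivative_at_within)
  define d where "d = pi * Re (schwarz_trunc \<theta> n z) - \<theta> x * (arctan ((real n - x) / y) - arctan ((- real n - x) / y))"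
  have "((\<lambda>t. \<theta> t * ?p t - \<theta> x * ?p t) has_integral d) I"
    unfolding d_def by (intro has_integral_diff 1 2)
  from has_integral_linear[OF this bounded_linear_of_real[where 'a = complex]]
  have 3: "((\<lambda>t. complex_of_real (\<theta> t * ?p t - \<theta> x * ?p t)) has_integral of_real d) I"
    by (simp add: o_def)
  have "norm (integral I (\<lambda>t. complex_of_real (\<theta> t * ?p t - \<theta> x * ?p t))) \<le> 8 * (H * y) / sqrt y"
    unfolding I_def
  proof (rule norm_integral_sqrt_kernel_le[where x = x])
    fix t
    have "norm (complex_of_real (\<theta> t * ?p t - \<theta> x * ?p t)) = \<bar>\<theta> t - \<theta> x\<bar> * ?p t"
      using y by (simp only: norm_of_real left_diff_distrib[symmetric] abs_mult) simp
    also have "\<dots> \<le> (H * sqrt \<bar>t - x\<bar>) * ?p t"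
      using H(2)[of t] y by (intro mult_right_mono) (auto simp: x_def)
    finally show "norm (complex_of_real (\<theta> t * ?p t - \<theta> x * ?p t)) \<le> H * y * sqrt \<bar>t - x\<bar> / ((t - x)\<^sup>2 + y\<^sup>2)"
      by (simp add: mult_ac)
  next
    show "continuous_on {- real n..real n} (\<lambda>t. complex_of_real (\<theta> t * ?p t - \<theta> x * ?p t))"
      using cont\<theta> contp unfolding I_def by (intro continuous_on_of_real continuous_on_diff continuous_on_mult continuous_on_const)
  qed (use y H n in \<open>auto simp: x_def\<close>)
  moreover have "8 * (H * y) / sqrt y = 8 * H * sqrt y"
    using y by (simp add: real_div_sqrt flip: times_divide_eq_right)
  ultimately have "\<bar>d\<bar> \<le> 8 * H * sqrt y"
    using integral_unique[OF 3] by simp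
  also have "\<dots> \<le> 3 * H * sqrt y * pi"
  proof -
    have "0 \<le> H * sqrt y" using H(1) y by simp
    then show ?thesis
      using eight_mult_le_pi[of "H * sqrt y"] by (simp add: mult_ac)
  qed
  finally have "\<bar>d\<bar> / pi \<le> 3 * H * sqrt y"
    by (simp add: pos_divide_le_eq)
  moreover have "\<bar>d\<bar> / pi = \<bar>Re (schwarz_trunc \<theta> n z) - \<theta> x / pi * (arctan ((real n - x) / y) - arctan ((- real n - x) / y))\<bar>"
  proof -
    have "\<bar>d\<bar> / pi = \<bar>d / pi\<bar>" by simp
    also have "d / pi = Re (schwarz_trunc \<theta> n z) - \<theta> x / pi * (arctan ((real n - x) / y) - arctan ((- real n - x) / y))"
      by (simp add: d_def diff_divide_distrib)
    finally show ?thesis .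
  qed
  ultimately show ?thesis unfolding x_def y_def by simp
qed

text \<open>Over a common denominator the terms in \<open>t^2\<close> cancel and the numerator is
  \<open>1 + t * z\<close>. This leaves decay of order \<open>1 / t^2\<close>, enough for bounded
  \<theta>.\<close>

lemma norm_schwarz_kernel_le:
  assumes z: "Im z > 0" and t: "\<bar>t\<bar> \<ge> 1" "\<bar>t\<bar> \<ge> 2 * norm z"
  shows "norm (schwarz_kernel t z) \<le> 2 * (1 + norm z) / t\<^sup>2"
proof -
  have nz: "complex_of_real t - z \<noteq> 0" using z by (rule real_minus_upper_nonzero)
  have nz': "1 + (complex_of_real t)\<^sup>2 \<noteq> 0"
    using one_plus_square_nonzero[of t] by (metis of_real_1 of_real_add of_real_eq_0_iff of_real_power)
  have "schwarz_kernel t z = (1 + of_real t * z) / ((of_real t - z) * of_real (1 + t\<^sup>2))"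
    unfolding schwarz_kernel_def using nz nz' by (simp add: field_simps power2_eq_square)
  then have "norm (schwarz_kernel t z) = norm (1 + of_real t * z) / (norm (of_real t - z) * (1 + t\<^sup>2))"
    by (simp add: norm_divide norm_mult del: of_real_add of_real_power)
  also have "\<dots> \<le> ((1 + norm z) * \<bar>t\<bar>) / ((\<bar>t\<bar> / 2) * t\<^sup>2)"
  proof (rule frac_le)
    have "norm (1 + of_real t * z) \<le> 1 + \<bar>t\<bar> * norm z"
      using norm_triangle_ineq[of 1 "of_real t * z"] by (simp add: norm_mult)
    also have "\<dots> \<le> (1 + norm z) * \<bar>t\<bar>" using t by (simp add: algebra_simps)
    finally show "norm (1 + of_real t * z) \<le> (1 + norm z) * \<bar>t\<bar>" .
    have "\<bar>t\<bar> - norm z \<le> norm (of_real t - z)"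
      using norm_triangle_ineq2[of "of_real t" z] by simp
    then have "\<bar>t\<bar> / 2 \<le> norm (of_real t - z)" using t by linarith
    then show "\<bar>t\<bar> / 2 * t\<^sup>2 \<le> norm (of_real t - z) * (1 + t\<^sup>2)"
      by (intro mult_mono) auto
  qed (use t in auto)
  also have "\<dots> = 2 * (1 + norm z) / t\<^sup>2"
    using t(1) by (simp add: divide_simps)
  finally show ?thesis .
qed

lemma schwarz_trunc_Cauchy:
  assumes \<theta>: "continuous_on UNIV \<theta>" "\<And>t. \<bar>\<theta> t\<bar> \<le> B" and z: "Im z > 0"
    and n: "n \<le> m" "real n \<ge> 2 * norm z" "n \<ge> 1"
  shows "norm (schwarz_trunc \<theta> m z - schwarz_trunc \<theta> n z) \<le> 2 * B * (1 + norm z) / n"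
proof -
  let ?f = "\<lambda>t. of_real (\<theta> t) * schwarz_kernel t z"
  define c where "c = B * (2 * (1 + norm z))"
  have B: "B \<ge> 0" using \<theta>(2)[of 0] by linarith
  have c: "c \<ge> 0" using B by (simp add: c_def)
  have cont: "continuous_on S ?f" for S by (intro continuous_on_schwarz_integrand \<theta> z)
  have int: "?f integrable_on {a..b}" for a b by (intro integrable_continuous_real cont)
  have bd: "norm (?f t) \<le> c / t\<^sup>2" if "\<bar>t\<bar> \<ge> real n" for t
  proof -
    have "norm (?f t) \<le> B * (2 * (1 + norm z) / t\<^sup>2)"
      unfolding norm_mult using that n z \<theta>(2)[of t] B
      by (intro mult_mono norm_schwarz_kernel_le) auto
    then show ?thesis by (simp add: c_def)
  qed
  have D: "((\<lambda>t. - c / t) has_real_derivative c / t\<^sup>2) (at t)" if "t \<noteq> 0" for t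
    using that by (auto intro!: derivative_eq_intros simp: power2_eq_square)
  have 1: "norm (integral {real n..real m} ?f) \<le> - c / real m - - c / real n"
    using n by (intro norm_integral_le_antiderivative[OF _ cont D] bd) auto
  have 2: "norm (integral {- real m..- real n} ?f) \<le> - c / (- real n) - - c / (- real m)"
    using n by (intro norm_integral_le_antiderivative[OF _ cont D] bd) auto
  have "integral {- real m..real m} ?f = integral {- real m..- real n} ?f + integral {- real n..real n} ?f + integral {real n..real m} ?f"
  proof -
    have "integral {- real m..real m} ?f = integral {- real m..real n} ?f + integral {real n..real m} ?f"
      using n by (subst Henstock_Kurzweil_Integration.integral_combine[OF _ _ int]) auto
    also have "integral {- real m..real n} ?f = integral {- real m..- real n} ?f + integral {- real n..real n} ?f"
      using n by (subst Henstock_Kurzweil_Integration.integral_combine[OF _ _ int]) auto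
    finally show ?thesis .
  qed
  then have "schwarz_trunc \<theta> m z - schwarz_trunc \<theta> n z =
     (integral {- real m..- real n} ?f + integral {real n..real m} ?f) / (pi * \<i>)"
    by (simp add: schwarz_trunc_def add_divide_distrib)
  then have "norm (schwarz_trunc \<theta> m z - schwarz_trunc \<theta> n z) =
     norm (integral {- real m..- real n} ?f + integral {real n..real m} ?f) / pi"
    by (simp add: norm_divide norm_mult)
  also have "\<dots> \<le> (2 * c / n) / pi"
  proof (rule divide_right_mono)
    have "0 \<le> c / real m" using c by simp
    then show "norm (integral {- real m..- real n} ?f + integral {real n..real m} ?f) \<le> 2 * c / n"
      using norm_triangle_ineq[of "integral {- real m..- real n} ?f" "integral {real n..real m} ?f"] 1 2 by simp
  qed simp
  also have "\<dots> = (4 / pi) * (B * (1 + norm z) / n)" by (simp add: c_def field_simps)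
  also have "\<dots> \<le> 2 * (B * (1 + norm z) / n)"
    using B pi_gt3 by (intro mult_right_mono) (auto simp: divide_simps)
  finally show ?thesis by simp
qed

text \<open>Exponent 1/2 allows one inequality for all \<open>t\<close>: for \<open>t\<close> near
  \<open>x\<close> it is weaker than a Lipschitz bound, and for distant \<open>t\<close> it follows
  from boundedness. The polynomial dependence on \<open>x\<close> is what makes the growth of the
  Schwarz integral logarithmic.\<close>

locale tempered_phase =
  fixes \<theta> :: "real \<Rightarrow> real" and B C :: real and k :: nat
  assumes continuous: "continuous_on UNIV \<theta>"
    and bounded: "\<bar>\<theta> t\<bar> \<le> B"
    and C_ge_1: "C \<ge> 1"
    and hoelder: "\<bar>\<theta> t - \<theta> x\<bar> \<le> C * (1 + \<bar>x\<bar>) ^ k * sqrt \<bar>t - x\<bar>"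
begin

lemma B_nonneg: "B \<ge> 0"
  using bounded[of 0] by linarith

definition H :: "real \<Rightarrow> real" where
  "H x = C * (1 + \<bar>x\<bar>) ^ k"

lemma H_ge_1: "H x \<ge> 1"
proof -
  have "1 * 1 \<le> C * (1 + \<bar>x\<bar>) ^ k"
    using C_ge_1 by (intro mult_mono one_le_power) auto
  then show ?thesis by (simp add: H_def)
qed

lemma H_hoelder: "\<bar>\<theta> t - \<theta> x\<bar> \<le> H x * sqrt \<bar>t - x\<bar>"
  using hoelder by (simp add: H_def)

definition schwarz :: "complex \<Rightarrow> complex" where
  "schwarz z = lim (\<lambda>n. schwarz_trunc \<theta> n z)"

lemma schwarz_tendsto:
  assumes z: "Im z > 0"
  shows "(\<lambda>n. schwarz_trunc \<theta> n z) \<longlonglongrightarrow> schwarz z"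
proof -
  define c where "c = 2 * B * (1 + norm z)"
  have "Cauchy (\<lambda>n. schwarz_trunc \<theta> n z)"
  proof (rule CauchyI')
    fix e :: real assume e: "e > 0"
    obtain M :: nat where M: "real M > c / e + 2 * norm z + 1"
      using reals_Archimedean2 by blast
    have c: "c \<ge> 0" using B_nonneg by (simp add: c_def)
    have "norm (schwarz_trunc \<theta> m z - schwarz_trunc \<theta> n z) < e" if "m \<ge> M" "n > m" for m n
    proof -
      have ce: "0 \<le> c / e" using c e by simp
      have m: "real m > c / e" "real m \<ge> 2 * norm z" "real m \<ge> 1"
        using M that(1) ce norm_ge_zero[of z] by linarith+
      have "norm (schwarz_trunc \<theta> n z - schwarz_trunc \<theta> m z) \<le> c / m"
        unfolding c_def using that m by (intro schwarz_trunc_Cauchy continuous bounded z) auto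
      also have "\<dots> < e" using m e by (simp add: field_simps)
      finally show ?thesis by (simp add: norm_minus_commute)
    qed
    then show "\<exists>M. \<forall>m\<ge>M. \<forall>n>m. dist (schwarz_trunc \<theta> m z) (schwarz_trunc \<theta> n z) < e"
      by (auto simp: dist_norm)
  qed
  then show ?thesis
    unfolding schwarz_def using Cauchy_convergent convergent_LIMSEQ_iff by blast
qed

lemma norm_schwarz_minus_trunc:
  assumes z: "Im z > 0" and n: "real n \<ge> 2 * norm z" "n \<ge> 1"
  shows "norm (schwarz z - schwarz_trunc \<theta> n z) \<le> 2 * B * (1 + norm z) / n"
proof (rule tendsto_upperbound)
  show "(\<lambda>m. norm (schwarz_trunc \<theta> m z - schwarz_trunc \<theta> n z)) \<longlonglongrightarrow> norm (schwarz z - schwarz_trunc \<theta> n z)"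
    by (intro tendsto_intros schwarz_tendsto z)
  show "\<forall>\<^sub>F m in sequentially. norm (schwarz_trunc \<theta> m z - schwarz_trunc \<theta> n z) \<le> 2 * B * (1 + norm z) / n"
    using eventually_ge_at_top[of n]
    by eventually_elim (intro schwarz_trunc_Cauchy continuous bounded z n)
qed simp

lemma schwarz_trunc_holomorphic: "schwarz_trunc \<theta> n holomorphic_on UHP"
  using schwarz_trunc_deriv[OF continuous]
  by (auto simp: holomorphic_on_open open_halfspace_Im_gt)

lemma schwarz_holomorphic: "schwarz holomorphic_on UHP"
proof (rule holomorphic_uniform_sequence[where f = "schwarz_trunc \<theta>"])
  show "open UHP" by (rule open_halfspace_Im_gt)
  fix w assume "w \<in> UHP"
  then obtain d where d: "d > 0" "cball w d \<subseteq> UHP"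
    using open_halfspace_Im_gt open_contains_cball by metis
  have "uniform_limit (cball w d) (schwarz_trunc \<theta>) schwarz sequentially"
  proof (rule uniform_limitI)
    fix e :: real assume e: "e > 0"
    define r where "r = norm w + d"
    have r: "norm z \<le> r" if "z \<in> cball w d" for z
      using that norm_triangle_ineq2[of z w] by (auto simp: r_def dist_norm norm_minus_commute)
    obtain M :: nat where M: "real M > 2 * B * (1 + r) / e + 2 * r + 1"
      using reals_Archimedean2 by blast
    have r0: "r \<ge> 0" using d by (simp add: r_def)
    have c0: "0 \<le> 2 * B * (1 + r) / e" using B_nonneg r0 e by simp
    show "\<forall>\<^sub>F n in sequentially. \<forall>z\<in>cball w d. dist (schwarz_trunc \<theta> n z) (schwarz z) < e"
      using eventually_ge_at_top[of M]
    proof eventually_elim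
      case (elim n)
      show ?case
      proof
        fix z assume z: "z \<in> cball w d"
        have n: "real n > 2 * B * (1 + r) / e" "real n \<ge> 2 * r" "real n \<ge> 1"
          using elim M c0 r0 by linarith+
        have "norm (schwarz z - schwarz_trunc \<theta> n z) \<le> 2 * B * (1 + norm z) / n"
          using z d n r[OF z] by (intro norm_schwarz_minus_trunc) auto
        also have "\<dots> \<le> 2 * B * (1 + r) / n"
          using B_nonneg r[OF z] by (intro divide_right_mono mult_left_mono) auto
        also have "\<dots> < e" using n e by (simp add: field_simps)
        finally show "dist (schwarz_trunc \<theta> n z) (schwarz z) < e"
          by (simp add: dist_norm norm_minus_commute)
      qed
    qed
  qed
  with d show "\<exists>d. 0 < d \<and> cball w d \<subseteq> UHP \<and> uniform_limit (cball w d) (schwarz_trunc \<theta>) schwarz sequentially"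
    by blast
qed (rule schwarz_trunc_holomorphic)

lemma norm_schwarz_diff_horizontal:
  assumes y: "y > 0"
  shows "norm (schwarz (Complex x' y) - schwarz (Complex x y)) \<le> B * \<bar>x' - x\<bar> / y"
proof (rule tendsto_upperbound)
  show "(\<lambda>n. norm (schwarz_trunc \<theta> n (Complex x' y) - schwarz_trunc \<theta> n (Complex x y))) \<longlonglongrightarrow>
     norm (schwarz (Complex x' y) - schwarz (Complex x y))"
    using y by (intro tendsto_intros schwarz_tendsto) auto
  have "norm (schwarz_trunc \<theta> n (Complex x' y) - schwarz_trunc \<theta> n (Complex x y)) \<le> B / y * norm (Complex x' y - Complex x y)" for n
  proof (rule field_differentiable_bound)
    show "convex {z. Im z = y}" by (auto simp: convex_alt algebra_simps)
    fix z assume "z \<in> {z. Im z = y}"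
    then have z: "Im z = y" by simp
    show "(schwarz_trunc \<theta> n has_field_derivative
      schwarz_trunc' \<theta> n z) (at z within {z. Im z = y})"
      using z y by (intro has_field_derivative_at_within[OF schwarz_trunc_deriv] continuous) auto
    show "norm (schwarz_trunc' \<theta> n z) \<le> B / y"
      using schwarz_trunc_deriv_bound[OF continuous bounded, of z n] z y by simp
  qed auto
  moreover have "norm (Complex x' y - Complex x y) = \<bar>x' - x\<bar>"
    by (simp add: complex_diff cmod_def)
  ultimately show "\<forall>\<^sub>F n in sequentially. norm (schwarz_trunc \<theta> n (Complex x' y) - schwarz_trunc \<theta> n (Complex x y)) \<le> B * \<bar>x' - x\<bar> / y"
    by simp
qed simp

lemma schwarz_trunc_vertical_deriv:
  assumes "y > 0"
  shows "((\<lambda>y. schwarz_trunc \<theta> n (Complex x y)) has_vector_derivative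
    \<i> * (schwarz_trunc' \<theta> n (Complex x y))) (at y)"
proof -
  have "((\<lambda>y. Complex x y) has_vector_derivative \<i>) (at y)"
    unfolding has_vector_derivative_complex_iff by (auto intro!: derivative_eq_intros)
  from field_vector_diff_chain_at[OF this schwarz_trunc_deriv[OF continuous, of "Complex x y" n]] assms
  show ?thesis by (simp add: o_def)
qed

text \<open>The mean value inequality is applied to the truncations. The error
  \<open>c / (n - |x|)\<close> is integrated over a fixed segment and disappears in the limit, so
  any majorant of the truncated derivatives valid up to such an error transfers to
  \<open>schwarz\<close>.\<close>

lemma norm_schwarz_diff_vertical_le:
  assumes y: "0 < y" "y < y'" and cont: "continuous_on {y..y'} \<phi>"
    and \<phi>': "\<And>v. y < v \<Longrightarrow> v < y' \<Longrightarrow> (\<phi> has_real_derivative \<phi>' v) (at v)"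
    and bd: "\<And>n v. \<lbrakk>real n > \<bar>x\<bar>; y < v; v < y'\<rbrakk> \<Longrightarrow> norm (schwarz_trunc' \<theta> n (Complex x v)) \<le> \<phi>' v + c / (n - \<bar>x\<bar>)"
  shows "norm (schwarz (Complex x y') - schwarz (Complex x y)) \<le> \<phi> y' - \<phi> y"
proof -
  let ?d = "\<lambda>n. norm (schwarz_trunc \<theta> n (Complex x y') - schwarz_trunc \<theta> n (Complex x y))"
  have "norm (schwarz (Complex x y') - schwarz (Complex x y)) \<le> \<phi> y' - \<phi> y + 0"
  proof (rule tendsto_le)
    show "?d \<longlonglongrightarrow> norm (schwarz (Complex x y') - schwarz (Complex x y))"
      using y by (intro tendsto_intros schwarz_tendsto) auto
    show "(\<lambda>n. \<phi> y' - \<phi> y + c * (y' - y) / (real n - \<bar>x\<bar>)) \<longlonglongrightarrow> \<phi> y' - \<phi> y + 0"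
      by (intro tendsto_add tendsto_const real_tendsto_divide_at_top[OF tendsto_const])
        (auto intro!: filterlim_tendsto_add_at_top[OF tendsto_const filterlim_real_sequentially, of "- \<bar>x\<bar>", simplified])
    obtain N :: nat where N: "real N > \<bar>x\<bar>" using reals_Archimedean2 by blast
    have le: "?d n \<le> (\<phi> y' + c / (n - \<bar>x\<bar>) * y') - (\<phi> y + c / (n - \<bar>x\<bar>) * y)" if n: "real n > \<bar>x\<bar>" for n :: nat
    proof (rule differentiable_bound_general[where a = y and b = y' and \<phi> = "\<lambda>y. \<phi> y + c / (n - \<bar>x\<bar>) * y"])
      show "continuous_on {y..y'} (\<lambda>y. schwarz_trunc \<theta> n (Complex x y))"
        using y by (intro continuous_at_imp_continuous_on ballI has_vector_derivative_continuous[OF schwarz_trunc_vertical_deriv]) auto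
      show "continuous_on {y..y'} (\<lambda>y. \<phi> y + c / (n - \<bar>x\<bar>) * y)"
        by (intro continuous_intros cont)
      fix v assume v: "y < v" "v < y'"
      show "((\<lambda>y. schwarz_trunc \<theta> n (Complex x y)) has_vector_derivative \<i> * schwarz_trunc' \<theta> n (Complex x v)) (at v)"
        using v y by (intro schwarz_trunc_vertical_deriv) auto
      have "((\<lambda>y. c / (n - \<bar>x\<bar>) * y) has_real_derivative c / (n - \<bar>x\<bar>) * 1) (at v)"
        by (intro DERIV_cmult DERIV_ident)
      from DERIV_add[OF \<phi>'[OF v] this]
      show "((\<lambda>y. \<phi> y + c / (n - \<bar>x\<bar>) * y) has_vector_derivative \<phi>' v + c / (n - \<bar>x\<bar>)) (at v)"
        by (simp add: has_real_derivative_iff_has_vector_derivative)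
      show "norm (\<i> * schwarz_trunc' \<theta> n (Complex x v)) \<le> \<phi>' v + c / (n - \<bar>x\<bar>)"
        using bd[OF n v] by (subst norm_mult) simp
    qed (rule y)
    show "\<forall>\<^sub>F n in sequentially. ?d n \<le> \<phi> y' - \<phi> y + c * (y' - y) / (real n - \<bar>x\<bar>)"
      using eventually_ge_at_top[of N]
    proof eventually_elim
      case (elim n)
      then have "real n > \<bar>x\<bar>" using N by linarith
      from le[OF this] show ?case by (simp add: algebra_simps diff_divide_distrib)
    qed
  qed simp
  then show ?thesis by simp
qed

lemma norm_schwarz_diff_vertical:
  assumes y: "0 < y" "y \<le> y'"
  shows "norm (schwarz (Complex x y') - schwarz (Complex x y)) \<le> B * (ln y' - ln y)"
proof (cases "y = y'")
  case False
  have "norm (schwarz (Complex x y') - schwarz (Complex x y)) \<le> B * ln y' - B * ln y"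
  proof (rule norm_schwarz_diff_vertical_le[where c = 0])
    fix n v assume v: "y < v" "v < y'"
    show "((\<lambda>y. B * ln y) has_real_derivative B / v) (at v)"
      using v y by (auto intro!: derivative_eq_intros)
    show "norm (schwarz_trunc' \<theta> n (Complex x v)) \<le> B / v + 0 / (real n - \<bar>x\<bar>)"
      using schwarz_trunc_deriv_bound[OF continuous bounded, of "Complex x v" n] v y by simp
  qed (use y False in \<open>auto intro!: continuous_intros\<close>)
  then show ?thesis by (simp add: right_diff_distrib)
qed simp

text \<open>The logarithmic bound diverges at the line; this one does not, and it yields the
  boundary values.\<close>

lemma norm_schwarz_diff_vertical_hoelder:
  assumes y: "0 < y" "y \<le> y'"
  shows "norm (schwarz (Complex x y') - schwarz (Complex x y)) \<le> 6 * H x * sqrt (y' - y)"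
proof (cases "y = y'")
  case False
  have "norm (schwarz (Complex x y') - schwarz (Complex x y)) \<le> 6 * H x * sqrt y' - 6 * H x * sqrt y"
  proof (rule norm_schwarz_diff_vertical_le[where c = B])
    fix n v assume v: "y < v" "v < y'"
    show "((\<lambda>y. 6 * H x * sqrt y) has_real_derivative 3 * H x / sqrt v) (at v)"
      using v y by (auto intro!: derivative_eq_intros simp: field_simps)
    assume n: "\<bar>x\<bar> < real n"
    show "norm (schwarz_trunc' \<theta> n (Complex x v)) \<le> 3 * H x / sqrt v + B / (real n - \<bar>x\<bar>)"
      using schwarz_trunc_deriv_bound_hoelder[OF continuous bounded, of "Complex x v" "H x" n] H_hoelder H_ge_1[of x] n v y
      by simp
  qed (use y False in \<open>auto intro!: continuous_intros\<close>)
  also have "\<dots> = 6 * H x * (sqrt y' - sqrt y)" by (simp add: right_diff_distrib)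
  also have "\<dots> \<le> 6 * H x * sqrt (y' - y)"
    using sqrt_add_le_add_sqrt[of y "y' - y"] y H_ge_1[of x] by (intro mult_left_mono) auto
  finally show ?thesis .
qed simp

text \<open>As the cutoff tends to infinity the arctangents tend to \<open>pi / 2\<close> and
  \<open>- pi / 2\<close>, so the comparison value becomes \<open>\<theta> x\<close> itself.\<close>

lemma Re_schwarz_bound:
  assumes y: "y > 0"
  shows "\<bar>Re (schwarz (Complex x y)) - \<theta> x\<bar> \<le> 3 * H x * sqrt y"
proof (rule tendsto_upperbound)
  have l1: "filterlim (\<lambda>n. (real n - x) / y) at_top sequentially"
    using y by real_asymp
  have l2: "filterlim (\<lambda>n. (- real n - x) / y) at_bot sequentially"
    using y by real_asymp
  have "(\<lambda>n. Re (schwarz_trunc \<theta> n (Complex x y)) - \<theta> x / pi * (arctan ((real n - x) / y) - arctan ((- real n - x) / y)))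
     \<longlonglongrightarrow> Re (schwarz (Complex x y)) - \<theta> x / pi * (pi / 2 - (- (pi / 2)))"
    using y by (intro tendsto_intros schwarz_tendsto filterlim_compose[OF tendsto_arctan_at_top l1]
      filterlim_compose[OF tendsto_arctan_at_bot l2]) auto
  from tendsto_rabs[OF this]
  show "(\<lambda>n. \<bar>Re (schwarz_trunc \<theta> n (Complex x y)) - \<theta> x / pi * (arctan ((real n - x) / y) - arctan ((- real n - x) / y))\<bar>)
     \<longlonglongrightarrow> \<bar>Re (schwarz (Complex x y)) - \<theta> x\<bar>"
    by simp
  obtain N :: nat where N: "real N > \<bar>x\<bar>" using reals_Archimedean2 by blast
  show "\<forall>\<^sub>F n in sequentially. \<bar>Re (schwarz_trunc \<theta> n (Complex x y)) - \<theta> x / pi * (arctan ((real n - x) / y) - arctan ((- real n - x) / y))\<bar> \<le> 3 * H x * sqrt y"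
    using eventually_ge_at_top[of N]
  proof eventually_elim
    case (elim n)
    then have "real n > \<bar>x\<bar>" using N by linarith
    then show ?case
      using schwarz_trunc_Re_bound[OF continuous, of "Complex x y" "H x" n] H_hoelder H_ge_1[of x] y by simp
  qed
qed simp

end

text \<open>The radius of the local extension may depend on the point. That suffices for continuity
  on the closed half-plane, for real-analytic boundary values and for division by real
  roots.\<close>

definition upper_analytic :: "(complex \<Rightarrow> complex) \<Rightarrow> bool" where
  "upper_analytic f \<longleftrightarrow> f holomorphic_on UHP \<and>
     (\<forall>x::real. extends_at x f)"

section \<open>Boundary values of the Schwarz integral, its growth, and reflection across the
  line\<close>

context tempered_phase
begin

abbreviation shift :: "nat \<Rightarrow> complex \<Rightarrow> complex" where
  "shift m z \<equiv> Complex (Re z) (Im z + inverse (real (Suc m)))"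

text \<open>Approaching interior points from above as well gives one formula for the whole closed
  half-plane. The convergence is uniform on bounded parts of it, which yields continuity up to the
  line.\<close>

definition ext :: "complex \<Rightarrow> complex" where
  "ext z = lim (\<lambda>m. schwarz (shift m z))"

lemma schwarz_shift_tendsto_ext:
  assumes z: "Im z \<ge> 0"
  shows "(\<lambda>m. schwarz (shift m z)) \<longlonglongrightarrow> ext z"
proof -
  let ?f = "\<lambda>m. schwarz (shift m z)"
  have le: "norm (?f m - ?f n) \<le> 6 * H (Re z) * sqrt (inverse (real (Suc m)))" if "m \<le> n" for m n
  proof -
    have inv: "0 < inverse (real (Suc n))" "inverse (real (Suc n)) \<le> inverse (real (Suc m))"
      using that by (auto intro: le_imp_inverse_le)
    have "norm (?f m - ?f n) \<le> 6 * H (Re z) * sqrt ((Im z + inverse (real (Suc m))) - (Im z + inverse (real (Suc n))))"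
      using z inv by (intro norm_schwarz_diff_vertical_hoelder add_nonneg_pos add_left_mono) auto
    also have "\<dots> \<le> 6 * H (Re z) * sqrt (inverse (real (Suc m)))"
      using inv H_ge_1[of "Re z"] by (intro mult_left_mono) auto
    finally show ?thesis .
  qed
  have "Cauchy ?f"
  proof (rule CauchyI')
    fix e :: real assume e: "e > 0"
    have "(\<lambda>m. 6 * H (Re z) * sqrt (inverse (real (Suc m)))) \<longlonglongrightarrow> 6 * H (Re z) * sqrt 0"
      by (intro tendsto_intros LIMSEQ_inverse_real_of_nat)
    then have "\<forall>\<^sub>F m in sequentially. 6 * H (Re z) * sqrt (inverse (real (Suc m))) < e"
      using e by (intro order_tendstoD) auto
    then obtain M where M: "\<And>m. m \<ge> M \<Longrightarrow> 6 * H (Re z) * sqrt (inverse (real (Suc m))) < e"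
      by (auto simp: eventually_sequentially)
    have "dist (?f m) (?f n) < e" if "m \<ge> M" "n > m" for m n
      using le[of m n] M[of m] that by (simp add: dist_norm)
    then show "\<exists>M. \<forall>m\<ge>M. \<forall>n>m. dist (?f m) (?f n) < e" by blast
  qed
  then show ?thesis
    unfolding ext_def using Cauchy_convergent convergent_LIMSEQ_iff by blast
qed

lemma norm_schwarz_minus_ext:
  assumes z: "Im z \<ge> 0" and \<eta>: "\<eta> > 0"
  shows "norm (schwarz (Complex (Re z) (Im z + \<eta>)) - ext z) \<le> 6 * H (Re z) * sqrt \<eta>"
proof (rule tendsto_upperbound)
  show "(\<lambda>m. norm (schwarz (Complex (Re z) (Im z + \<eta>)) - schwarz (shift m z)))
    \<longlonglongrightarrow> norm (schwarz (Complex (Re z) (Im z + \<eta>)) - ext z)"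
    by (intro tendsto_intros schwarz_shift_tendsto_ext z)
  have "\<forall>\<^sub>F m in sequentially. inverse (real (Suc m)) < \<eta>"
    using \<eta> LIMSEQ_inverse_real_of_nat by (intro order_tendstoD) auto
  then show "\<forall>\<^sub>F m in sequentially. norm (schwarz (Complex (Re z) (Im z + \<eta>)) - schwarz (shift m z))
     \<le> 6 * H (Re z) * sqrt \<eta>"
  proof eventually_elim
    case (elim m)
    have pos: "0 < inverse (real (Suc m))" by simp
    have "norm (schwarz (Complex (Re z) (Im z + \<eta>)) - schwarz (shift m z))
       \<le> 6 * H (Re z) * sqrt ((Im z + \<eta>) - (Im z + inverse (real (Suc m))))"
      using z elim pos by (intro norm_schwarz_diff_vertical_hoelder add_nonneg_pos) auto
    also have "\<dots> \<le> 6 * H (Re z) * sqrt \<eta>"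
      using pos H_ge_1[of "Re z"] by (intro mult_left_mono) (auto simp del: of_nat_Suc)
    finally show ?case .
  qed
qed simp

lemma ext_eq_schwarz:
  assumes z: "Im z > 0"
  shows "ext z = schwarz z"
proof -
  have "continuous_on UHP schwarz"
    by (intro holomorphic_on_imp_continuous_on schwarz_holomorphic)
  then have "isCont schwarz z"
    using z by (simp add: continuous_on_eq_continuous_at open_halfspace_Im_gt)
  moreover have "(\<lambda>m. shift m z) \<longlonglongrightarrow> Complex (Re z) (Im z + 0)"
    by (intro tendsto_Complex tendsto_intros LIMSEQ_inverse_real_of_nat)
  ultimately have "(\<lambda>m. schwarz (shift m z)) \<longlonglongrightarrow> schwarz z"
    by (intro isCont_tendsto_compose[of z schwarz]) auto
  then show ?thesis
    using schwarz_shift_tendsto_ext[of z] z LIMSEQ_unique by auto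
qed

lemma ext_holomorphic: "ext holomorphic_on UHP"
  using schwarz_holomorphic by (rule holomorphic_transform) (auto simp: ext_eq_schwarz)

lemma H_mono: "\<bar>x\<bar> \<le> \<bar>y\<bar> \<Longrightarrow> H x \<le> H y"
  using C_ge_1 by (auto simp: H_def intro!: mult_left_mono power_mono)

lemma continuous_on_ext: "continuous_on cUHP ext"
proof -
  have cont: "continuous_on (cUHP \<inter> ball 0 r) ext" for r
  proof (rule uniform_limit_theorem)
    show "uniform_limit (cUHP \<inter> ball 0 r) (\<lambda>m z. schwarz (shift m z)) ext sequentially"
    proof (rule uniform_limitI)
      fix e :: real assume e: "e > 0"
      have "(\<lambda>m. 6 * H r * sqrt (inverse (real (Suc m)))) \<longlonglongrightarrow> 6 * H r * sqrt 0"
        by (intro tendsto_intros LIMSEQ_inverse_real_of_nat)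
      then have "\<forall>\<^sub>F m in sequentially. 6 * H r * sqrt (inverse (real (Suc m))) < e"
        using e by (intro order_tendstoD) auto
      then show "\<forall>\<^sub>F m in sequentially. \<forall>z\<in>cUHP \<inter> ball 0 r.
           dist (schwarz (shift m z)) (ext z) < e"
      proof eventually_elim
        case (elim m)
        show ?case
        proof
          fix z assume z: "z \<in> cUHP \<inter> ball 0 r"
          then have "H (Re z) \<le> H r"
            using abs_Re_le_cmod[of z] by (intro H_mono) auto
          have "dist (schwarz (shift m z)) (ext z) \<le> 6 * H (Re z) * sqrt (inverse (real (Suc m)))"
            unfolding dist_norm using z by (intro norm_schwarz_minus_ext) auto
          also have "\<dots> \<le> 6 * H r * sqrt (inverse (real (Suc m)))"
            using \<open>H (Re z) \<le> H r\<close> by (intro mult_right_mono) auto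
          also note elim
          finally show "dist (schwarz (shift m z)) (ext z) < e" .
        qed
      qed
    qed
    show "\<forall>\<^sub>F m in sequentially. continuous_on (cUHP \<inter> ball 0 r) (\<lambda>z. schwarz (shift m z))"
    proof (intro always_eventually allI)
      fix m
      show "continuous_on (cUHP \<inter> ball 0 r) (\<lambda>z. schwarz (shift m z))"
      proof (rule continuous_on_compose2[OF holomorphic_on_imp_continuous_on[OF schwarz_holomorphic]])
        show "continuous_on (cUHP \<inter> ball 0 r) (\<lambda>z. shift m z)"
          by (intro continuous_on_Complex continuous_intros)
        show "(\<lambda>z. shift m z) ` (cUHP \<inter> ball 0 r) \<subseteq> UHP"
          by (auto intro!: add_nonneg_pos)
      qed
    qed
  qed simp
  show ?thesis
    unfolding continuous_on_eq_continuous_within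
  proof
    fix z assume z: "z \<in> cUHP"
    have "continuous (at z within cUHP \<inter> ball 0 (norm z + 1)) ext"
      using cont[of "norm z + 1"] z by (simp add: continuous_on_eq_continuous_within)
    moreover have "at z within cUHP \<inter> ball 0 (norm z + 1) = at z within cUHP"
      by (rule at_within_nhd[of _ "ball 0 (norm z + 1)"]) auto
    ultimately show "continuous (at z within cUHP) ext" by simp
  qed
qed

lemma Re_ext_of_real: "Re (ext (of_real x)) = \<theta> x"
proof -
  have "(\<lambda>m. Re (schwarz (Complex x (inverse (real (Suc m))))) - \<theta> x) \<longlonglongrightarrow> Re (ext (of_real x)) - \<theta> x"
    using schwarz_shift_tendsto_ext[of "of_real x"] by (intro tendsto_intros) simp
  moreover have "(\<lambda>m. Re (schwarz (Complex x (inverse (real (Suc m))))) - \<theta> x) \<longlonglongrightarrow> 0"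
  proof (rule Lim_null_comparison)
    show "\<forall>\<^sub>F m in sequentially. norm (Re (schwarz (Complex x (inverse (real (Suc m))))) - \<theta> x) \<le> 3 * H x * sqrt (inverse (real (Suc m)))"
      using Re_schwarz_bound by simp
    have "(\<lambda>m. 3 * H x * sqrt (inverse (real (Suc m)))) \<longlonglongrightarrow> 3 * H x * sqrt 0"
      by (intro tendsto_intros LIMSEQ_inverse_real_of_nat)
    then show "(\<lambda>m. 3 * H x * sqrt (inverse (real (Suc m)))) \<longlonglongrightarrow> 0" by simp
  qed
  ultimately show ?thesis using LIMSEQ_unique by fastforce
qed

text \<open>The route from \<open>z\<close> to \<open>\<i>\<close> goes up to height
  \<open>y1\<close>, vertically to height \<open>1 + |x|\<close>, horizontally to the imaginary
  axis, and vertically to \<open>\<i>\<close>. At height \<open>1 + |x|\<close> the horizontal move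
  costs only \<open>B\<close>, so all growth comes from the logarithms of the vertical
  moves.\<close>

lemma norm_ext_le:
  assumes z: "Im z \<ge> 0"
  shows "norm (ext z) \<le> (norm (schwarz \<i>) + 6 + B + 2 * B * ln C) + B * (3 + 2 * real k) * ln (1 + norm z)"
proof -
  define x y where "x = Re z" and "y = Im z"
  define S where "S = 1 + \<bar>x\<bar>"
  \<comment> \<open>At height \<open>1 / (H x)^2\<close> the Hoelder estimate costs exactly 6, while
    the logarithm of this height is only \<open>- 2 * ln (H x)\<close>, hence logarithmic in
    \<open>1 + |x|\<close>.\<close>
  define y1 where "y1 = max y (1 / (H x)\<^sup>2)"
  have h: "H x \<ge> 1" by (rule H_ge_1)
  have S: "S \<ge> 1" "S \<le> 1 + norm z" using abs_Re_le_cmod[of z] by (auto simp: S_def x_def)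
  have y1: "y1 > 0" "y \<le> y1" "1 / (H x)\<^sup>2 \<le> y1" using h by (auto simp: y1_def less_max_iff_disj)
  have "1 / (H x)\<^sup>2 \<le> 1" using h by simp
  then have y1': "y1 \<le> 1 + norm z"
    using abs_Im_le_cmod[of z] by (auto simp: y1_def y_def intro: order.trans)
  have zxy: "Complex x y = z" by (simp add: x_def y_def)
  have 1: "norm (schwarz (Complex x y1) - ext z) \<le> 6"
  proof (cases "y1 = y")
    case True
    then show ?thesis using y1 zxy ext_eq_schwarz[of z] by (auto simp: y_def)
  next
    case False
    then have y1_eq: "y1 = 1 / (H x)\<^sup>2" and "y1 > y" using y1 by (auto simp: y1_def)
    have "norm (schwarz (Complex (Re z) (Im z + (y1 - y))) - ext z) \<le> 6 * H (Re z) * sqrt (y1 - y)"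
      using \<open>y1 > y\<close> z by (intro norm_schwarz_minus_ext) auto
    also have "\<dots> \<le> 6 * H (Re z) * sqrt (1 / (H x)\<^sup>2)"
      using h z y1_eq by (intro mult_left_mono) (auto simp: x_def y_def)
    also have "\<dots> = 6" using h by (simp add: real_sqrt_divide x_def)
    finally show ?thesis by (simp add: x_def y_def)
  qed
  have 2: "norm (schwarz (Complex x y1) - schwarz (Complex x S)) \<le> B * (ln S + (2 * ln (H x) + ln (1 + norm z)))"
  proof -
    have lnS: "ln S \<ge> 0" using S by simp
    have "ln (1 / (H x)\<^sup>2) \<le> ln y1" using y1 h by (subst ln_le_cancel_iff) auto
    then have l1: "- 2 * ln (H x) \<le> ln y1"
      using h by (simp add: ln_div ln_realpow)
    have l2: "ln y1 \<le> ln (1 + norm z)" using y1 y1' by simp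
    have l3: "0 \<le> ln (H x)" "0 \<le> ln (1 + norm z)" using h by auto
    have "norm (schwarz (Complex x y1) - schwarz (Complex x S)) \<le> B * \<bar>ln y1 - ln S\<bar>"
    proof (cases "y1 \<le> S")
      case True
      then show ?thesis 
        using norm_schwarz_diff_vertical[of y1 S x] y1 by (simp add: norm_minus_commute abs_real_def)
    next
      case False
      then show ?thesis 
        using norm_schwarz_diff_vertical[of S y1 x] y1 S by (simp add: abs_real_def)
    qed
    also have "\<dots> \<le> B * (ln S + (2 * ln (H x) + ln (1 + norm z)))"
      using B_nonneg lnS l1 l2 l3 by (intro mult_left_mono) linarith+
    finally show ?thesis .
  qed
  have 3: "norm (schwarz (Complex x S) - schwarz (Complex 0 S)) \<le> B"
  proof -
    have "norm (schwarz (Complex x S) - schwarz (Complex 0 S)) \<le> B * \<bar>x - 0\<bar> / S"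
      using S by (intro norm_schwarz_diff_horizontal) auto
    also have "\<dots> \<le> B" using B_nonneg S by (simp add: S_def divide_simps mult_left_mono)
    finally show ?thesis .
  qed
  have 4: "norm (schwarz (Complex 0 S) - schwarz \<i>) \<le> B * ln S"
    using norm_schwarz_diff_vertical[of 1 S 0] S by (simp add: Complex_eq)
  have lnH: "ln (H x) = ln C + k * ln S"
    using C_ge_1 S by (simp add: H_def S_def ln_mult ln_realpow)
  have "norm (ext z) \<le> norm (schwarz (Complex x y1) - ext z) + norm (schwarz (Complex x y1) - schwarz (Complex x S))
     + norm (schwarz (Complex x S) - schwarz (Complex 0 S)) + norm (schwarz (Complex 0 S) - schwarz \<i>) + norm (schwarz \<i>)"
    by (smt (verit, ccfv_SIG) norm_minus_commute norm_triangle_sub)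
  also have "\<dots> \<le> 6 + B * (ln S + (2 * (ln C + k * ln S) + ln (1 + norm z))) + B + B * ln S + norm (schwarz \<i>)"
    using 1 2 3 4 lnH by (intro add_mono) auto
  also have "\<dots> = norm (schwarz \<i>) + 6 + B + 2 * B * ln C + B * ((2 + 2 * k) * ln S + ln (1 + norm z))"
    by (simp add: algebra_simps)
  also have "\<dots> \<le> norm (schwarz \<i>) + 6 + B + 2 * B * ln C + B * ((2 + 2 * k) * ln (1 + norm z) + ln (1 + norm z))"
    using B_nonneg S by (intro add_mono mult_left_mono) auto
  finally show ?thesis by (simp add: algebra_simps)
qed

lemma ext_local_extension:
  assumes r: "r > 0" and hol: "\<Theta> holomorphic_on rball x r"
    and \<Theta>: "\<And>t. \<bar>t - x\<bar> < r \<Longrightarrow> \<Theta> (of_real t) = of_real (\<theta> t)"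
  shows "\<exists>F. F holomorphic_on rball x r \<and> (\<forall>z \<in> rball x r. Im z \<ge> 0 \<longrightarrow> F z = ext z)"
proof -
  define S where "S = rball x r"
  \<comment> \<open>On the line \<open>ext\<close> and \<open>\<Theta>\<close> have the same real
    part, so \<open>f\<close> is real there and can be reflected; \<open>ext\<close> is then
    recovered as \<open>\<Theta> - \<i> * f\<close>.\<close>
  define f where "f = (\<lambda>z. \<i> * (ext z - \<Theta> z))"
  define g where "g = (\<lambda>z. if 0 \<le> Im z then f z else cnj (f (cnj z)))"
  have "g holomorphic_on S"
    unfolding g_def
  proof (rule Schwarz_reflection)
    show "open S" by (simp add: S_def)
    show "cnj ` S \<subseteq> S"
      by (auto simp: S_def dist_norm) (metis complex_cnj_complex_of_real complex_cnj_diff complex_mod_cnj)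
    show "f holomorphic_on S \<inter> UHP"
      unfolding f_def using holomorphic_on_subset[OF ext_holomorphic] holomorphic_on_subset[OF hol]
      by (intro holomorphic_intros) (auto simp: S_def)
    show "continuous_on (S \<inter> cUHP) f"
      unfolding f_def using continuous_on_subset[OF continuous_on_ext]
        continuous_on_subset[OF holomorphic_on_imp_continuous_on[OF hol]]
      by (intro continuous_intros) (auto simp: S_def)
    fix z assume z: "z \<in> S" "z \<in> \<real>"
    then obtain t where t: "z = of_real t" by (auto elim: Reals_cases)
    have "\<bar>t - x\<bar> < r"
      using z(1) unfolding S_def t by (simp add: dist_norm abs_minus_commute flip: of_real_diff)
    then have "Im (f z) = 0" by (simp add: f_def t \<Theta> Re_ext_of_real)
    then show "f z \<in> \<real>" by (simp add: complex_is_Real_iff)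
  qed
  then have "(\<lambda>z. \<Theta> z - \<i> * g z) holomorphic_on S"
    using hol unfolding S_def by (intro holomorphic_intros) auto
  moreover have "\<Theta> z - \<i> * g z = ext z" if "Im z \<ge> 0" for z
    using that by (simp add: g_def f_def algebra_simps flip: mult.assoc)
  ultimately show ?thesis unfolding S_def by blast
qed

end

section \<open>Functions analytic up to the real line\<close>

lemma upper_analyticI:
  assumes "f holomorphic_on UHP"
    and "\<And>x::real. extends_at x f"
  shows "upper_analytic f"
  using assms by (auto simp: upper_analytic_def)

lemma upper_analyticD:
  assumes "upper_analytic f"
  obtains r F where "r > 0" "F holomorphic_on rball x r"
    "\<And>z. z \<in> rball x r \<Longrightarrow> Im z \<ge> 0 \<Longrightarrow> F z = f z"
  using assms unfolding upper_analytic_def by blast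

lemma upper_analytic_mult:
  assumes "upper_analytic f" "upper_analytic g"
  shows "upper_analytic (\<lambda>z. f z * g z)"
proof (rule upper_analyticI)
  show "(\<lambda>z. f z * g z) holomorphic_on UHP"
    using assms by (auto simp: upper_analytic_def intro: holomorphic_on_mult)
  fix x :: real
  obtain r F where F: "r > 0" "F holomorphic_on rball x r"
    "\<And>z. z \<in> rball x r \<Longrightarrow> Im z \<ge> 0 \<Longrightarrow> F z = f z"
    using upper_analyticD[OF assms(1), of "x"] by blast
  obtain s G where G: "s > 0" "G holomorphic_on rball x s"
    "\<And>z. z \<in> rball x s \<Longrightarrow> Im z \<ge> 0 \<Longrightarrow> G z = g z"
    using upper_analyticD[OF assms(2), of "x"] by blast
  have "(\<lambda>z. F z * G z) holomorphic_on rball x (min r s)"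
    by (intro holomorphic_on_mult holomorphic_on_subset[OF F(2)] holomorphic_on_subset[OF G(2)]) auto
  moreover have "F z * G z = f z * g z" if "z \<in> rball x (min r s)" "Im z \<ge> 0" for z
    using that F(3) G(3) by auto
  ultimately show "extends_at x (\<lambda>z. f z * g z)"
    using F(1) G(1) by (intro exI[of _ "min r s"] conjI exI[of _ "\<lambda>z. F z * G z"]) auto
qed

lemma upper_analytic_exp:
  assumes "upper_analytic f"
  shows "upper_analytic (\<lambda>z. exp (\<i> * f z))"
proof (rule upper_analyticI)
  show "(\<lambda>z. exp (\<i> * f z)) holomorphic_on UHP"
    using assms by (auto simp: upper_analytic_def intro!: holomorphic_intros)
  fix x :: real
  obtain r F where F: "r > 0" "F holomorphic_on rball x r"
    "\<And>z. z \<in> rball x r \<Longrightarrow> Im z \<ge> 0 \<Longrightarrow> F z = f z"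
    using upper_analyticD[OF assms(1), of "x"] by blast
  then show "extends_at x (\<lambda>z. exp (\<i> * f z))"
    by (intro exI[of _ r] conjI exI[of _ "\<lambda>z. exp (\<i> * F z)"]) (auto intro!: holomorphic_intros)
qed

lemma upper_analytic_continuous_on:
  assumes "upper_analytic f"
  shows "continuous_on cUHP f"
  unfolding continuous_on_eq_continuous_within
proof
  fix z assume z: "z \<in> cUHP"
  show "continuous (at z within cUHP) f"
  proof (cases "Im z > 0")
    case True
    have "continuous_on UHP f"
      using assms by (auto simp: upper_analytic_def intro: holomorphic_on_imp_continuous_on)
    then have "isCont f z"
      using True by (simp add: continuous_on_eq_continuous_at open_halfspace_Im_gt)
    then show ?thesis by (rule continuous_at_imp_continuous_within)
  next
    case False
    then have "z \<in> \<real>" using z by (simp add: complex_is_Real_iff)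
    then obtain x where x: "z = of_real x" by (rule Reals_cases)
    obtain r F where F: "r > 0" "F holomorphic_on rball x r"
      "\<And>w. w \<in> rball x r \<Longrightarrow> Im w \<ge> 0 \<Longrightarrow> F w = f w"
      using upper_analyticD[OF assms(1), of x] by blast
    have "isCont F (of_real x)"
      using F(1,2) by (metis centre_in_ball continuous_on_eq_continuous_at holomorphic_on_imp_continuous_on open_ball)
    then have "continuous (at z within cUHP) F"
      unfolding x by (rule continuous_at_imp_continuous_within)
    then show ?thesis
    proof (rule continuous_transform_within[OF _ F(1) z])
      fix w assume "w \<in> cUHP" "dist w z < r"
      then show "F w = f w" using F(3)[of w] by (simp add: x dist_commute)
    qed
  qed
qed

lemma upper_analytic_real_analytic:
  assumes "upper_analytic f"
  shows "real_analytic (\<lambda>x. f (of_real x))"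
  unfolding real_analytic_def
proof
  fix x :: real
  obtain r F where F: "r > 0" "F holomorphic_on rball x r"
    "\<And>z. z \<in> rball x r \<Longrightarrow> Im z \<ge> 0 \<Longrightarrow> F z = f z"
    using upper_analyticD[OF assms, of "x"] by blast
  have "(\<lambda>n. (y - x) ^ n *\<^sub>R ((deriv ^^ n) F (of_real x) / fact n)) sums f (of_real y)" if "\<bar>y - x\<bar> < r" for y
  proof -
    have y: "complex_of_real y \<in> rball x r"
      using that by (simp add: dist_norm abs_minus_commute flip: of_real_diff)
    from holomorphic_power_series[OF F(2) this] F(3)[OF y] show ?thesis
      by (simp add: scaleR_conv_of_real mult.commute)
  qed
  with F(1) show "\<exists>r>0. \<exists>a. \<forall>y. \<bar>y - x\<bar> < r \<longrightarrow> (\<lambda>n. (y - x) ^ n *\<^sub>R a n) sums f (of_real y)"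
    by (intro exI[of _ r] conjI exI[of _ "\<lambda>n. (deriv ^^ n) F (of_real x) / fact n"]) auto
qed

text \<open>At \<mu> the difference quotient of the local extension is holomorphic; near any other
  real point a smaller disc avoids \<mu>.\<close>

lemma upper_analytic_divide_root:
  assumes f: "upper_analytic f" and root: "f (of_real \<mu>) = 0"
  shows "\<exists>g. upper_analytic g \<and> (\<forall>z. Im z \<ge> 0 \<longrightarrow> f z = (z - of_real \<mu>) * g z)"
proof -
  obtain r F where F: "r > 0" "F holomorphic_on rball \<mu> r"
    "\<And>z. z \<in> rball \<mu> r \<Longrightarrow> Im z \<ge> 0 \<Longrightarrow> F z = f z"
    using upper_analyticD[OF f, of "\<mu>"] by blast
  define g where "g z = (if z = of_real \<mu> then deriv F (of_real \<mu>) else f z / (z - of_real \<mu>))" for z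
  have "upper_analytic g"
  proof (rule upper_analyticI)
    have "(\<lambda>z. f z / (z - of_real \<mu>)) holomorphic_on UHP"
      using f by (auto simp: upper_analytic_def intro!: holomorphic_intros)
    then show "g holomorphic_on UHP"
      by (rule holomorphic_transform) (auto simp: g_def)
    fix x :: real
    show "extends_at x g"
    proof (cases "x = \<mu>")
      case True
      have "F (of_real \<mu>) = 0" using F(1) F(3)[of "of_real \<mu>"] root by simp
      moreover have "(\<lambda>z. if z = of_real \<mu> then deriv F (of_real \<mu>) else (F z - F (of_real \<mu>)) / (z - of_real \<mu>)) holomorphic_on rball \<mu> r"
        using F(2) by (rule pole_lemma_open) simp
      ultimately show ?thesis
        using F(1,3) unfolding True
        by (intro exI[of _ r] conjI exI[of _ "\<lambda>z. if z = of_real \<mu> then deriv F (of_real \<mu>) else (F z - F (of_real \<mu>)) / (z - of_real \<mu>)"])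
          (auto simp: g_def)
    next
      case False
      obtain s G where G: "s > 0" "G holomorphic_on rball x s"
        "\<And>z. z \<in> rball x s \<Longrightarrow> Im z \<ge> 0 \<Longrightarrow> G z = f z"
        using upper_analyticD[OF f, of "x"] by blast
      define t where "t = min s \<bar>x - \<mu>\<bar>"
      have \<mu>: "complex_of_real \<mu> \<notin> rball x t"
        by (simp add: t_def dist_norm flip: of_real_diff)
      have "(\<lambda>z. G z / (z - of_real \<mu>)) holomorphic_on rball x t"
        using \<mu> by (intro holomorphic_intros holomorphic_on_subset[OF G(2)]) (auto simp: t_def)
      moreover have "G z / (z - of_real \<mu>) = g z" if "z \<in> rball x t" "Im z \<ge> 0" for z
        using G(3)[of z] that \<mu> by (auto simp: g_def t_def)
      moreover have "t > 0" using G(1) False by (simp add: t_def)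
      ultimately show ?thesis by blast
    qed
  qed
  moreover have "f z = (z - of_real \<mu>) * g z" if "Im z \<ge> 0" for z
    using root by (simp add: g_def)
  ultimately show ?thesis by blast
qed

lemma upper_analytic_divide_roots:
  assumes "finite M" "upper_analytic f" "\<And>\<mu>. \<mu> \<in> M \<Longrightarrow> f (of_real \<mu>) = 0"
  shows "\<exists>g. upper_analytic g \<and> (\<forall>z. Im z \<ge> 0 \<longrightarrow> f z = (\<Prod>\<mu>\<in>M. z - of_real \<mu>) * g z)"
  using assms
proof (induction M rule: finite_induct)
  case (insert \<mu> M)
  then obtain g where g: "upper_analytic g" "\<And>z. Im z \<ge> 0 \<Longrightarrow> f z = (\<Prod>\<mu>\<in>M. z - of_real \<mu>) * g z"
    by auto
  have "(\<Prod>\<nu>\<in>M. complex_of_real \<mu> - of_real \<nu>) \<noteq> 0"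
    using insert.hyps by auto
  then have "g (of_real \<mu>) = 0"
    using g(2)[of "of_real \<mu>"] insert.prems(2)[of \<mu>] by simp
  from upper_analytic_divide_root[OF g(1) this] obtain h where
    "upper_analytic h" "\<And>z. Im z \<ge> 0 \<Longrightarrow> g z = (z - of_real \<mu>) * h z" by blast
  with g insert.hyps show ?case
    by (intro exI[of _ h]) (auto simp: mult_ac)
qed auto

text \<open>Continuity of the cofactor at the root is enough; it need not be differentiable.\<close>

lemma has_vector_derivative_at_root:
  fixes f r :: "real \<Rightarrow> complex"
  assumes "\<And>y. \<bar>y - x\<bar> < d \<Longrightarrow> f y = of_real (y - x) * r y" "d > 0" "isCont r x"
  shows "(f has_vector_derivative r x) (at x)"
proof -
  have "(\<lambda>y. norm (r y - r x)) \<midarrow>x\<rightarrow> 0"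
    using assms(3) by (simp add: isCont_def LIM_zero tendsto_norm_zero)
  moreover have "\<forall>\<^sub>F y in at x. norm (r y - r x) = norm (f y - f x - (y - x) *\<^sub>R r x) / norm (y - x)"
  proof -
    have "\<forall>\<^sub>F y in at x. \<bar>y - x\<bar> < d \<and> y \<noteq> x"
      unfolding eventually_at using assms(2) by (auto simp: dist_real_def)
    then show ?thesis
    proof eventually_elim
      case (elim y)
      have "f y - f x - (y - x) *\<^sub>R r x = of_real (y - x) * (r y - r x)"
        using assms(1)[of y] assms(1)[of x] assms(2) elim by (simp add: scaleR_conv_of_real algebra_simps)
      then show ?case using elim by (simp add: norm_mult del: of_real_diff)
    qed
  qed
  ultimately have "((\<lambda>y. norm (f y - f x - (y - x) *\<^sub>R r x) / norm (y - x)) \<longlongrightarrow> 0) (at x)"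
    using tendsto_cong by fastforce
  then show ?thesis
    unfolding has_vector_derivative_def has_derivative_iff_norm
    by (auto intro: bounded_linear_scaleR_left)
qed

lemma upper_analytic_H_infty:
  assumes "upper_analytic f" "bounded (f ` UHP)"
  shows "(\<lambda>x. f (of_real x)) \<in> H_infty"
proof -
  have "nontangential_limit f (f (of_real x)) x" for x
    unfolding nontangential_limit_def
  proof (intro allI impI)
    fix \<kappa> :: real
    have "(f \<longlongrightarrow> f (of_real x)) (at (of_real x) within cUHP)"
      using upper_analytic_continuous_on[OF assms(1)] by (auto simp: continuous_on_def)
    then show "(f \<longlongrightarrow> f (of_real x)) (at (of_real x) within {z. Im z > 0 \<and> \<bar>Re z - x\<bar> < \<kappa> * Im z})"
      by (rule tendsto_within_subset) auto
  qed
  then show ?thesis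
    using assms unfolding H_infty_def upper_analytic_def by (auto intro!: exI[of _ f])
qed

text \<open>Compactness handles the part near the roots, where nothing is known about the quotient
  except continuity. Far away every linear factor is comparable to \<open>1 + norm z\<close>, so
  \<open>card M\<close> factors absorb growth of order \<open>card M\<close>.\<close>

lemma bounded_quotient_by_roots:
  assumes g: "upper_analytic g" and M: "finite M"
    and f: "\<And>z. Im z \<ge> 0 \<Longrightarrow> f z = (\<Prod>\<mu>\<in>M. z - complex_of_real \<mu>) * g z"
    and bd: "\<And>z. Im z > 0 \<Longrightarrow> norm (f z) \<le> A * (1 + norm z) ^ card M"
  shows "bounded (g ` UHP)"
proof -
  \<comment> \<open>Beyond this radius \<open>2 * |\<mu>| + 1 \<le> norm z\<close> for every root,
    which gives \<open>norm (z - \<mu>) \<ge> (1 + norm z) / 4\<close>.\<close>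
  define \<rho> where "\<rho> = 1 + 2 * (\<Sum>\<mu>\<in>M. \<bar>\<mu>\<bar>)"
  have "compact (cUHP \<inter> cball 0 \<rho>)"
    by (intro closed_Int_compact closed_halfspace_Im_ge compact_cball)
  then have "compact (g ` (cUHP \<inter> cball 0 \<rho>))"
    by (intro compact_continuous_image continuous_on_subset[OF upper_analytic_continuous_on[OF g]]) auto
  then have "bounded (g ` (cUHP \<inter> cball 0 \<rho>))"
    by (rule compact_imp_bounded)
  then obtain b where "\<forall>w \<in> g ` (cUHP \<inter> cball 0 \<rho>). norm w \<le> b"
    unfolding bounded_iff by blast
  then have b: "\<And>z. Im z \<ge> 0 \<Longrightarrow> norm z \<le> \<rho> \<Longrightarrow> norm (g z) \<le> b"
    by auto
  have far: "norm (g z) \<le> A * 4 ^ card M" if z: "Im z > 0" "norm z > \<rho>" for z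
  proof -
    have "norm (z - of_real \<mu>) \<ge> (1 + norm z) / 4" if "\<mu> \<in> M" for \<mu>
    proof -
      have "\<bar>\<mu>\<bar> \<le> (\<Sum>\<mu>\<in>M. \<bar>\<mu>\<bar>)" using M that by (intro member_le_sum) auto
      then have "2 * \<bar>\<mu>\<bar> + 1 \<le> norm z" using z by (simp add: \<rho>_def)
      then show ?thesis using norm_triangle_ineq2[of z "of_real \<mu>"] by simp
    qed
    then have "((1 + norm z) / 4) ^ card M \<le> norm (\<Prod>\<mu>\<in>M. z - of_real \<mu>)"
      unfolding prod_norm[symmetric] prod_constant[symmetric]
      by (intro prod_mono) auto
    then have "((1 + norm z) / 4) ^ card M * norm (g z) \<le> norm (f z)"
      by (simp add: f[OF less_imp_le[OF z(1)]] norm_mult mult_right_mono)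
    also have "\<dots> \<le> A * (1 + norm z) ^ card M" by (rule bd[OF z(1)])
    also have "\<dots> = ((1 + norm z) / 4) ^ card M * (A * 4 ^ card M)"
      by (simp add: power_divide)
    finally show ?thesis
      by (rule mult_left_le_imp_le) (use norm_ge_zero[of z] in \<open>auto intro!: zero_less_power divide_pos_pos add_pos_nonneg\<close>)
  qed
  show ?thesis
    unfolding bounded_iff
  proof (intro exI ballI)
    fix w assume "w \<in> g ` UHP"
    then obtain z where "w = g z" "Im z > 0" by auto
    then show "norm w \<le> max b (A * 4 ^ card M)"
      using b[of z] far[of z] by (cases "norm z \<le> \<rho>") (auto simp: max.coboundedI1 max.coboundedI2)
  qed
qed

section \<open>Density and completion of the zero set\<close>

text \<open>Meant for images under \<alpha>, where the \<alpha>-distance is the ordinary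
  distance.\<close>

definition separated :: "real \<Rightarrow> real set \<Rightarrow> bool" where
  "separated \<delta> A \<longleftrightarrow> \<delta> > 0 \<and> (\<forall>x\<in>A. \<forall>y\<in>A. x \<noteq> y \<longrightarrow> \<bar>x - y\<bar> > \<delta>)"

text \<open>A cell of length \<delta> holds at most one point. The cell number serves twice: for
  counting points and for assigning summable weights.\<close>

lemma inj_on_floor_separated:
  assumes "separated \<delta> A"
  shows "inj_on (\<lambda>a. \<lfloor>(a - u) / \<delta>\<rfloor>) A"
proof (rule inj_onI)
  fix x y assume xy: "x \<in> A" "y \<in> A" "\<lfloor>(x - u) / \<delta>\<rfloor> = \<lfloor>(y - u) / \<delta>\<rfloor>"
  have \<delta>: "\<delta> > 0" using assms by (simp add: separated_def)
  have "\<bar>(x - u) / \<delta> - (y - u) / \<delta>\<bar> < 1" using xy(3) by linarith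
  moreover have "(x - u) / \<delta> - (y - u) / \<delta> = (x - y) / \<delta>" by (simp add: diff_divide_distrib)
  ultimately have "\<bar>x - y\<bar> / \<delta> < 1" using \<delta> by simp
  then have "\<not> \<bar>x - y\<bar> > \<delta>" using \<delta> by (simp add: pos_divide_less_eq)
  then show "x = y" using assms xy by (auto simp: separated_def)
qed

lemma separated_finite_card:
  assumes A: "separated \<delta> A" and r: "r \<ge> 0"
  shows "finite (A \<inter> {u..u + r})" "real (card (A \<inter> {u..u + r})) \<le> r / \<delta> + 1"
proof -
  have \<delta>: "\<delta> > 0" using A by (simp add: separated_def)
  let ?f = "\<lambda>a. \<lfloor>(a - u) / \<delta>\<rfloor>"
  have inj: "inj_on ?f (A \<inter> {u..u + r})"
    using inj_on_floor_separated[OF A] by (rule inj_on_subset) auto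
  have sub: "?f ` (A \<inter> {u..u + r}) \<subseteq> {0..\<lfloor>r / \<delta>\<rfloor>}"
    using \<delta> by (auto intro!: floor_mono divide_right_mono)
  show "finite (A \<inter> {u..u + r})"
    using inj_on_finite[OF inj sub] by simp
  have "card (A \<inter> {u..u + r}) \<le> card {0..\<lfloor>r / \<delta>\<rfloor>}"
    using card_inj_on_le[OF inj sub] by simp
  moreover have "0 \<le> r / \<delta>" using r \<delta> by simp
  ultimately have "real (card (A \<inter> {u..u + r})) \<le> real_of_int \<lfloor>r / \<delta>\<rfloor> + 1"
    by simp linarith
  also have "\<dots> \<le> r / \<delta> + 1" by simp
  finally show "real (card (A \<inter> {u..u + r})) \<le> r / \<delta> + 1" .
qed

text \<open>Fekete's argument for a real variable, the limit being the infimum of the ratios. The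
  linear bound controls the value at the remainder and replaces any regularity of
  \<open>c\<close>.\<close>

lemma subadditive_ratio_convergent:
  fixes c :: "real \<Rightarrow> real"
  assumes nonneg: "\<And>r. r > 0 \<Longrightarrow> c r \<ge> 0"
    and subadd: "\<And>r s. r > 0 \<Longrightarrow> s > 0 \<Longrightarrow> c (r + s) \<le> c r + c s"
    and bd: "\<And>r. r > 0 \<Longrightarrow> c r \<le> a * r + b" and ab: "a \<ge> 0"
  shows "\<exists>L\<ge>0. ((\<lambda>r. c r / r) \<longlongrightarrow> L) at_top"
proof -
  define L where "L = (INF r\<in>{0<..}. c r / r)"
  have bdd: "bdd_below ((\<lambda>r. c r / r) ` {0<..})"
    using nonneg by (intro bdd_belowI[of _ 0]) auto
  have lower: "L \<le> c r / r" if "r > 0" for r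
    unfolding L_def using bdd that by (intro cINF_lower) auto
  have mult: "c (real k * r + s) \<le> real k * c r + c s" if "r > 0" "s > 0" for k r s
  proof (induction k)
    case (Suc k)
    have "c (real (Suc k) * r + s) = c (r + (real k * r + s))" by (simp add: algebra_simps)
    also have "\<dots> \<le> c r + c (real k * r + s)"
      using that by (intro subadd add_nonneg_pos) auto
    finally show ?case using Suc by (simp add: algebra_simps)
  qed simp
  have "((\<lambda>r. c r / r) \<longlongrightarrow> L) at_top"
  proof (rule order_tendstoI)
    fix y assume y: "y < L"
    show "\<forall>\<^sub>F r in at_top. y < c r / r"
      using eventually_gt_at_top[of 0]
    proof eventually_elim
      case (elim r)
      then show ?case using lower[of r] y by linarith
    qed
  next
    fix y assume "L < y"
    then obtain r0 where r0: "r0 > 0" "c r0 / r0 < y"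
      unfolding L_def using bdd by (subst (asm) cINF_less_iff) auto
    have "((\<lambda>r. c r0 / r0 + (a * r0 + b) / r) \<longlongrightarrow> c r0 / r0 + 0) at_top"
      by (intro tendsto_add tendsto_const real_tendsto_divide_at_top[OF tendsto_const filterlim_ident])
    then have "\<forall>\<^sub>F r in at_top. c r0 / r0 + (a * r0 + b) / r < y"
      using r0 by (intro order_tendstoD) auto
    then show "\<forall>\<^sub>F r in at_top. c r / r < y"
      using eventually_gt_at_top[of 0]
    proof eventually_elim
      case (elim r)
      \<comment> \<open>The ceiling minus one, rather than the floor, makes the remainder
        \<open>s\<close> strictly positive: \<open>c\<close> is controlled only at positive
        arguments.\<close>
      define k where "k = nat (\<lceil>r / r0\<rceil> - 1)"
      define s where "s = r - real k * r0"
      have pos: "r / r0 > 0" using elim r0 by simp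
      then have "real k = real_of_int (\<lceil>r / r0\<rceil> - 1)" unfolding k_def by simp
      then have k: "real k < r / r0" "r / r0 \<le> real k + 1" by linarith+
      then have s: "s > 0" "s \<le> r0" using r0 by (simp_all add: s_def field_simps)
      have "c r = c (real k * r0 + s)" by (simp add: s_def)
      also have "\<dots> \<le> real k * c r0 + c s" using s r0 by (intro mult) auto
      also have "\<dots> \<le> (r / r0) * c r0 + (a * r0 + b)"
      proof (intro add_mono mult_right_mono)
        show "c s \<le> a * r0 + b"
          using bd[OF s(1)] mult_left_mono[OF s(2) ab] by linarith
      qed (use k nonneg r0 in auto)
      finally have "c r / r \<le> ((r / r0) * c r0 + (a * r0 + b)) / r"
        using elim by (intro divide_right_mono) auto
      also have "\<dots> = c r0 / r0 + (a * r0 + b) / r" using elim by (simp add: add_divide_distrib)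
      finally show ?case using elim by simp
    qed
  qed
  moreover have "L \<ge> 0"
    unfolding L_def using nonneg by (intro cINF_greatest) auto
  ultimately show ?thesis by blast
qed

section \<open>The upper density in the coordinate \<alpha>\<close>

abbreviation npoints :: "real set \<Rightarrow> ennreal" where
  "npoints \<equiv> emeasure (count_space UNIV)"

text \<open>\<open>upper_density\<close> is written with \<open>Lim\<close>, which carries no
  information unless the limit exists. Existence follows from subadditivity of the maximal count: an
  interval of length \<open>r + s\<close> is cut in two, and counting the common endpoint twice does
  no harm.\<close>

lemma SUP_card_separated:
  assumes A: "separated \<delta> A"
  shows "\<exists>c. (\<forall>r>0. (SUP u. npoints (A \<inter> {u..u + r})) = ennreal (c r)) \<and>
     (\<forall>r>0. \<forall>u. real (card (A \<inter> {u..u + r})) \<le> c r) \<and> (\<exists>L\<ge>0. ((\<lambda>r. c r / r) \<longlongrightarrow> L) at_top)"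
proof -
  define c where "c r = (SUP u. real (card (A \<inter> {u..u + r})))" for r
  note fin = separated_finite_card(1)[OF A]
  note bd = separated_finite_card(2)[OF A]
  have \<delta>: "\<delta> > 0" using A by (simp add: separated_def)
  have bdd: "bdd_above (range (\<lambda>u. real (card (A \<inter> {u..u + r}))))" if "r > 0" for r
    using bd[of r] that by (intro bdd_aboveI[of _ "r / \<delta> + 1"]) auto
  have upper: "real (card (A \<inter> {u..u + r})) \<le> c r" if "r > 0" for r u
    unfolding c_def using bdd[OF that] by (intro cSUP_upper) auto
  have c_bd: "c r \<le> (1 / \<delta>) * r + 1" if "r > 0" for r
    unfolding c_def using bd[of r] that by (intro cSUP_least) auto
  have nonneg: "c r \<ge> 0" if "r > 0" for r
    using upper[OF that, of 0] by linarith
  have subadd: "c (r + s) \<le> c r + c s" if rs: "r > 0" "s > 0" for r s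
    unfolding c_def[of "r + s"]
  proof (rule cSUP_least)
    fix u
    have "A \<inter> {u..u + (r + s)} = (A \<inter> {u..u + r}) \<union> (A \<inter> {u + r..u + r + s})"
      using rs by auto
    then have "card (A \<inter> {u..u + (r + s)}) \<le> card (A \<inter> {u..u + r}) + card (A \<inter> {u + r..u + r + s})"
      by (metis card_Un_le)
    then have "real (card (A \<inter> {u..u + (r + s)})) \<le> real (card (A \<inter> {u..u + r})) + real (card (A \<inter> {u + r..u + r + s}))"
      by linarith
    then show "real (card (A \<inter> {u..u + (r + s)})) \<le> c r + c s"
      using upper[OF rs(1), of u] upper[OF rs(2), of "u + r"] by linarith
  qed simp
  have "\<exists>L\<ge>0. ((\<lambda>r. c r / r) \<longlongrightarrow> L) at_top"
    using nonneg subadd c_bd \<delta> by (intro subadditive_ratio_convergent[of c "1 / \<delta>" 1]) auto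
  moreover have "(SUP u. npoints (A \<inter> {u..u + r})) = ennreal (c r)" if r: "r > 0" for r
  proof -
    have "npoints (A \<inter> {u..u + r}) = ennreal (real (card (A \<inter> {u..u + r})))" for u
      using fin[of r u] r by (simp add: emeasure_count_space_finite ennreal_of_nat_eq_real_of_nat)
    then have eq: "(SUP u. npoints (A \<inter> {u..u + r})) = (SUP u. ennreal (real (card (A \<inter> {u..u + r}))))"
      by simp
    have le: "(SUP u. ennreal (real (card (A \<inter> {u..u + r})))) \<le> ennreal (c r)"
      using upper[OF r] by (intro SUP_least ennreal_leI) auto
    moreover have "ennreal (c r) \<le> (SUP u. ennreal (real (card (A \<inter> {u..u + r}))))"
    proof -
      have "(SUP u. ennreal (real (card (A \<inter> {u..u + r})))) < top"
        using le by (rule le_less_trans) simp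
      then obtain s where s: "(SUP u. ennreal (real (card (A \<inter> {u..u + r})))) = ennreal s" "s \<ge> 0"
        by (auto simp: less_top_ennreal)
      have "ennreal (real (card (A \<inter> {u..u + r}))) \<le> ennreal s" for u
        unfolding s(1)[symmetric] by (rule SUP_upper) simp
      then have "c r \<le> s"
        unfolding c_def using s(2) by (intro cSUP_least) (auto simp: ennreal_le_iff)
      then show ?thesis unfolding s(1) by (rule ennreal_leI)
    qed
    ultimately show ?thesis
      unfolding eq by (rule antisym)
  qed
  ultimately show ?thesis using upper by blast
qed

text \<open>The positive lower bound makes \<alpha> a bijection of the line, so all point sets can
  be handled in the coordinate \<alpha>.\<close>

locale increasing_weight =
  fixes \<alpha> \<alpha>' :: "real \<Rightarrow> real" and c :: real
  assumes deriv: "(\<alpha> has_real_derivative \<alpha>' x) (at x)"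
    and cont: "continuous_on UNIV \<alpha>'"
    and c_pos: "c > 0" and c_le: "c \<le> \<alpha>' x"
begin

lemma diff_ge: "x \<le> y \<Longrightarrow> \<alpha> y - \<alpha> x \<ge> c * (y - x)"
proof (cases "x = y")
  case False
  assume "x \<le> y"
  with False have "x < y" by simp
  from MVT2[OF this, of \<alpha> \<alpha>'] deriv obtain z where "\<alpha> y - \<alpha> x = (y - x) * \<alpha>' z" by blast
  then show ?thesis using c_le[of z] \<open>x < y\<close> by (simp add: mult.commute)
qed simp

lemma strict_mono: "strict_mono \<alpha>"
proof (rule strict_monoI)
  fix x y :: real assume "x < y"
  then have "c * (y - x) > 0" using c_pos by simp
  then show "\<alpha> x < \<alpha> y" using diff_ge[of x y] \<open>x < y\<close> by simp
qed

lemma inj: "inj \<alpha>"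
  using strict_mono by (rule strict_mono_imp_inj_on)

lemma surj: "surj \<alpha>"
proof -
  have "\<exists>x. \<alpha> x = u" for u
  proof -
    define d where "d = \<bar>u - \<alpha> 0\<bar> / c"
    have d: "d \<ge> 0" "c * d = \<bar>u - \<alpha> 0\<bar>" using c_pos by (auto simp: d_def)
    have "\<alpha> (- d) \<le> u" "u \<le> \<alpha> d"
      using diff_ge[of "- d" 0] diff_ge[of 0 d] d by auto
    then show ?thesis
      using d deriv IVT[of \<alpha> "- d" u d] by (meson DERIV_isCont add_increasing2 le_minus_iff neg_le_0_iff_le order_trans)
  qed
  then show ?thesis by (metis surjI)
qed

lemma bij: "bij \<alpha>"
  using inj surj by (simp add: bij_def)

lemma le_iff: "\<alpha> x \<le> \<alpha> y \<longleftrightarrow> x \<le> y"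
  using strict_mono by (rule strict_mono_less_eq)

lemma deriv_eq: "deriv \<alpha> x = \<alpha>' x"
  using deriv by (rule DERIV_imp_deriv)

lemma set_integral_Icc:
  assumes "a \<le> b"
  shows "set_integrable lborel {a..b} \<alpha>'" "(LBINT x:{a..b}. \<alpha>' x) = \<alpha> b - \<alpha> a"
proof -
  have c: "continuous_on {a..b} \<alpha>'" using cont by (rule continuous_on_subset) simp
  show "set_integrable lborel {a..b} \<alpha>'"
    using borel_integrable_atLeastAtMost'[OF c] .
  show "(LBINT x:{a..b}. \<alpha>' x) = \<alpha> b - \<alpha> a"
    unfolding set_lebesgue_integral_def
    using assms deriv c
    by (intro integral_FTC_atLeastAtMost)
       (auto simp: has_real_derivative_iff_has_vector_derivative intro: has_vector_derivative_at_within)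
qed

lemma weight_length_Icc: "a \<le> b \<Longrightarrow> weight_length \<alpha> {a..b} = \<alpha> b - \<alpha> a"
  using set_integral_Icc(2) by (simp add: weight_length_def deriv_eq)

text \<open>An interval of finite positive \<alpha>-length is bounded because the derivative is at
  least \<open>c\<close>, and it differs from its closure by at most two points.\<close>

lemma weight_length_interval:
  assumes I: "is_interval I" and r: "weight_length \<alpha> I = r" "r > 0"
  obtains a b where "a \<le> b" "I \<subseteq> {a..b}" "\<alpha> b - \<alpha> a = r"
proof -
  have I_sets: "I \<in> sets borel"
    using I by (rule real_interval_borel_measurable)
  \<comment> \<open>The integral of a non-integrable function has the default value 0, so
    \<open>r > 0\<close> forces integrability.\<close>
  have int: "set_integrable lborel I \<alpha>'"
  proof (rule ccontr)
    assume "\<not> set_integrable lborel I \<alpha>'"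
    then have "weight_length \<alpha> I = 0"
      unfolding weight_length_def deriv_eq set_lebesgue_integral_def set_integrable_def
      by (rule not_integrable_integral_eq)
    with r show False by simp
  qed
  have ne: "I \<noteq> {}"
    using r by (auto simp: weight_length_def set_lebesgue_integral_def)
  have diff: "c * (q - p) \<le> r" if "p \<in> I" "q \<in> I" "p \<le> q" for p q
  proof -
    have "{p..q} \<subseteq> I" using mem_is_interval_1_I[OF I that(1,2)] by auto
    moreover have "0 \<le> \<alpha>' x" for x using c_le[of x] c_pos by linarith
    ultimately have "(LBINT x:{p..q}. \<alpha>' x) \<le> (LBINT x:I. \<alpha>' x)"
      using int set_integral_Icc(1)[OF that(3)]
      unfolding set_lebesgue_integral_def set_integrable_def
      by (intro integral_mono) (auto simp: indicator_def)
    then show ?thesis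
      using r(1) set_integral_Icc(2)[OF that(3)] diff_ge[OF that(3)] by (simp add: weight_length_def deriv_eq)
  qed
  obtain p where p: "p \<in> I" using ne by auto
  have bdd: "\<bar>q - p\<bar> \<le> r / c" if "q \<in> I" for q
  proof -
    have "c * \<bar>q - p\<bar> \<le> r"
      using diff[OF p that] diff[OF that p] by (cases "p \<le> q") (simp_all add: abs_if)
    then show ?thesis using c_pos by (simp add: pos_le_divide_eq mult.commute)
  qed
  have ba: "bdd_above I" using bdd by (intro bdd_aboveI[of _ "p + r / c"]) force
  have bb: "bdd_below I" using bdd by (intro bdd_belowI[of _ "p - r / c"]) force
  define a b where "a = Inf I" and "b = Sup I"
  have sub: "I \<subseteq> {a..b}" using ba bb by (auto simp: a_def b_def intro: cInf_lower cSup_upper)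
  have sup: "{a<..<b} \<subseteq> I"
  proof
    fix x assume x: "x \<in> {a<..<b}"
    then obtain s t where "s \<in> I" "s < x" "t \<in> I" "x < t"
      unfolding a_def b_def using ne ba bb by (auto simp: cInf_less_iff less_cSup_iff)
    then show "x \<in> I" using mem_is_interval_1_I[OF I] by (meson less_imp_le)
  qed
  have ab: "a \<le> b" using sub p by auto
  have "(LBINT x:I. \<alpha>' x) = (LBINT x:{a..b}. \<alpha>' x)"
  proof (rule set_integral_discrete_difference[where X = "{a, b}"])
    have "x \<in> {a, b}" if "x \<in> {a..b}" "x \<notin> I" for x
    proof (rule ccontr)
      assume "x \<notin> {a, b}"
      then have "x \<in> {a<..<b}" using that by auto
      with sup that show False by blast
    qed
    then show "(I - {a..b}) \<union> ({a..b} - I) \<subseteq> {a, b}" using sub by blast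
  qed auto
  then have "\<alpha> b - \<alpha> a = r"
    using r(1) set_integral_Icc(2)[OF ab] by (simp add: weight_length_def deriv_eq)
  with ab sub show ?thesis by (rule that)
qed

abbreviation intervals :: "real \<Rightarrow> real set set" where
  "intervals r \<equiv> {I. is_interval I \<and> weight_length \<alpha> I = r}"

text \<open>Every interval of \<alpha>-length \<open>r\<close> lies in a closed one of the same
  length, and \<alpha> maps closed intervals bijectively onto closed intervals of ordinary length
  \<open>r\<close>.\<close>

lemma SUP_weight_length:
  assumes r: "r > 0"
  shows "(SUP I \<in> intervals r. npoints (\<Lambda> \<inter> I)) =
    (SUP u. npoints (\<alpha> ` \<Lambda> \<inter> {u..u + r}))"
proof (rule antisym)
  have em: "npoints (\<Lambda> \<inter> {a..b}) = npoints (\<alpha> ` \<Lambda> \<inter> {\<alpha> a..\<alpha> b})" for a b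
  proof -
    have "\<alpha> ` \<Lambda> \<inter> {\<alpha> a..\<alpha> b} = \<alpha> ` (\<Lambda> \<inter> {a..b})" by (auto simp: le_iff)
    moreover have "npoints (\<alpha> ` S) = npoints S" for S
    proof (cases "finite S")
      case True
      then show ?thesis using inj by (simp add: emeasure_count_space_finite card_image inj_on_subset[OF inj])
    next
      case False
      then have "infinite (\<alpha> ` S)" using finite_imageD[of \<alpha> S] inj_on_subset[OF inj] by blast
      with False show ?thesis by (simp add: emeasure_count_space_infinite)
    qed
    ultimately show ?thesis by simp
  qed
  show "(SUP I \<in> intervals r. npoints (\<Lambda> \<inter> I)) \<le>
    (SUP u. npoints (\<alpha> ` \<Lambda> \<inter> {u..u + r}))"
  proof (rule SUP_least)
    fix I assume "I \<in> intervals r"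
    then obtain a b where ab: "a \<le> b" "I \<subseteq> {a..b}" "\<alpha> b - \<alpha> a = r"
      using weight_length_interval[of I r] r by blast
    have "npoints (\<Lambda> \<inter> I) \<le> npoints (\<Lambda> \<inter> {a..b})"
      using ab by (intro emeasure_mono) auto
    also have "\<dots> = npoints (\<alpha> ` \<Lambda> \<inter> {\<alpha> a..\<alpha> a + r})"
      unfolding em using ab(3) by (simp add: algebra_simps flip: ab(3))
    also have "\<dots> \<le> (SUP u. npoints (\<alpha> ` \<Lambda> \<inter> {u..u + r}))"
      by (rule SUP_upper) simp
    finally show "npoints (\<Lambda> \<inter> I) \<le> (SUP u. npoints (\<alpha> ` \<Lambda> \<inter> {u..u + r}))" .
  qed
  show "(SUP u. npoints (\<alpha> ` \<Lambda> \<inter> {u..u + r})) \<le>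
    (SUP I \<in> intervals r. npoints (\<Lambda> \<inter> I))"
  proof (rule SUP_least)
    fix u :: real
    obtain a b where ab: "\<alpha> a = u" "\<alpha> b = u + r" using surj by (metis surjD)
    then have "a \<le> b" using r le_iff[of a b] by simp
    then have "{a..b} \<in> intervals r"
      using ab by (simp add: weight_length_Icc is_interval_cc)
    then have "npoints (\<Lambda> \<inter> {a..b}) \<le>
       (SUP I \<in> intervals r. npoints (\<Lambda> \<inter> I))"
      by (rule SUP_upper)
    then show "npoints (\<alpha> ` \<Lambda> \<inter> {u..u + r}) \<le>
       (SUP I \<in> intervals r. npoints (\<Lambda> \<inter> I))"
      unfolding em ab .
  qed
qed

text \<open>The limit is one of suprema over all positions, so the strict inequality holds for large
  \<open>r\<close> simultaneously for every \<open>u\<close>.\<close>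

lemma upper_density_card_less:
  assumes sep: "separated \<delta> (\<alpha> ` \<Lambda>)" and dens: "upper_density \<alpha> \<Lambda> < ennreal D"
  shows "\<forall>\<^sub>F r in at_top. \<forall>u. real (card (\<alpha> ` \<Lambda> \<inter> {u..u + r})) < D * r"
proof -
  obtain f L where f: "\<And>r. r > 0 \<Longrightarrow> (SUP u. npoints (\<alpha> ` \<Lambda> \<inter> {u..u + r})) = ennreal (f r)"
    "\<And>r u. r > 0 \<Longrightarrow> real (card (\<alpha> ` \<Lambda> \<inter> {u..u + r})) \<le> f r"
    and L: "L \<ge> 0" "((\<lambda>r. f r / r) \<longlongrightarrow> L) at_top"
    using SUP_card_separated[OF sep] by blast
  have "((\<lambda>r. ennreal (f r / r)) \<longlongrightarrow> ennreal L) at_top"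
    using L(2) by (rule tendsto_ennrealI)
  moreover have "\<forall>\<^sub>F r in at_top. ennreal (f r / r) = (SUP I \<in> intervals r.
         npoints (\<Lambda> \<inter> I) / ennreal r)"
    using eventually_gt_at_top[of 0]
  proof eventually_elim
    case (elim r)
    obtain a b where ab: "\<alpha> a = 0" "\<alpha> b = r" using surj by (metis surjD)
    then have "a \<le> b" using elim le_iff[of a b] by simp
    then have ne: "{a..b} \<in> intervals r"
      using ab by (simp add: weight_length_Icc is_interval_cc)
    have f0: "f r \<ge> 0" using f(2)[OF elim, of 0] by linarith
    have "(SUP I \<in> intervals r. npoints (\<Lambda> \<inter> I) / ennreal r) =
      (SUP I \<in> intervals r. npoints (\<Lambda> \<inter> I)) / ennreal r"
      unfolding divide_ennreal_def by (rule SUP_mult_right_ennreal[symmetric])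
    also have "\<dots> = ennreal (f r) / ennreal r"
      using SUP_weight_length[OF elim] f(1)[OF elim] by simp
    also have "\<dots> = ennreal (f r / r)"
      using f0 elim by (simp add: divide_ennreal)
    finally show ?case by simp
  qed
  ultimately have "((\<lambda>r. SUP I \<in> intervals r.
         npoints (\<Lambda> \<inter> I) / ennreal r) \<longlongrightarrow> ennreal L) at_top"
    by (rule Lim_transform_eventually)
  then have "upper_density \<alpha> \<Lambda> = ennreal L"
    unfolding upper_density_def by (intro tendsto_Lim) auto
  then have "L < D" using dens L(1) by (simp add: ennreal_less_iff)
  then have "\<forall>\<^sub>F r in at_top. f r / r < D"
    using L(2) by (intro order_tendstoD)
  then show ?thesis
    using eventually_gt_at_top[of 0]
  proof eventually_elim
    case (elim r)
    then have "f r < D * r" by (simp add: divide_simps)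
    then show ?case using f(2)[OF elim(2)] by (meson le_less_trans)
  qed
qed

end

section \<open>Completion of the point set, its counting function, and the weights\<close>

lemma separated_complete_blocks:
  assumes A: "separated \<delta> A" and l: "l = 2 * pi * real m"
    and few: "\<And>k::int. card (A \<inter> {x. \<lfloor>x / l\<rfloor> = k}) < m"
  shows "\<exists>A' \<delta>'. A \<subseteq> A' \<and> separated \<delta>' A' \<and> infinite (A' - A) \<and> (\<forall>k::int. card (A' \<inter> {x. \<lfloor>x / l\<rfloor> = k}) = m)"
proof -
  have m: "m > 0" using few[of 0] by simp
  then have lpos: "l > 0" by (simp add: l)
  have \<delta>: "\<delta> > 0" using A by (simp add: separated_def)
  define block where "block k = {x. \<lfloor>x / l\<rfloor> = k}" for k
  have block: "x \<in> block k \<longleftrightarrow> l * of_int k \<le> x \<and> x < l * of_int (k + 1)" for x k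
    using lpos by (auto simp: block_def floor_eq_iff field_simps)
  have fin: "finite (A \<inter> block k)" for k
  proof (rule finite_subset)
    show "A \<inter> block k \<subseteq> A \<inter> {l * of_int k..l * of_int k + l}"
      by (auto simp: block algebra_simps)
    show "finite (A \<inter> {l * of_int k..l * of_int k + l})"
      using separated_finite_card(1)[OF A] lpos by simp
  qed
  \<comment> \<open>A block contains \<open>2 m\<close> grid points, and each point of \<open>A\<close> rules out at most one of them.\<close>
  define grid where "grid j = pi * (of_int j + 1 / 2)" for j :: int
  have grid_diff: "\<bar>grid i - grid j\<bar> \<ge> pi" if "i \<noteq> j" for i j
  proof -
    have "1 \<le> \<bar>i - j\<bar>" using that by simp
    then have "1 \<le> \<bar>real_of_int i - real_of_int j\<bar>" by linarith
    moreover have "grid i - grid j = pi * (real_of_int i - real_of_int j)" by (simp add: grid_def algebra_simps)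
    ultimately show ?thesis by (simp add: abs_mult)
  qed
  define J where "J k = {2 * int m * k..<2 * int m * (k + 1)}" for k
  \<comment> \<open>The offset 1/2 keeps grid points \<open>pi / 2\<close> away from the ends of
    their block, so a point of \<open>A\<close> within \<open>pi / 4\<close> of a grid point lies in
    the same block.\<close>
  have grid_J: "l * of_int k + pi / 2 \<le> grid j" "grid j \<le> l * of_int (k + 1) - pi / 2" if "j \<in> J k" for j k
  proof -
    have "2 * int m * k \<le> j" "j + 1 \<le> 2 * int m * (k + 1)" using that by (auto simp: J_def)
    then have "real_of_int (2 * int m * k) \<le> real_of_int j" "real_of_int (j + 1) \<le> real_of_int (2 * int m * (k + 1))"
      by (simp_all only: of_int_le_iff)
    then have "pi * real_of_int (2 * int m * k) \<le> pi * real_of_int j" "pi * real_of_int (j + 1) \<le> pi * real_of_int (2 * int m * (k + 1))"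
      by simp_all
    then show "l * of_int k + pi / 2 \<le> grid j" "grid j \<le> l * of_int (k + 1) - pi / 2"
      by (simp_all add: grid_def l algebra_simps)
  qed
  define good where "good j \<longleftrightarrow> (\<forall>a\<in>A. \<bar>a - grid j\<bar> \<ge> pi / 4)" for j
  have "\<exists>X. X \<subseteq> J k \<and> (\<forall>j\<in>X. good j) \<and> card X = m - card (A \<inter> block k)" for k
  proof -
    define bad where "bad = {j \<in> J k. \<not> good j}"
    define f where "f j = (SOME a. a \<in> A \<and> \<bar>a - grid j\<bar> < pi / 4)" for j
    have f: "f j \<in> A" "\<bar>f j - grid j\<bar> < pi / 4" if "j \<in> bad" for j
    proof -
      have "\<exists>a. a \<in> A \<and> \<bar>a - grid j\<bar> < pi / 4" using that by (auto simp: bad_def good_def not_le)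
      from someI_ex[OF this] show "f j \<in> A" "\<bar>f j - grid j\<bar> < pi / 4" by (auto simp: f_def)
    qed
    have "f ` bad \<subseteq> A \<inter> block k"
    proof
      fix a assume "a \<in> f ` bad"
      then obtain j where j: "j \<in> bad" "a = f j" by auto
      then have "j \<in> J k" by (simp add: bad_def)
      from grid_J[OF this] f[OF j(1)] pi_gt_zero show "a \<in> A \<inter> block k"
        unfolding Int_iff block j(2) by linarith
    qed
    moreover have "inj_on f bad"
    proof (rule inj_onI)
      fix i j assume ij: "i \<in> bad" "j \<in> bad" "f i = f j"
      then have "\<bar>grid i - grid j\<bar> < pi" using f(2)[OF ij(1)] f(2)[OF ij(2)] by linarith
      then show "i = j" using grid_diff[of i j] by linarith
    qed
    ultimately have "card bad \<le> card (A \<inter> block k)"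
      using fin by (intro card_inj_on_le)
    moreover have "card (J k - bad) = 2 * m - card bad"
    proof -
      have "card (J k) = 2 * m" by (simp add: J_def algebra_simps nat_mult_distrib)
      then show ?thesis by (subst card_Diff_subset) (auto simp: bad_def J_def intro: finite_subset[of _ "J k"])
    qed
    ultimately have "m - card (A \<inter> block k) \<le> card (J k - bad)"
      using few[of k] by (simp add: block_def)
    then obtain X where "X \<subseteq> J k - bad" "card X = m - card (A \<inter> block k)"
      by (rule obtain_subset_with_card_n)
    then show ?thesis by (intro exI[of _ X]) (auto simp: bad_def)
  qed
  then obtain X where X: "\<And>k. X k \<subseteq> J k" "\<And>k j. j \<in> X k \<Longrightarrow> good j" "\<And>k. card (X k) = m - card (A \<inter> block k)"
    by metis
  define A' where "A' = A \<union> (\<Union>k. grid ` X k)"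
  have inj_grid: "inj grid" by (auto simp: inj_def grid_def)
  have X_block: "grid ` X k \<subseteq> block k" for k
  proof
    fix a assume "a \<in> grid ` X k"
    then obtain j where "j \<in> J k" "a = grid j" using X(1) by blast
    with grid_J[of j k] pi_gt_zero show "a \<in> block k" unfolding block by linarith
  qed
  have X_A: "a \<notin> A" if aX: "a \<in> grid ` X k" for a k
  proof
    assume "a \<in> A"
    obtain j where "j \<in> X k" "a = grid j" using aX by auto
    then have "pi / 4 \<le> \<bar>a - a\<bar>" using X(2) \<open>a \<in> A\<close> unfolding good_def by blast
    then show False using pi_gt_zero by simp
  qed
  have A'_block: "A' \<inter> block k = (A \<inter> block k) \<union> grid ` X k" for k
    using X_block by (auto simp: A'_def block_def)
  have finX: "finite (grid ` X k)" for k
    using X(1)[of k] by (intro finite_imageI finite_subset[of "X k" "J k"]) (auto simp: J_def)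
  have "card (A' \<inter> block k) = m" for k
  proof -
    have "card (A' \<inter> block k) = card (A \<inter> block k) + card (grid ` X k)"
      unfolding A'_block using X_A fin finX by (intro card_Un_disjoint) auto
    also have "card (grid ` X k) = m - card (A \<inter> block k)"
      using X(3) by (subst card_image) (auto intro: inj_on_subset[OF inj_grid])
    finally show ?thesis using few[of k] by (simp add: block_def)
  qed
  \<comment> \<open>Strictness of \<open>few\<close> is essential here: every block receives at
    least one new point.\<close>
  moreover have "infinite (A' - A)"
  proof -
    have "\<exists>x. x \<in> grid ` X k" for k
    proof -
      have "card (X k) > 0" using X(3)[of k] few[of k] by (simp add: block_def)
      then show ?thesis by (metis card.empty ex_in_conv image_is_empty less_nat_zero_code)
    qed
    then obtain x where x: "\<And>k. x k \<in> grid ` X k" by metis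
    have "inj x"
    proof (rule injI)
      fix i j assume "x i = x j"
      moreover have "x i \<in> block i" "x j \<in> block j" using x X_block by blast+
      ultimately show "i = j" by (simp add: block_def)
    qed
    then have "infinite (range x)" using finite_imageD infinite_UNIV_int by blast
    moreover have "range x \<subseteq> A' - A" using x X_A by (auto simp: A'_def)
    ultimately show ?thesis using finite_subset by blast
  qed
  \<comment> \<open>Halving turns the weak inequalities for pairs with a grid point into the strict
    ones required by \<open>separated\<close>.\<close>
  moreover have "separated (min \<delta> (pi / 4) / 2) A'"
    unfolding separated_def
  proof (intro conjI ballI impI)
    show "0 < min \<delta> (pi / 4) / 2" using \<delta> by simp
    have AX: "\<bar>a - x\<bar> \<ge> pi / 4" if "a \<in> A" "x \<in> grid ` X k" for a x k
      using that X(2) by (auto simp: good_def)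
    have XX: "\<bar>x - y\<bar> \<ge> pi" if "x \<in> grid ` X k" "y \<in> grid ` X k'" "x \<noteq> y" for x y k k'
      using that grid_diff by (metis imageE)
    fix x y assume xy: "x \<in> A'" "y \<in> A'" "x \<noteq> y"
    consider "x \<in> A" "y \<in> A" | k where "x \<in> A" "y \<in> grid ` X k" | k where "y \<in> A" "x \<in> grid ` X k"
      | k k' where "x \<in> grid ` X k" "y \<in> grid ` X k'"
      using xy unfolding A'_def by blast
    then show "\<bar>x - y\<bar> > min \<delta> (pi / 4) / 2"
    proof cases
      case 1
      then have "\<bar>x - y\<bar> > \<delta>" using A xy by (auto simp: separated_def)
      then show ?thesis using \<delta> by linarith
    next
      case 2
      then show ?thesis using AX[OF 2] pi_gt_zero by linarith
    next
      case 3
      then show ?thesis using AX[OF 3] pi_gt_zero by linarith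
    next
      case 4
      then show ?thesis using XX[OF 4 xy(3)] pi_gt_zero by linarith
    qed
  qed
  moreover have "A \<subseteq> A'" by (auto simp: A'_def)
  ultimately show ?thesis unfolding block_def by blast
qed

text \<open>A block has length \<open>2 * pi * m\<close> and \<open>m\<close> points, so
  \<open>2 * pi * n\<close> agrees with the identity at block ends; in between both are monotone,
  and they differ by at most one block length.\<close>

lemma block_counting_function:
  assumes A: "separated \<delta> A" and l: "l = 2 * pi * real m" and m: "m > 0"
    and blocks: "\<And>k::int. card (A \<inter> {x. \<lfloor>x / l\<rfloor> = k}) = m"
  shows "\<exists>n::real \<Rightarrow> int. (\<forall>u v. u \<le> v \<longrightarrow> n v - n u = int (card (A \<inter> {u..<v}))) \<and>
     (\<forall>u. \<bar>u - 2 * pi * of_int (n u)\<bar> \<le> l)"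
proof -
  have lpos: "l > 0" using m by (simp add: l)
  \<comment> \<open>A signed count from the origin. With half-open intervals the jump occurs
    immediately to the right of each point, in agreement with the definition of
    \<open>j\<close>.\<close>
  define n where "n u = (if u \<ge> 0 then int (card (A \<inter> {0..<u})) else - int (card (A \<inter> {u..<0})))" for u :: real
  have fin: "finite (A \<inter> {u..<v})" for u v
  proof (cases "u \<le> v")
    case True
    then have "finite (A \<inter> {u..u + (v - u)})" by (intro separated_finite_card(1)[OF A]) simp
    then show ?thesis by (rule finite_subset[rotated]) auto
  qed auto
  have split: "card (A \<inter> {u..<w}) = card (A \<inter> {u..<v}) + card (A \<inter> {v..<w})" if "u \<le> v" "v \<le> w" for u v w
  proof -
    have "A \<inter> {u..<w} = (A \<inter> {u..<v}) \<union> (A \<inter> {v..<w})" using that by auto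
    then show ?thesis using fin by (simp add: card_Un_disjoint disjoint_iff)
  qed
  have diff: "n v - n u = int (card (A \<inter> {u..<v}))" if "u \<le> v" for u v
  proof -
    consider "0 \<le> u" | "u < 0" "0 \<le> v" | "v < 0" by linarith
    then show ?thesis
    proof cases
      case 1
      then show ?thesis using that split[of 0 u v] by (simp add: n_def)
    next
      case 2
      then show ?thesis using split[of u 0 v] by (simp add: n_def)
    next
      case 3
      then show ?thesis using that split[of u v 0] by (simp add: n_def)
    qed
  qed
  have step: "n (l * of_int (k + 1)) - n (l * of_int k) = int m" for k
  proof -
    have "{l * of_int k..<l * of_int (k + 1)} = {x. \<lfloor>x / l\<rfloor> = k}"
      using lpos by (auto simp: floor_eq_iff field_simps)
    then show ?thesis
      using diff[of "l * of_int k" "l * of_int (k + 1)"] lpos blocks[of k] by simp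
  qed
  have grid: "n (l * of_int k) = int m * k" for k :: int
  proof (induction k rule: int_induct[where k = 0])
    case base
    show ?case by (simp add: n_def)
  next
    case (step1 i)
    then show ?case using step[of i] by (simp add: algebra_simps)
  next
    case (step2 i)
    then show ?case using step[of "i - 1"] by (simp add: algebra_simps)
  qed
  have "\<bar>u - 2 * pi * of_int (n u)\<bar> \<le> l" for u
  proof -
    define k where "k = \<lfloor>u / l\<rfloor>"
    have "of_int k \<le> u / l" "u / l < of_int k + 1" by (auto simp: k_def)
    then have k: "l * of_int k \<le> u" "u \<le> l * of_int (k + 1)"
      using lpos by (simp_all add: field_simps)
    have "int m * k \<le> n u" "n u \<le> int m * (k + 1)"
      using diff[OF k(1)] diff[OF k(2)] grid[of k] grid[of "k + 1"] by linarith+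
    then have "real_of_int (int m * k) \<le> of_int (n u)" "of_int (n u) \<le> real_of_int (int m * (k + 1))"
      by (simp_all only: of_int_le_iff)
    then have "2 * pi * real_of_int (int m * k) \<le> 2 * pi * of_int (n u)" "2 * pi * of_int (n u) \<le> 2 * pi * real_of_int (int m * (k + 1))"
      by simp_all
    then have "l * of_int k \<le> 2 * pi * of_int (n u)" "2 * pi * of_int (n u) \<le> l * of_int (k + 1)"
      by (simp_all add: l algebra_simps)
    then show ?thesis using k by (simp add: algebra_simps)
  qed
  with diff show ?thesis by blast
qed

text \<open>The cell number, encoded as a natural number, indexes the points injectively, so inverse
  squares of the index are summable. The index grows at most linearly in \<open>|a|\<close>, hence
  the quadratic bound on \<open>1 / w\<close>.\<close>

lemma separated_summable_weights:
  assumes A: "separated \<delta> A"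
  shows "\<exists>w C. (\<forall>a\<in>A. 0 < w a \<and> w a \<le> (1::real) \<and> 1 / w a \<le> C * (1 + \<bar>a\<bar>)\<^sup>2) \<and> w summable_on A"
proof -
  have \<delta>: "\<delta> > 0" using A by (simp add: separated_def)
  define idx where "idx a = int_encode \<lfloor>(a - 0) / \<delta>\<rfloor>" for a
  define v where "v n = inverse ((real (Suc n))\<^sup>2)" for n
  define w where "w a = v (idx a)" for a
  have "inj_on idx A"
    unfolding idx_def
    by (rule comp_inj_on[OF inj_on_floor_separated[OF A, of 0] inj_on_subset[OF inj_int_encode subset_UNIV], unfolded o_def])
  moreover have "v summable_on idx ` A"
  proof (rule summable_on_subset_banach)
    have "summable (\<lambda>n. inverse ((real n)\<^sup>2))"
      by (rule inverse_power_summable) simp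
    then have "summable v"
      unfolding v_def by (simp only: summable_Suc_iff[of "\<lambda>n. inverse ((real n)\<^sup>2)"])
    moreover have "norm (v n) = v n" for n by (simp add: v_def)
    ultimately show "v summable_on UNIV"
      by (intro norm_summable_imp_summable_on) simp
  qed simp
  ultimately have "w summable_on A"
    using summable_on_reindex[of idx A v] by (simp add: w_def[abs_def] o_def)
  moreover have "0 < w a \<and> w a \<le> 1 \<and> 1 / w a \<le> (2 / \<delta> + 4)\<^sup>2 * (1 + \<bar>a\<bar>)\<^sup>2" for a
  proof -
    define k where "k = \<lfloor>a / \<delta>\<rfloor>"
    have "int (int_encode k) \<le> 2 * \<bar>k\<bar> + 1" by (auto simp: int_encode_def sum_encode_def)
    then have "real (int_encode k) \<le> real_of_int (2 * \<bar>k\<bar> + 1)" by (metis of_int_le_iff of_int_of_nat_eq)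
    moreover have "\<bar>real_of_int k\<bar> \<le> \<bar>a / \<delta>\<bar> + 1" unfolding k_def by linarith
    ultimately have "real (Suc (idx a)) \<le> 2 * (\<bar>a\<bar> / \<delta>) + 4"
      using \<delta> by (simp add: idx_def k_def)
    also have "\<dots> \<le> (2 / \<delta> + 4) * (1 + \<bar>a\<bar>)"
    proof -
      have "(2 / \<delta> + 4) * (1 + \<bar>a\<bar>) = 2 * (\<bar>a\<bar> / \<delta>) + 4 + (2 / \<delta> + 4 * \<bar>a\<bar>)"
        by (simp add: algebra_simps add_divide_distrib)
      moreover have "0 \<le> 2 / \<delta>" using \<delta> by simp
      ultimately show ?thesis by linarith
    qed
    finally have "(real (Suc (idx a)))\<^sup>2 \<le> ((2 / \<delta> + 4) * (1 + \<bar>a\<bar>))\<^sup>2"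
      by (intro power_mono) auto
    moreover have "v n \<le> 1" "0 < v n" for n
      by (auto simp: v_def intro!: inverse_le_1_iff[THEN iffD2])
    ultimately show ?thesis by (simp add: w_def v_def power_mult_distrib inverse_eq_divide)
  qed
  ultimately show ?thesis by blast
qed

section \<open>The Herglotz function and its phase\<close>

text \<open>The index set is a parameter because the estimates are used both for the full sum and
  for the sum with a nearby pole removed.\<close>

definition cauchy_sum :: "(real \<Rightarrow> real) \<Rightarrow> real set \<Rightarrow> complex \<Rightarrow> complex" where
  "cauchy_sum w M z = (\<Sum>\<^sub>\<infinity>l\<in>M. of_real (w l) / (of_real l - z))"

context
  fixes w :: "real \<Rightarrow> real" and M :: "real set"
  assumes w_nonneg: "\<And>l. l \<in> M \<Longrightarrow> 0 \<le> w l" and w_summable: "w summable_on M"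
begin

lemma norm_cauchy_term_le:
  assumes "l \<in> M" "0 < \<epsilon>" "\<epsilon> \<le> norm (complex_of_real l - z)"
  shows "norm (complex_of_real (w l) / (of_real l - z)) \<le> w l * (1 / \<epsilon>)"
  using assms w_nonneg[OF assms(1)] by (auto simp: norm_divide intro!: divide_left_mono mult_pos_pos)

lemma cauchy_sum_summable:
  assumes "0 < \<epsilon>" "\<And>l. l \<in> M \<Longrightarrow> \<epsilon> \<le> norm (complex_of_real l - z)"
  shows "(\<lambda>l. complex_of_real (w l) / (of_real l - z)) summable_on M"
proof (rule abs_summable_summable, rule Infinite_Sum.abs_summable_on_comparison_test')
  show "(\<lambda>l. w l * (1 / \<epsilon>)) summable_on M" by (intro summable_on_cmult_left w_summable)
qed (use assms norm_cauchy_term_le in auto)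

lemma norm_cauchy_sum_le:
  assumes "0 < \<epsilon>" "\<And>l. l \<in> M \<Longrightarrow> \<epsilon> \<le> norm (complex_of_real l - z)"
  shows "norm (cauchy_sum w M z) \<le> infsum w M / \<epsilon>"
proof (rule norm_infsum_le)
  show "((\<lambda>l. complex_of_real (w l) / (of_real l - z)) has_sum cauchy_sum w M z) M"
    unfolding cauchy_sum_def using cauchy_sum_summable[OF assms] by (rule has_sum_infsum)
  have "((\<lambda>l. w l * (1 / \<epsilon>)) has_sum infsum w M * (1 / \<epsilon>)) M"
    by (intro has_sum_cmult_left has_sum_infsum w_summable)
  then show "((\<lambda>l. w l * (1 / \<epsilon>)) has_sum infsum w M / \<epsilon>) M" by simp
qed (use assms norm_cauchy_term_le in blast)

lemma cauchy_sum_holomorphic_on_ball: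
  assumes "0 < \<epsilon>" "\<And>l z. l \<in> M \<Longrightarrow> z \<in> ball z0 r \<Longrightarrow> \<epsilon> \<le> norm (complex_of_real l - z)"
  shows "cauchy_sum w M holomorphic_on ball z0 r"
proof -
  have ul: "uniform_limit (ball z0 r) (\<lambda>X z. \<Sum>l\<in>X. of_real (w l) / (complex_of_real l - z)) (cauchy_sum w M) (finite_subsets_at_top M)"
    unfolding cauchy_sum_def
  proof (rule Weierstrass_m_test_general)
    show "(\<lambda>l. w l * (1 / \<epsilon>)) summable_on M" by (intro summable_on_cmult_left w_summable)
  qed (use assms norm_cauchy_term_le in blast)
  have "cauchy_sum w M field_differentiable at z" if z: "z \<in> ball z0 r" for z
  proof -
    obtain d where d: "d > 0" "cball z d \<subseteq> ball z0 r"
      using z by (meson open_ball open_contains_cball)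
    have hol: "(\<lambda>z. \<Sum>l\<in>X. of_real (w l) / (complex_of_real l - z)) holomorphic_on cball z d" if "X \<subseteq> M" for X
    proof (intro holomorphic_intros)
      fix l z' assume "l \<in> X" "z' \<in> cball z d"
      then have "\<epsilon> \<le> norm (complex_of_real l - z')" using assms(2) d that by blast
      then show "complex_of_real l - z' \<noteq> 0" using assms(1) by auto
    qed
    have "\<forall>\<^sub>F X in finite_subsets_at_top M. continuous_on (cball z d) (\<lambda>z. \<Sum>l\<in>X. of_real (w l) / (complex_of_real l - z)) \<and>
       (\<lambda>z. \<Sum>l\<in>X. of_real (w l) / (complex_of_real l - z)) holomorphic_on ball z d"
    proof (rule eventually_finite_subsets_at_top_weakI)
      fix X assume "X \<subseteq> M"
      from hol[OF this] show "continuous_on (cball z d) (\<lambda>z. \<Sum>l\<in>X. of_real (w l) / (complex_of_real l - z)) \<and>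
       (\<lambda>z. \<Sum>l\<in>X. of_real (w l) / (complex_of_real l - z)) holomorphic_on ball z d"
        using holomorphic_on_imp_continuous_on holomorphic_on_subset ball_subset_cball by blast
    qed
    then have "cauchy_sum w M holomorphic_on ball z d"
      by (rule holomorphic_uniform_limit[OF _ uniform_limit_on_subset[OF ul d(2)]]) auto
    then show ?thesis
      using d(1) by (meson centre_in_ball holomorphic_on_imp_differentiable_at open_ball)
  qed
  then show ?thesis
    by (simp add: holomorphic_on_def field_differentiable_at_within)
qed

lemma Im_cauchy_sum_nonneg:
  assumes z: "Im z > 0"
  shows "Im (cauchy_sum w M z) \<ge> 0"
proof -
  have "Im z \<le> norm (complex_of_real l - z)" for l
    using abs_Im_le_cmod[of "of_real l - z"] by simp
  then have "(\<lambda>l. complex_of_real (w l) / (of_real l - z)) summable_on M"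
    by (intro cauchy_sum_summable[OF z])
  from infsum_Im[OF this]
  have "Im (cauchy_sum w M z) = (\<Sum>\<^sub>\<infinity>l\<in>M. Im (complex_of_real (w l) / (of_real l - z)))"
    by (simp add: cauchy_sum_def)
  also have "\<dots> \<ge> 0"
    using w_nonneg z by (intro infsum_nonneg) (auto simp: Im_divide intro!: divide_nonneg_nonneg mult_nonneg_nonneg)
  finally show ?thesis .
qed

lemma Im_cauchy_sum_of_real:
  assumes "0 < \<epsilon>" "\<And>l. l \<in> M \<Longrightarrow> \<epsilon> \<le> \<bar>l - x\<bar>"
  shows "Im (cauchy_sum w M (of_real x)) = 0"
proof -
  have "(\<lambda>l. complex_of_real (w l) / (of_real l - of_real x)) summable_on M"
    using assms by (intro cauchy_sum_summable[of \<epsilon>]) (auto simp flip: of_real_diff)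
  from infsum_Im[OF this] show ?thesis
    by (simp add: cauchy_sum_def flip: of_real_diff of_real_divide)
qed

lemma cauchy_sum_insert:
  assumes "0 < \<epsilon>" "\<And>l. l \<in> M \<Longrightarrow> \<epsilon> \<le> norm (complex_of_real l - z)" "l0 \<notin> M"
  shows "cauchy_sum w (insert l0 M) z = of_real (w l0) / (of_real l0 - z) + cauchy_sum w M z"
  unfolding cauchy_sum_def using cauchy_sum_summable[OF assms(1,2)] assms(3) by (simp add: infsum_insert)

end

text \<open>With \<open>R\<close> the Cauchy sum of the weights,
  \<open>(R - \<i>) / (R + \<i>)\<close> is a meromorphic inner function that equals 1 exactly on
  \<open>L\<close>, and the weights are the masses of the corresponding Clark measure up to a
  constant factor. \<open>s x\<close> is a radius around \<open>x\<close> within which at most one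
  point of \<open>L\<close> lies, and \<open>V x\<close> bounds the inverse weight of that point.
  Both depend on \<open>x\<close> because the spacing of \<open>L\<close> and the weights may decay
  at infinity.\<close>

locale clark_phase =
  fixes L :: "real set" and w s V :: "real \<Rightarrow> real" and n :: "real \<Rightarrow> int"
  assumes w_pos: "l \<in> L \<Longrightarrow> 0 < w l" and w_summable: "w summable_on L"
    and s_pos: "0 < s x"
    and isolated: "l \<in> L \<Longrightarrow> l' \<in> L \<Longrightarrow> \<bar>l - x\<bar> < s x \<Longrightarrow> \<bar>l' - x\<bar> < s x \<Longrightarrow> l = l'"
    and w_ge: "l \<in> L \<Longrightarrow> \<bar>l - x\<bar> < s x \<Longrightarrow> 1 / w l \<le> V x"
    and V_nonneg: "0 \<le> V x"
    and count: "u \<le> v \<Longrightarrow> n v - n u = int (card (L \<inter> {u..<v}))"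
begin

definition W :: real where "W = infsum w L"

lemma W_nonneg: "W \<ge> 0"
  unfolding W_def using w_pos by (intro infsum_nonneg) (auto intro: less_imp_le)

definition R :: "complex \<Rightarrow> complex" where "R = cauchy_sum w L"

definition far :: "real \<Rightarrow> real set" where "far x = {l \<in> L. s x \<le> \<bar>l - x\<bar>}"

text \<open>The regular part of \<open>R\<close> near \<open>x\<close>. On the disc of radius
  \<open>s x / 2\<close> the remaining poles keep distance \<open>s x / 2\<close>, so
  \<open>S x\<close> is holomorphic there with an explicit bound.\<close>

definition S :: "real \<Rightarrow> complex \<Rightarrow> complex" where "S x = cauchy_sum w (far x)"

lemma far_subset: "far x \<subseteq> L" by (auto simp: far_def)

lemma w_far: "\<And>l. l \<in> far x \<Longrightarrow> 0 \<le> w l" "w summable_on far x"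
  using w_pos less_imp_le summable_on_subset_banach[OF w_summable far_subset] by (auto simp: far_def)

lemma w_L: "\<And>l. l \<in> L \<Longrightarrow> 0 \<le> w l"
  using w_pos less_imp_le by blast

lemma infsum_far_le: "infsum w (far x) \<le> W"
  unfolding W_def
  using w_far w_summable far_subset w_pos by (intro infsum_mono2) (auto intro: less_imp_le)

lemma far_dist:
  assumes "l \<in> far x" "z \<in> rball x (s x / 2)"
  shows "s x / 2 \<le> norm (complex_of_real l - z)"
proof -
  have "s x \<le> norm (complex_of_real l - of_real x)"
    using assms(1) by (simp add: far_def flip: of_real_diff)
  also have "\<dots> \<le> norm (complex_of_real l - z) + norm (z - of_real x)"
    using norm_triangle_ineq[of "of_real l - z" "z - of_real x"] by simp
  also have "norm (z - of_real x) < s x / 2"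
    using assms(2) by (simp add: dist_norm norm_minus_commute)
  finally show ?thesis by simp
qed

lemma S_holomorphic: "S x holomorphic_on rball x (s x / 2)"
  unfolding S_def
  by (rule cauchy_sum_holomorphic_on_ball[where \<epsilon> = "s x / 2"])
    (use w_far s_pos[of x] far_dist in auto)

lemma norm_S_le:
  assumes "z \<in> rball x (s x / 2)"
  shows "norm (S x z) \<le> 2 * W / s x"
proof -
  have "norm (S x z) \<le> infsum w (far x) / (s x / 2)"
    unfolding S_def using w_far s_pos[of x] far_dist assms by (intro norm_cauchy_sum_le) auto
  also have "\<dots> \<le> W / (s x / 2)"
    using infsum_far_le s_pos[of x] by (intro divide_right_mono) auto
  finally show ?thesis by (simp add: mult.commute)
qed

text \<open>Cauchy's estimate on the circle of radius \<open>s x / 4\<close>, on which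
  \<open>norm_S_le\<close> applies.\<close>

lemma norm_deriv_S_le: "norm (deriv (S x) (of_real x)) \<le> 8 * W / (s x)\<^sup>2"
proof -
  have sub: "cball (complex_of_real x) (s x / 4) \<subseteq> rball x (s x / 2)"
    using s_pos[of x] by (intro cball_subset_ball_iff[THEN iffD2]) auto
  have "norm ((deriv ^^ 1) (S x) (of_real x)) \<le> fact 1 * (2 * W / s x) / (s x / 4) ^ 1"
  proof (rule Cauchy_inequality)
    show "S x holomorphic_on rball x (s x / 4)"
      using S_holomorphic sub ball_subset_cball holomorphic_on_subset by blast
    show "continuous_on (cball (of_real x) (s x / 4)) (S x)"
      using S_holomorphic sub continuous_on_subset holomorphic_on_imp_continuous_on by blast
    fix z assume "norm (complex_of_real x - z) = s x / 4"
    then have "z \<in> rball x (s x / 2)"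
      using s_pos[of x] by (simp add: dist_norm)
    then show "norm (S x z) \<le> 2 * W / s x" by (rule norm_S_le)
  qed (use s_pos[of x] in simp)
  then show ?thesis by (simp add: power2_eq_square)
qed

lemma Im_S_of_real:
  assumes "\<bar>t - x\<bar> < s x / 2"
  shows "Im (S x (of_real t)) = 0"
  unfolding S_def
proof (rule Im_cauchy_sum_of_real[where \<epsilon> = "s x / 2"])
  fix l assume "l \<in> far x"
  then have "s x \<le> \<bar>l - x\<bar>" by (simp add: far_def)
  then show "s x / 2 \<le> \<bar>l - t\<bar>" using assms by linarith
qed (use w_far s_pos[of x] in auto)

lemma R_eq_S:
  assumes "\<And>l. l \<in> L \<Longrightarrow> s x \<le> \<bar>l - x\<bar>"
  shows "R z = S x z"
proof -
  have "far x = L" using assms by (auto simp: far_def)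
  then show ?thesis by (simp add: R_def S_def)
qed

lemma R_eq_pole_plus_S:
  assumes "l0 \<in> L" "\<bar>l0 - x\<bar> < s x" "z \<in> rball x (s x / 2)"
  shows "R z = of_real (w l0) / (of_real l0 - z) + S x z"
proof -
  have "l \<in> far x" if "l \<in> L" "l \<noteq> l0" for l
    using isolated[OF that(1) assms(1) _ assms(2)] that by (cases "\<bar>l - x\<bar> < s x") (auto simp: far_def)
  then have "L = insert l0 (far x)"
    using assms(1) far_subset by blast
  moreover have "l0 \<notin> far x" using assms(2) by (simp add: far_def)
  ultimately show ?thesis
    unfolding R_def S_def
    using cauchy_sum_insert[of "far x" w "s x / 2" z l0] w_far far_dist[OF _ assms(3)] s_pos[of x] by simp
qed

definition q :: "complex \<Rightarrow> complex" where
  "q z = (if z \<in> of_real ` L then 0 else 1 / (R z + \<i>))"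

text \<open>Multiplying through by \<open>l0 - z\<close> removes the singularity of
  \<open>R\<close>. The right-hand side stays meaningful at \<open>l0\<close>, gives the extension
  of \<open>q\<close> across the line, and shows the simple zero.\<close>

lemma q_near_pole:
  assumes "l0 \<in> L" "\<bar>l0 - x\<bar> < s x" "z \<in> rball x (s x / 2)"
  shows "q z = (of_real l0 - z) / (of_real (w l0) + (of_real l0 - z) * (S x z + \<i>))"
proof (cases "z = of_real l0")
  case True
  then show ?thesis using assms(1) by (simp add: q_def)
next
  case False
  have "z \<notin> of_real ` L"
  proof
    assume "z \<in> of_real ` L"
    then obtain l where l: "l \<in> L" "z = of_real l" by auto
    then have "\<bar>l - x\<bar> < s x"
      using assms(3) s_pos[of x] by (simp add: dist_norm abs_minus_commute flip: of_real_diff)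
    then show False using isolated[OF l(1) assms(1)] assms(2) l(2) False by auto
  qed
  then have "q z = 1 / (of_real (w l0) / (of_real l0 - z) + S x z + \<i>)"
    using R_eq_pole_plus_S[OF assms] by (simp add: q_def)
  also have "of_real (w l0) / (of_real l0 - z) + S x z + \<i> =
     (of_real (w l0) + (of_real l0 - z) * (S x z + \<i>)) / (of_real l0 - z)"
    using False by (simp add: field_simps)
  finally show ?thesis by simp
qed

text \<open>\<open>S x\<close> is real on the line, so the imaginary part of the expression is
  \<open>l0 - t\<close>; it vanishes only at \<open>t = l0\<close>, where the expression equals
  \<open>w l0 > 0\<close>.\<close>

lemma denominator_nonzero:
  assumes "l0 \<in> L" "\<bar>t - x\<bar> < s x / 2"
  shows "of_real (w l0) + (of_real l0 - of_real t) * (S x (of_real t) + \<i>) \<noteq> 0"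
proof
  assume eq: "of_real (w l0) + (of_real l0 - of_real t) * (S x (of_real t) + \<i>) = 0"
  from arg_cong[OF eq, of Im] have "l0 = t" using Im_S_of_real[OF assms(2)] by simp
  with eq w_pos[OF assms(1)] show False by simp
qed

lemma norm_q_le: "Im z > 0 \<Longrightarrow> norm (q z) \<le> 1"
proof -
  assume z: "Im z > 0"
  have "Im (R z) \<ge> 0"
    unfolding R_def using w_L w_summable z by (rule Im_cauchy_sum_nonneg)
  then have "1 \<le> norm (R z + \<i>)" using abs_Im_le_cmod[of "R z + \<i>"] by simp
  then show ?thesis using z by (auto simp: q_def norm_divide divide_simps)
qed

lemma q_holomorphic: "q holomorphic_on UHP"
proof -
  have "R field_differentiable at z" if z: "Im z > 0" for z
  proof -
    have "R holomorphic_on ball z (Im z / 2)"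
      unfolding R_def
    proof (rule cauchy_sum_holomorphic_on_ball[where \<epsilon> = "Im z / 2"])
      fix l z' assume "z' \<in> ball z (Im z / 2)"
      then have "Im z / 2 \<le> Im z'"
        using abs_Im_le_cmod[of "z - z'"] by (simp add: dist_norm)
      then show "Im z / 2 \<le> norm (complex_of_real l - z')"
        using abs_Im_le_cmod[of "of_real l - z'"] z by simp
    qed (use w_L w_summable z in auto)
    then show ?thesis
      using z by (meson centre_in_ball half_gt_zero holomorphic_on_imp_differentiable_at open_ball)
  qed
  then have "R holomorphic_on UHP"
    by (simp add: holomorphic_on_def field_differentiable_at_within)
  moreover have "R z + \<i> \<noteq> 0" if "Im z > 0" for z
    using Im_cauchy_sum_nonneg[OF w_L w_summable that] by (auto simp: R_def complex_eq_iff)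
  ultimately have "(\<lambda>z. 1 / (R z + \<i>)) holomorphic_on UHP"
    by (intro holomorphic_intros) auto
  then show ?thesis
    by (rule holomorphic_transform) (auto simp: q_def)
qed

lemma ball_nonzero:
  assumes "continuous_on (ball z0 r) f" "f z0 \<noteq> (0::complex)" "r > 0"
  obtains d where "d > 0" "d \<le> r" "\<And>z. z \<in> ball z0 d \<Longrightarrow> f z \<noteq> 0"
proof -
  have "isCont f z0"
    using assms by (simp add: continuous_on_eq_continuous_at)
  from continuous_at_avoid[OF this assms(2)]
  obtain e where e: "e > 0" "\<And>y. dist z0 y < e \<Longrightarrow> f y \<noteq> 0" by blast
  show ?thesis
    by (rule that[of "min e r"]) (use e assms(3) in auto)
qed

lemma q_upper_analytic: "upper_analytic q"
proof (rule upper_analyticI[OF q_holomorphic])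
  fix x :: real
  define B where "B = rball x (s x / 2)"
  have contS: "continuous_on B (S x)"
    unfolding B_def by (intro holomorphic_on_imp_continuous_on S_holomorphic)
  have x: "complex_of_real x \<in> B" using s_pos[of x] by (simp add: B_def)
  show "extends_at x q"
  proof (cases "\<exists>l0\<in>L. \<bar>l0 - x\<bar> < s x")
    case True
    then obtain l0 where l0: "l0 \<in> L" "\<bar>l0 - x\<bar> < s x" by auto
    let ?D = "\<lambda>z. of_real (w l0) + (of_real l0 - z) * (S x z + \<i>)"
    have "continuous_on B ?D" using contS by (intro continuous_intros)
    moreover have "?D (of_real x) \<noteq> 0"
      using denominator_nonzero[OF l0(1), of x x] s_pos[of x] by simp
    ultimately obtain d where d: "d > 0" "d \<le> s x / 2" "\<And>z. z \<in> rball x d \<Longrightarrow> ?D z \<noteq> 0"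
      using ball_nonzero[of "of_real x" "s x / 2" ?D] s_pos[of x] by (auto simp: B_def)
    have sub: "rball x d \<subseteq> rball x (s x / 2)" using d(2) by auto
    have "(\<lambda>z. (of_real l0 - z) / ?D z) holomorphic_on rball x d"
      using d(3) holomorphic_on_subset[OF S_holomorphic sub] by (intro holomorphic_intros) auto
    then show ?thesis
      using d(1) q_near_pole[OF l0] sub by (intro exI[of _ d] conjI exI[of _ "\<lambda>z. (of_real l0 - z) / ?D z"]) auto
  next
    case False
    then have far: "\<And>l. l \<in> L \<Longrightarrow> s x \<le> \<bar>l - x\<bar>" by force
    have "continuous_on B (\<lambda>z. S x z + \<i>)" using contS by (intro continuous_intros)
    moreover have "S x (of_real x) + \<i> \<noteq> 0"
      using Im_S_of_real[of x x] s_pos[of x] by (auto simp: complex_eq_iff)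
    ultimately obtain d where d: "d > 0" "d \<le> s x / 2" "\<And>z. z \<in> rball x d \<Longrightarrow> S x z + \<i> \<noteq> 0"
      using ball_nonzero[of "of_real x" "s x / 2" "\<lambda>z. S x z + \<i>"] s_pos[of x] by (auto simp: B_def)
    have sub: "rball x d \<subseteq> rball x (s x / 2)" using d(2) by auto
    have "(\<lambda>z. 1 / (S x z + \<i>)) holomorphic_on rball x d"
      using d(3) holomorphic_on_subset[OF S_holomorphic sub] by (intro holomorphic_intros) auto
    moreover have "1 / (S x z + \<i>) = q z" if z: "z \<in> rball x d" for z
    proof -
      have "z \<notin> of_real ` L"
      proof
        assume "z \<in> of_real ` L"
        then obtain l where "l \<in> L" "z = of_real l" by auto
        then have "\<bar>l - x\<bar> < d" using z by (simp add: dist_norm abs_minus_commute flip: of_real_diff)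
        with far[OF \<open>l \<in> L\<close>] d s_pos[of x] show False by linarith
      qed
      then show ?thesis using R_eq_S[of x z] far by (simp add: q_def)
    qed
    ultimately show ?thesis using d(1) by blast
  qed
qed

text \<open>The value \<open>r l\<close> is the derivative of \<open>q\<close> along the line; its
  modulus \<open>1 / w l\<close> is the source of the lower bound for the multiplier.\<close>

lemma q_at_pole:
  assumes l: "l \<in> L"
  shows "\<exists>d r. d > 0 \<and> isCont r l \<and> r l = - 1 / of_real (w l) \<and>
    (\<forall>y. \<bar>y - l\<bar> < d \<longrightarrow> q (of_real y) = of_real (y - l) * r y)"
proof -
  let ?D = "\<lambda>z. of_real (w l) + (of_real l - z) * (S l z + \<i>)"
  define r where "r y = - 1 / ?D (of_real y)" for y :: real
  have nz: "?D (of_real y) \<noteq> 0" if "\<bar>y - l\<bar> < s l / 2" for y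
    using denominator_nonzero[OF l that] .
  have "isCont (S l) (of_real l)"
    using holomorphic_on_imp_continuous_on[OF S_holomorphic, of l] s_pos[of l]
    by (simp add: continuous_on_eq_continuous_at)
  then have "isCont (\<lambda>y. S l (of_real y)) l"
    by (intro isCont_o2[where g = "S l" and f = complex_of_real]) (auto intro: continuous_intros)
  then have "isCont r l"
    unfolding r_def using nz[of l] s_pos[of l] by (intro continuous_intros) auto
  moreover have "r l = - 1 / of_real (w l)" by (simp add: r_def)
  moreover have "q (of_real y) = of_real (y - l) * r y" if "\<bar>y - l\<bar> < s l / 2" for y
  proof -
    have "complex_of_real y \<in> rball l (s l / 2)"
      using that by (simp add: dist_norm abs_minus_commute flip: of_real_diff)
    then have "q (of_real y) = (of_real l - of_real y) / ?D (of_real y)"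
      using q_near_pole[OF l, of l "of_real y"] s_pos[of l] by simp
    moreover have "(complex_of_real l - of_real y) / D = of_real (y - l) * (- 1 / D)" for D
      by (simp add: diff_divide_distrib algebra_simps)
    ultimately show ?thesis unfolding r_def by simp
  qed
  ultimately show ?thesis using s_pos[of l] by (intro exI[of _ "s l / 2"] exI[of _ r]) auto
qed

end

section \<open>The phase \<open>j\<close>: analyticity and a bound for its derivative\<close>

lemma local_Arctan:
  assumes G: "G holomorphic_on rball x d" and d: "d > 0" and real: "Im (G (of_real x)) = 0"
  obtains e where "e > 0" "e \<le> d" "(\<lambda>z. Arctan (G z)) holomorphic_on rball x e"
    "((\<lambda>z. Arctan (G z)) has_field_derivative inverse (1 + (G (of_real x))\<^sup>2) * deriv G (of_real x)) (at (of_real x))"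
proof -
  let ?x = "complex_of_real x"
  have "isCont G ?x"
    using holomorphic_on_imp_continuous_on[OF G] d by (simp add: continuous_on_eq_continuous_at)
  then have "isCont (\<lambda>z. Im (G z)) ?x" by (rule isCont_Im)
  then obtain e where e: "e > 0" "\<And>z. dist z ?x < e \<Longrightarrow> dist (Im (G z)) (Im (G ?x)) < 1"
    unfolding continuous_at_eps_delta by (meson zero_less_one)
  have Im: "\<bar>Im (G z)\<bar> < 1" if "z \<in> ball ?x (min e d)" for z
    using e(2)[of z] that real by (simp add: dist_commute dist_real_def)
  show ?thesis
  proof (rule that)
    show "min e d > 0" "min e d \<le> d" using e d by auto
    show "(\<lambda>z. Arctan (G z)) holomorphic_on ball ?x (min e d)"
    proof (rule holomorphic_on_compose_gen[unfolded o_def, where g = Arctan and t = "G ` ball ?x (min e d)"])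
      show "G holomorphic_on ball ?x (min e d)" by (rule holomorphic_on_subset[OF G]) auto
      show "Arctan holomorphic_on G ` ball ?x (min e d)" using Im by (intro holomorphic_on_Arctan) auto
    qed auto
    have "(G has_field_derivative deriv G ?x) (at ?x)"
      using G d by (intro holomorphic_derivI) auto
    moreover have "\<bar>Im (G ?x)\<bar> < 1" using real by simp
    ultimately show "((\<lambda>z. Arctan (G z)) has_field_derivative inverse (1 + (G ?x)\<^sup>2) * deriv G ?x) (at ?x)"
      by (intro DERIV_chain2[OF has_field_derivative_Arctan])
  qed
qed

lemma exp_double_arctan:
  "exp (\<i> * of_real (2 * arctan r)) * of_real (1 + r\<^sup>2) = (1 + \<i> * of_real r)\<^sup>2"
proof -
  have nz: "sqrt (1 + r\<^sup>2) \<noteq> 0" using one_plus_square_nonzero by simp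
  have "exp (\<i> * of_real (arctan r)) * of_real (sqrt (1 + r\<^sup>2)) = 1 + \<i> * of_real r"
    using nz by (simp add: complex_eq_iff cos_arctan sin_arctan flip: cis_conv_exp)
  then have "(exp (\<i> * of_real (arctan r)) * of_real (sqrt (1 + r\<^sup>2)))\<^sup>2 = (1 + \<i> * of_real r)\<^sup>2" by simp
  moreover have "(exp (\<i> * complex_of_real (arctan r)))\<^sup>2 = exp (\<i> * of_real (2 * arctan r))"
    by (simp add: algebra_simps flip: exp_double)
  moreover have "(complex_of_real (sqrt (1 + r\<^sup>2)))\<^sup>2 = of_real (1 + r\<^sup>2)"
    by (simp flip: of_real_power)
  ultimately show ?thesis by (simp add: power_mult_distrib)
qed

context clark_phase
begin

text \<open>On \<open>L\<close>, where \<open>R\<close> has a pole and \<open>R (of_real x)\<close> is a junk value, \<open>j\<close> is the common one-sided limit.\<close>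

definition j :: "real \<Rightarrow> real" where
  "j x = (if x \<in> L then 2 * pi * of_int (n x) else 2 * arctan (Re (R (of_real x))) - pi + 2 * pi * of_int (n x))"

lemma j_bound: "\<bar>j x - 2 * pi * of_int (n x)\<bar> \<le> 2 * pi"
  using arctan_bounded[of "Re (R (of_real x))"] by (auto simp: j_def abs_le_iff)

lemma count_const:
  assumes "L \<inter> {a<..<b} = {}" "x \<in> {a<..<b}" "t \<in> {a<..<b}"
  shows "n t = n x"
proof -
  have "n v = n u" if "u \<le> v" "u \<in> {a<..<b}" "v \<in> {a<..<b}" for u v
  proof -
    have "L \<inter> {u..<v} = {}" using that assms(1) by fastforce
    then show ?thesis using count[OF that(1)] by simp
  qed
  then show ?thesis using assms(2,3) by (cases "t \<le> x") fastforce+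
qed

text \<open>Across a pole, from left to right, \<open>2 * arctan R\<close> falls by
  \<open>2 * pi\<close>; the increase of \<open>n\<close> by 1 just right of \<open>l\<close>
  compensates this, which makes \<open>j\<close> continuous.\<close>

lemma count_jump:
  assumes "L \<inter> {a<..<b} = {l}" "t \<in> {a<..<b}"
  shows "n t = (if t \<le> l then n l else n l + 1)"
proof -
  have l: "l \<in> L" "a < l" "l < b" using assms(1) by auto
  have uniq: "y = l" if "y \<in> L" "a < y" "y < b" for y
    using that assms(1) by (metis IntI greaterThanLessThan_iff singletonD)
  show ?thesis
  proof (cases "t \<le> l")
    case True
    have "y \<notin> {t..<l}" if "y \<in> L" for y
    proof
      assume y: "y \<in> {t..<l}"
      then have "y = l" using uniq[OF that] l assms(2) by auto
      with y show False by simp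
    qed
    then have "L \<inter> {t..<l} = {}" by blast
    with count[OF True] True show ?thesis by simp
  next
    case False
    have "y = l" if "y \<in> L" "y \<in> {l..<t}" for y
      using uniq[OF that(1)] l assms(2) that(2) by auto
    then have "L \<inter> {l..<t} = {l}" using l(1) False by auto
    with count[of l t] False show ?thesis by simp
  qed
qed

abbreviation Arctan_R' :: "real \<Rightarrow> complex" where
  "Arctan_R' x \<equiv> inverse (1 + (R (of_real x))\<^sup>2) * deriv R (of_real x)"

text \<open>The term with \<open>V\<close> accounts for a pole within distance \<open>s x\<close>,
  the last term for the derivative of \<open>S x\<close>.\<close>

abbreviation slope :: "real \<Rightarrow> real" where
  "slope x \<equiv> 2 * V x * (1 + (2 * W / s x)\<^sup>2) + 8 * W / (s x)\<^sup>2"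

abbreviation slope' :: "real \<Rightarrow> real" where
  "slope' x \<equiv> 4 * V x * (1 + (2 * W / s x)\<^sup>2) + 16 * W / (s x)\<^sup>2"

text \<open>Near a pole both \<open>R\<close> and its derivative are large. With pole term
  \<open>a\<close> and regular part \<open>\<sigma>\<close> the pole contributes
  \<open>a^2 / w l0\<close> to the derivative, and the denominator
  \<open>1 + (a + \<sigma>)^2\<close> cancels the growth in \<open>a\<close>. The bound therefore
  does not depend on the distance to the pole, although the radius \<open>d\<close> does.\<close>

lemma R_real_and_local:
  assumes x: "x \<notin> L"
  obtains d where "d > 0" "L \<inter> {x - d<..<x + d} = {}" "R holomorphic_on rball x d"
    "\<And>t. \<bar>t - x\<bar> < d \<Longrightarrow> Im (R (of_real t)) = 0"
    "norm (Arctan_R' x) \<le> slope x"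
proof (cases "\<exists>l0\<in>L. \<bar>l0 - x\<bar> < s x")
  case False
  then have far: "\<And>l. l \<in> L \<Longrightarrow> s x \<le> \<bar>l - x\<bar>" by force
  then have RS: "R = S x" using R_eq_S by auto
  have Im: "Im (S x (of_real x)) = 0" using Im_S_of_real[of x x] s_pos[of x] by simp
  then have Sx: "S x (of_real x) = of_real (Re (S x (of_real x)))" by (simp add: complex_eq_iff)
  show ?thesis
  proof (rule that[of "s x / 2"])
    show "L \<inter> {x - s x / 2<..<x + s x / 2} = {}"
      using far s_pos[of x] by (force simp: abs_le_iff abs_real_def split: if_splits)
    show "R holomorphic_on rball x (s x / 2)" unfolding RS by (rule S_holomorphic)
    show "Im (R (of_real t)) = 0" if "\<bar>t - x\<bar> < s x / 2" for t
      unfolding RS using that by (rule Im_S_of_real)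
    have "norm (1 + (R (of_real x))\<^sup>2) \<ge> 1"
    proof -
      have "1 + (R (of_real x))\<^sup>2 = of_real (1 + (Re (S x (of_real x)))\<^sup>2)"
        unfolding RS by (subst Sx) simp
      then show ?thesis by (simp only: norm_of_real) simp
    qed
    then have "norm (inverse (1 + (R (of_real x))\<^sup>2)) \<le> 1"
      unfolding norm_inverse by (rule inverse_le_1_iff[THEN iffD2, OF disjI2])
    then have "norm (Arctan_R' x) \<le> 1 * (8 * W / (s x)\<^sup>2)"
      unfolding norm_mult using norm_deriv_S_le[of x] RS by (intro mult_mono) auto
    moreover have "0 \<le> 2 * V x * (1 + (2 * W / s x)\<^sup>2)" using V_nonneg by (simp add: add_nonneg_nonneg)
    ultimately show "norm (Arctan_R' x) \<le> slope x"
      by simp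
  qed (use s_pos[of x] in simp)
next
  case True
  then obtain l0 where l0: "l0 \<in> L" "\<bar>l0 - x\<bar> < s x" by auto
  then have ne: "l0 \<noteq> x" using x by auto
  define d where "d = min (s x / 2) \<bar>l0 - x\<bar>"
  have d: "d > 0" "d \<le> s x / 2" "d \<le> \<bar>l0 - x\<bar>" using ne s_pos[of x] by (auto simp: d_def min_def)
  have sub: "rball x d \<subseteq> rball x (s x / 2)" using d(2) by auto
  have R: "R z = of_real (w l0) / (of_real l0 - z) + S x z" if "z \<in> rball x d" for z
    using R_eq_pole_plus_S[OF l0] that sub by blast
  have nz: "complex_of_real l0 - z \<noteq> 0" if "z \<in> rball x d" for z
    using that d(3) by (auto simp: dist_norm abs_minus_commute simp flip: of_real_diff)
  have avoid: "L \<inter> {x - d<..<x + d} = {}"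
  proof (rule ccontr)
    assume "L \<inter> {x - d<..<x + d} \<noteq> {}"
    then obtain l where "l \<in> L" "x - d < l" "l < x + d" by auto
    then have l: "l \<in> L" "\<bar>l - x\<bar> < d" by auto
    then have "l = l0" using isolated[OF l(1) l0(1) _ l0(2)] d s_pos[of x] by simp
    with l d show False by simp
  qed
  have hol: "R holomorphic_on rball x d"
  proof (rule holomorphic_transform[where f = "\<lambda>z. of_real (w l0) / (of_real l0 - z) + S x z"])
    show "(\<lambda>z. of_real (w l0) / (of_real l0 - z) + S x z) holomorphic_on rball x d"
      using nz holomorphic_on_subset[OF S_holomorphic sub] by (intro holomorphic_intros) auto
  qed (simp add: R)
  have real: "Im (R (of_real t)) = 0" if "\<bar>t - x\<bar> < d" for t
  proof -
    have "complex_of_real t \<in> rball x d"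
      using that by (simp add: dist_norm abs_minus_commute flip: of_real_diff)
    then show ?thesis
      using R Im_S_of_real[of t x] that d by (simp flip: of_real_diff of_real_divide)
  qed
  have xin: "complex_of_real x \<in> rball x d" using d by simp
  have "deriv R (of_real x) = of_real (w l0) / (of_real l0 - of_real x)\<^sup>2 + deriv (S x) (of_real x)"
  proof (rule DERIV_imp_deriv, rule has_field_derivative_transform_within_open[where S = "rball x d"])
    have "(S x has_field_derivative deriv (S x) (of_real x)) (at (of_real x))"
      using s_pos[of x] by (intro holomorphic_derivI[OF S_holomorphic]) auto
    then show "((\<lambda>z. of_real (w l0) / (of_real l0 - z) + S x z) has_field_derivative
       of_real (w l0) / (of_real l0 - of_real x)\<^sup>2 + deriv (S x) (of_real x)) (at (of_real x))"
      using nz[OF xin] by (auto intro!: derivative_eq_intros simp: power2_eq_square)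
  qed (use xin R in auto)
  moreover define a where "a = w l0 / (l0 - x)"
  moreover define \<sigma> where "\<sigma> = Re (S x (of_real x))"
  have wpos: "w l0 > 0" using w_pos l0 by blast
  have "complex_of_real (w l0) / (of_real l0 - of_real x)\<^sup>2 = of_real (a\<^sup>2 / w l0)"
    using wpos by (simp add: a_def power2_eq_square flip: of_real_diff of_real_mult of_real_divide)
  ultimately have deriv: "deriv R (of_real x) = of_real (a\<^sup>2 / w l0) + deriv (S x) (of_real x)" by simp
  have "Im (S x (of_real x)) = 0" using Im_S_of_real[of x x] s_pos[of x] by simp
  then have "S x (of_real x) = of_real \<sigma>" by (simp add: \<sigma>_def complex_eq_iff)
  then have Rx: "R (of_real x) = of_real (a + \<sigma>)"
    using R[OF xin] by (simp add: a_def)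
  have \<sigma>: "\<bar>\<sigma>\<bar> \<le> 2 * W / s x"
    unfolding \<sigma>_def using abs_Re_le_cmod[of "S x (of_real x)"] norm_S_le[of "of_real x" x] s_pos[of x] by simp
  define D where "D = 1 + (a + \<sigma>)\<^sup>2"
  have D1: "D \<ge> 1" by (simp add: D_def)
  have div_D: "X / D \<le> X" if "0 \<le> X" for X
    using mult_left_mono[OF D1 that] D1 by (simp add: pos_divide_le_eq)
  \<comment> \<open>A quantitative form of \<open>|a| \<le> |a + \<sigma>| + |\<sigma>|\<close>; the
    difference of the two sides is exhibited as a sum of squares.\<close>
  have a2: "a\<^sup>2 \<le> 2 * D * (1 + \<sigma>\<^sup>2)"
  proof -
    have "2 * D * (1 + \<sigma>\<^sup>2) - a\<^sup>2 = (a + 2 * \<sigma>)\<^sup>2 + 2 + 2 * (a + \<sigma>)\<^sup>2 * \<sigma>\<^sup>2"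
      by (simp add: D_def power2_eq_square algebra_simps)
    moreover have "0 \<le> (a + 2 * \<sigma>)\<^sup>2 + 2 + 2 * (a + \<sigma>)\<^sup>2 * \<sigma>\<^sup>2" by simp
    ultimately show ?thesis by linarith
  qed
  have "norm (Arctan_R' x) = norm (deriv R (of_real x)) / D"
  proof -
    have "1 + (R (of_real x))\<^sup>2 = of_real D" unfolding Rx D_def by simp
    then show ?thesis using D1 by (simp add: norm_mult norm_inverse divide_inverse mult.commute)
  qed
  also have "\<dots> \<le> (a\<^sup>2 / w l0 + 8 * W / (s x)\<^sup>2) / D"
  proof (rule divide_right_mono)
    have "norm (deriv R (of_real x)) \<le> norm (complex_of_real (a\<^sup>2 / w l0)) + norm (deriv (S x) (of_real x))"
      unfolding deriv by (rule norm_triangle_ineq)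
    also have "norm (complex_of_real (a\<^sup>2 / w l0)) = a\<^sup>2 / w l0"
      unfolding norm_of_real using wpos by simp
    finally show "norm (deriv R (of_real x)) \<le> a\<^sup>2 / w l0 + 8 * W / (s x)\<^sup>2"
      using norm_deriv_S_le[of x] by linarith
  qed (use D1 in simp)
  also have "\<dots> = (a\<^sup>2 / D) * (1 / w l0) + (8 * W / (s x)\<^sup>2) / D" by (simp add: add_divide_distrib)
  also have "\<dots> \<le> (2 * (1 + (2 * W / s x)\<^sup>2)) * V x + 8 * W / (s x)\<^sup>2"
  proof (intro add_mono mult_mono)
    have "a\<^sup>2 / D \<le> 2 * (1 + \<sigma>\<^sup>2)" using a2 D1 by (simp add: pos_divide_le_eq mult_ac)
    also have "\<sigma>\<^sup>2 \<le> (2 * W / s x)\<^sup>2" using \<sigma> by (metis abs_ge_zero power2_abs power_mono)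
    finally show "a\<^sup>2 / D \<le> 2 * (1 + (2 * W / s x)\<^sup>2)" by simp
    show "1 / w l0 \<le> V x" using w_ge[OF l0] .
    have "0 \<le> 8 * W / (s x)\<^sup>2" using W_nonneg by simp
    then show "(8 * W / (s x)\<^sup>2) / D \<le> 8 * W / (s x)\<^sup>2"
      using div_D by blast
  qed (use wpos in \<open>auto simp: add_nonneg_nonneg\<close>)
  finally have "norm (Arctan_R' x) \<le> slope x"
    by (simp add: mult_ac)
  then show ?thesis using that d(1) avoid hol real by blast
qed

text \<open>Off \<open>L\<close> the quotient of \<open>q\<close> and its conjugate is
  \<open>(R - \<i>) / (R + \<i>)\<close>. Since \<open>r - \<i> = - \<i> * (1 + \<i> * r)\<close>,
  this is \<open>exp (2 * \<i> * arctan r)\<close> up to sign, and the \<open>- pi\<close> in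
  \<open>j\<close> supplies the sign.\<close>

lemma q_phase: "exp (\<i> * of_real (j x)) * cnj (q (of_real x)) = q (of_real x)"
proof (cases "x \<in> L")
  case True
  then show ?thesis by (simp add: q_def)
next
  case False
  then obtain d where "d > 0" "\<And>t. \<bar>t - x\<bar> < d \<Longrightarrow> Im (R (of_real t)) = 0"
    by (rule R_real_and_local) blast
  then have "Im (R (of_real x)) = 0" by simp
  define r where "r = Re (R (of_real x))"
  have Rx: "R (of_real x) = of_real r" using \<open>Im (R (of_real x)) = 0\<close> by (simp add: r_def complex_eq_iff)
  have q: "q (of_real x) = 1 / (of_real r + \<i>)"
    using False by (auto simp: q_def Rx)
  have nz: "complex_of_real r + \<i> \<noteq> 0" "complex_of_real r - \<i> \<noteq> 0" by (auto simp: complex_eq_iff)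
  have r2: "(complex_of_real r + \<i>) * (of_real r - \<i>) = of_real (1 + r\<^sup>2)"
    by (simp add: algebra_simps power2_eq_square)
  have "exp (\<i> * of_real (j x)) = exp (\<i> * of_real (2 * arctan r)) * exp (- (\<i> * of_real pi)) * exp (2 * of_real pi * \<i> * of_int (n x))"
    using False by (simp add: j_def r_def exp_add[symmetric] algebra_simps)
  also have "exp (2 * of_real pi * \<i> * of_int (n x)) = 1"
    using exp_integer_2pi[of "of_int (n x)"] by (simp add: mult_ac)
  also have "exp (- (\<i> * of_real pi)) = (-1 :: complex)"
    by (simp add: exp_minus)
  finally have e: "exp (\<i> * of_real (j x)) * of_real (1 + r\<^sup>2) = - (1 + \<i> * of_real r)\<^sup>2"
    using exp_double_arctan[of r] by simp
  also have "\<dots> = (of_real r - \<i>)\<^sup>2" by (simp add: power2_eq_square algebra_simps)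
  finally have "exp (\<i> * of_real (j x)) * ((of_real r + \<i>) * (of_real r - \<i>)) = (of_real r - \<i>) * (of_real r - \<i>)"
    by (simp only: r2 power2_eq_square)
  then have "exp (\<i> * of_real (j x)) * (of_real r + \<i>) = of_real r - \<i>"
    using nz by (simp flip: mult.assoc)
  then show ?thesis using nz by (simp add: q field_simps)
qed

text \<open>On \<open>L\<close> the function \<open>R\<close> is replaced by
  \<open>\<rho> = 1 / R\<close>, which is regular and vanishes there. The identity for
  \<open>arctan\<close> of an inverse brings in \<open>pi / 2\<close> with a sign depending on the
  side, and the jump of \<open>n\<close> makes the two sides match.\<close>

lemma j_local:
  obtains d \<Theta> where "d > 0" "\<Theta> holomorphic_on rball x d"
    "\<And>t. \<bar>t - x\<bar> < d \<Longrightarrow> \<Theta> (of_real t) = of_real (j t)"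
    "norm (deriv \<Theta> (of_real x)) \<le> slope' x"
proof (cases "x \<in> L")
  case False
  then obtain d where d: "d > 0" "L \<inter> {x - d<..<x + d} = {}" "R holomorphic_on rball x d"
    "\<And>t. \<bar>t - x\<bar> < d \<Longrightarrow> Im (R (of_real t)) = 0"
    "norm (Arctan_R' x) \<le> slope x"
    by (rule R_real_and_local) blast
  have "Im (R (of_real x)) = 0" using d by simp
  from local_Arctan[OF d(3,1) this] obtain e where e: "e > 0" "e \<le> d" "(\<lambda>z. Arctan (R z)) holomorphic_on rball x e"
    "((\<lambda>z. Arctan (R z)) has_field_derivative Arctan_R' x) (at (of_real x))" .
  define \<Theta> where "\<Theta> z = 2 * Arctan (R z) - of_real pi + of_real (2 * pi * of_int (n x))" for z
  show ?thesis
  proof (rule that[of e \<Theta>])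
    show "\<Theta> holomorphic_on rball x e"
      unfolding \<Theta>_def using e(3) by (intro holomorphic_intros)
    fix t assume t: "\<bar>t - x\<bar> < e"
    have "R (of_real t) = of_real (Re (R (of_real t)))" using d(4)[of t] t e by (simp add: complex_eq_iff)
    then have "Arctan (R (of_real t)) = of_real (arctan (Re (R (of_real t))))" by (metis Arctan_of_real)
    moreover have "n t = n x"
      using count_const[OF d(2), of x t] t e d(1) by (auto simp: abs_less_iff)
    moreover have "t \<notin> L" using d(2) t e by (auto simp: abs_less_iff)
    ultimately show "\<Theta> (of_real t) = of_real (j t)" by (simp add: \<Theta>_def j_def)
  next
    have "(\<Theta> has_field_derivative 2 * (Arctan_R' x)) (at (of_real x))"
      unfolding \<Theta>_def by (rule derivative_eq_intros e(4) refl)+ simp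
    from DERIV_imp_deriv[OF this]
    have "norm (deriv \<Theta> (of_real x)) = 2 * norm (Arctan_R' x)"
      by (simp add: norm_mult)
    with d(5) show "norm (deriv \<Theta> (of_real x)) \<le> slope' x" by simp
  qed (rule e(1))
next
  case True
  have wpos: "w x > 0" using w_pos True by blast
  let ?D = "\<lambda>z. of_real (w x) + (of_real x - z) * S x z"
  define B where "B = rball x (s x / 2)"
  have holD: "?D holomorphic_on B" unfolding B_def using S_holomorphic by (intro holomorphic_intros)
  have "isCont (\<lambda>z. Re (?D z)) (of_real x)"
    using holomorphic_on_imp_continuous_on[OF holD] s_pos[of x]
    by (intro isCont_Re) (simp add: B_def continuous_on_eq_continuous_at)
  then obtain d0 where d0: "d0 > 0" "\<And>z. dist z (of_real x) < d0 \<Longrightarrow> dist (Re (?D z)) (Re (?D (of_real x))) < w x"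
    unfolding continuous_at_eps_delta using wpos by blast
  define d where "d = min d0 (s x / 2)"
  have d: "d > 0" "d \<le> s x / 2" using d0 s_pos[of x] by (auto simp: d_def)
  \<comment> \<open>Positivity on the smaller disc settles the sign of \<open>R\<close>: on the line
    it is that of \<open>x - t\<close>.\<close>
  have ReD: "Re (?D z) > 0" if "z \<in> rball x d" for z
    using d0(2)[of z] that by (simp add: d_def dist_commute dist_real_def abs_less_iff)
  have sub: "rball x d \<subseteq> B" using d(2) by (auto simp: B_def)
  have Dnz: "?D z \<noteq> 0" if "z \<in> rball x d" for z
    using ReD[OF that] by (metis less_irrefl zero_complex.simps(1))
  define \<rho> where "\<rho> z = (of_real x - z) / ?D z" for z
  have hol\<rho>: "\<rho> holomorphic_on rball x d"
    unfolding \<rho>_def using Dnz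
    by (intro holomorphic_on_divide[OF _ holomorphic_on_subset[OF holD sub]]) (auto intro!: holomorphic_intros)
  have "\<rho> (of_real x) = 0" by (simp add: \<rho>_def)
  then have "Im (\<rho> (of_real x)) = 0" by simp
  from local_Arctan[OF hol\<rho> d(1) this] obtain e where e: "e > 0" "e \<le> d" "(\<lambda>z. Arctan (\<rho> z)) holomorphic_on rball x e"
    "((\<lambda>z. Arctan (\<rho> z)) has_field_derivative inverse (1 + (\<rho> (of_real x))\<^sup>2) * deriv \<rho> (of_real x)) (at (of_real x))" .
  have deriv\<rho>: "deriv \<rho> (of_real x) = - 1 / of_real (w x)"
  proof (rule DERIV_imp_deriv)
    have "(?D has_field_derivative deriv ?D (of_real x)) (at (of_real x))"
      using s_pos[of x] by (intro holomorphic_derivI[OF holD]) (auto simp: B_def)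
    moreover have "?D (of_real x) \<noteq> 0" using wpos by simp
    ultimately have "(\<rho> has_field_derivative ((0 - 1) * ?D (of_real x) - (of_real x - of_real x) * deriv ?D (of_real x)) / (?D (of_real x) * ?D (of_real x))) (at (of_real x))"
      unfolding \<rho>_def by (intro DERIV_divide DERIV_diff DERIV_const DERIV_ident)
    then show "(\<rho> has_field_derivative - 1 / of_real (w x)) (at (of_real x))"
      using wpos by simp
  qed
  define \<Theta> where "\<Theta> z = of_real (2 * pi * of_int (n x)) - 2 * Arctan (\<rho> z)" for z
  show ?thesis
  proof (rule that[of e \<Theta>])
    show "\<Theta> holomorphic_on rball x e"
      unfolding \<Theta>_def using e(3) by (intro holomorphic_intros)
    fix t assume t: "\<bar>t - x\<bar> < e"
    have tin: "complex_of_real t \<in> rball x d"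
      using t e by (simp add: dist_norm abs_minus_commute flip: of_real_diff)
    define D where "D = Re (?D (of_real t))"
    have Dpos: "D > 0" unfolding D_def by (rule ReD[OF tin])
    have "Im (S x (of_real t)) = 0" using Im_S_of_real[of t x] t e d by simp
    then have D_eq: "?D (of_real t) = of_real D"
      by (simp add: D_def complex_eq_iff)
    have \<rho>t: "\<rho> (of_real t) = of_real ((x - t) / D)" by (simp add: \<rho>_def D_eq)
    show "\<Theta> (of_real t) = of_real (j t)"
    proof (cases "t = x")
      case True
      then show ?thesis using \<open>x \<in> L\<close> \<rho>t by (simp add: \<Theta>_def j_def)
    next
      case False
      have iso: "L \<inter> {x - s x / 2<..<x + s x / 2} = {x}"
        using isolated[OF _ \<open>x \<in> L\<close>, of _ x] \<open>x \<in> L\<close> s_pos[of x] by (fastforce simp: abs_less_iff)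
      have nt: "n t = (if t \<le> x then n x else n x + 1)"
        using t e d by (intro count_jump[OF iso]) (auto simp: abs_less_iff)
      have "t \<notin> L"
      proof
        assume "t \<in> L"
        then have "t \<in> L \<inter> {x - s x / 2<..<x + s x / 2}" using t e d by auto
        with False show False unfolding iso by simp
      qed
      have "R (of_real t) = of_real (w x) / (of_real x - of_real t) + S x (of_real t)"
        using R_eq_pole_plus_S[OF \<open>x \<in> L\<close> _ subsetD[OF sub[unfolded B_def] tin]] s_pos[of x] by simp
      also have "\<dots> = ?D (of_real t) / (of_real x - of_real t)"
        using False by (simp add: field_simps)
      also have "\<dots> = of_real (D / (x - t))" by (simp add: D_eq)
      finally have Rt: "Re (R (of_real t)) = D / (x - t)" by simp
      have "arctan (D / (x - t)) = (if t < x then pi / 2 else - (pi / 2)) - arctan ((x - t) / D)"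
      proof (cases "t < x")
        case True
        then show ?thesis using arctan_inverse[of "(x - t) / D"] Dpos by simp
      next
        case F: False
        then have "arctan (inverse ((t - x) / D)) = pi / 2 - arctan ((t - x) / D)"
          using False Dpos by (intro arctan_inverse) simp
        moreover have "D / (x - t) = - inverse ((t - x) / D)" "(x - t) / D = - ((t - x) / D)"
          using F False Dpos by (auto simp: field_simps)
        ultimately show ?thesis using F by (simp only: arctan_minus) simp
      qed
      then have "j t = 2 * pi * of_int (n x) - 2 * arctan ((x - t) / D)"
        using \<open>t \<notin> L\<close> nt Rt False by (auto simp: j_def algebra_simps)
      then show ?thesis by (simp only: \<Theta>_def \<rho>t Arctan_of_real) simp
    qed
  next
    have "(\<Theta> has_field_derivative 0 - 2 * (inverse (1 + (\<rho> (of_real x))\<^sup>2) * deriv \<rho> (of_real x))) (at (of_real x))"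
      unfolding \<Theta>_def by (intro DERIV_diff DERIV_const DERIV_cmult e(4))
    from DERIV_imp_deriv[OF this]
    have "norm (deriv \<Theta> (of_real x)) = 2 * (1 / w x)"
      using \<open>\<rho> (of_real x) = 0\<close> deriv\<rho> wpos by (simp add: norm_divide)
    also have "\<dots> \<le> 4 * V x * 1 + 0"
      using w_ge[OF True, of x] s_pos[of x] V_nonneg[of x] by simp
    also have "\<dots> \<le> slope' x"
      using V_nonneg[of x] W_nonneg by (intro add_mono mult_left_mono) auto
    finally show "norm (deriv \<Theta> (of_real x)) \<le> slope' x" .
  qed (rule e(1))
qed

end

section \<open>Polynomial growth and local extension\<close>

text \<open>The shape \<open>(1 + |x|) ^ k\<close> with a natural exponent is closed under sums,
  products and powers without side conditions.\<close>

definition poly_growth :: "(real \<Rightarrow> real) \<Rightarrow> bool" where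
  "poly_growth f \<longleftrightarrow> (\<exists>C k. \<forall>x. \<bar>f x\<bar> \<le> C * (1 + \<bar>x\<bar>) ^ k)"

lemma poly_growthE:
  assumes "poly_growth f"
  obtains C k where "C \<ge> 0" "\<And>x. \<bar>f x\<bar> \<le> C * (1 + \<bar>x\<bar>) ^ k"
proof -
  obtain C k where C: "\<And>x. \<bar>f x\<bar> \<le> C * (1 + \<bar>x\<bar>) ^ k"
    using assms by (auto simp: poly_growth_def)
  then have "C \<ge> 0" using C[of 0] by simp
  with C show ?thesis using that by blast
qed

lemma poly_growth_mono:
  assumes "poly_growth g" "\<And>x. \<bar>f x\<bar> \<le> g x"
  shows "poly_growth f"
  using assms unfolding poly_growth_def by (meson abs_ge_self order_trans)

lemma poly_growth_const: "poly_growth (\<lambda>x. c)"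
  unfolding poly_growth_def by (intro exI[of _ "\<bar>c\<bar>"] exI[of _ 0]) simp

lemma poly_growth_abs: "poly_growth (\<lambda>x. \<bar>x\<bar>)"
  unfolding poly_growth_def by (intro exI[of _ 1]) simp

lemma poly_growth_add:
  assumes "poly_growth f" "poly_growth g"
  shows "poly_growth (\<lambda>x. f x + g x)"
proof -
  obtain C k where C: "C \<ge> 0" "\<And>x. \<bar>f x\<bar> \<le> C * (1 + \<bar>x\<bar>) ^ k" using poly_growthE[OF assms(1)] by blast
  obtain D m where D: "D \<ge> 0" "\<And>x. \<bar>g x\<bar> \<le> D * (1 + \<bar>x\<bar>) ^ m" using poly_growthE[OF assms(2)] by blast
  have "\<bar>f x + g x\<bar> \<le> (C + D) * (1 + \<bar>x\<bar>) ^ (k + m)" for x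
  proof -
    have "C * (1 + \<bar>x\<bar>) ^ k \<le> C * (1 + \<bar>x\<bar>) ^ (k + m)" "D * (1 + \<bar>x\<bar>) ^ m \<le> D * (1 + \<bar>x\<bar>) ^ (k + m)"
      using C(1) D(1) by (auto intro!: mult_left_mono power_increasing)
    then show ?thesis
      using C(2)[of x] D(2)[of x] abs_triangle_ineq[of "f x" "g x"] unfolding distrib_right by linarith
  qed
  then show ?thesis unfolding poly_growth_def by blast
qed

lemma poly_growth_mult:
  assumes "poly_growth f" "poly_growth g"
  shows "poly_growth (\<lambda>x. f x * g x)"
proof -
  obtain C k where C: "C \<ge> 0" "\<And>x. \<bar>f x\<bar> \<le> C * (1 + \<bar>x\<bar>) ^ k" using poly_growthE[OF assms(1)] by blast
  obtain D m where D: "D \<ge> 0" "\<And>x. \<bar>g x\<bar> \<le> D * (1 + \<bar>x\<bar>) ^ m" using poly_growthE[OF assms(2)] by blast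
  have "\<bar>f x * g x\<bar> \<le> (C * D) * (1 + \<bar>x\<bar>) ^ (k + m)" for x
  proof -
    have "\<bar>f x\<bar> * \<bar>g x\<bar> \<le> (C * (1 + \<bar>x\<bar>) ^ k) * (D * (1 + \<bar>x\<bar>) ^ m)"
      using C D by (intro mult_mono) auto
    then show ?thesis by (simp add: abs_mult power_add mult_ac)
  qed
  then show ?thesis unfolding poly_growth_def by blast
qed

lemma poly_growth_power: "poly_growth f \<Longrightarrow> poly_growth (\<lambda>x. f x ^ k)"
  by (induction k) (auto intro: poly_growth_const poly_growth_mult)

lemmas poly_growth_intros = poly_growth_const poly_growth_abs poly_growth_add poly_growth_mult poly_growth_power

lemma jbracket_le: "jbracket x \<le> 1 + \<bar>x\<bar>"
  unfolding jbracket_def by (rule real_le_lsqrt) (auto simp: power2_eq_square algebra_simps)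

lemma jbracket_ge_1: "jbracket x \<ge> 1"
  unfolding jbracket_def by simp

lemma jbracket_ge: "1 + \<bar>x\<bar> \<le> 2 * jbracket x"
proof -
  have "\<bar>x\<bar> \<le> jbracket x" unfolding jbracket_def by (rule real_le_rsqrt) simp
  then show ?thesis using jbracket_ge_1[of x] by linarith
qed

lemma poly_growth_lesssim:
  assumes "lesssim_on UNIV (\<lambda>x. \<bar>f x\<bar>) (\<lambda>x. jbracket x powr K)" 
  shows "poly_growth f"
proof -
  obtain C where C: "C > 0" "\<And>x. \<bar>f x\<bar> \<le> C * jbracket x powr K"
    using assms by (auto simp: lesssim_on_def)
  have "\<bar>f x\<bar> \<le> C * (1 + \<bar>x\<bar>) ^ nat \<lceil>K\<rceil>" for x
  proof -
    have "jbracket x powr K \<le> jbracket x powr real (nat \<lceil>K\<rceil>)"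
      using jbracket_ge_1 by (intro powr_mono) linarith+
    also have "\<dots> = jbracket x ^ nat \<lceil>K\<rceil>"
      using jbracket_ge_1[of x] by (intro powr_realpow) simp
    also have "\<dots> \<le> (1 + \<bar>x\<bar>) ^ nat \<lceil>K\<rceil>"
      using jbracket_ge_1[of x] jbracket_le[of x] by (intro power_mono) auto
    finally show ?thesis using C(2)[of x] mult_left_mono[of _ _ C] C(1) by (meson less_imp_le order_trans)
  qed
  then show ?thesis unfolding poly_growth_def by blast
qed

text \<open>Real-analyticity in the form required by the reflection argument: a holomorphic
  extension to a full complex disc.\<close>

definition locally_extendable :: "(real \<Rightarrow> real) \<Rightarrow> bool" where
  "locally_extendable f \<longleftrightarrow> (\<forall>x. real_extends_at x f)"

lemma locally_extendableE:
  assumes "locally_extendable f"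
  obtains r \<Theta> where "r > 0" "\<Theta> holomorphic_on rball x r"
    "\<And>t. \<bar>t - x\<bar> < r \<Longrightarrow> \<Theta> (of_real t) = of_real (f t)"
  using assms unfolding locally_extendable_def by meson

lemma real_analytic_locally_extendable:
  fixes f :: "real \<Rightarrow> real"
  assumes "real_analytic f"
  shows "locally_extendable f"
  unfolding locally_extendable_def
proof
  fix x
  obtain r a where r: "r > 0" and a: "\<And>y. \<bar>y - x\<bar> < r \<Longrightarrow> (\<lambda>n. (y - x) ^ n *\<^sub>R a n) sums f y"
    using assms unfolding real_analytic_def by meson
  define \<Theta> where "\<Theta> z = (\<Sum>n. complex_of_real (a n) * (z - of_real x) ^ n)" for z
  have sums: "(\<lambda>n. complex_of_real (a n) * (z - of_real x) ^ n) sums \<Theta> z" if z: "z \<in> rball x r" for z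
  proof -
    \<comment> \<open>Convergence at a real point farther from \<open>x\<close> than
      \<open>z\<close> gives convergence at \<open>z\<close>, so the complex disc has the same
      radius as the real interval.\<close>
    obtain t where t: "norm (z - of_real x) < t" "t < r"
      using z dense[of "norm (z - of_real x)" r] by (auto simp: dist_norm norm_minus_commute)
    have "0 \<le> t" using t(1) norm_ge_zero[of "z - of_real x"] by linarith
    then have "(\<lambda>n. t ^ n *\<^sub>R a n) sums f (x + t)" using a[of "x + t"] t(2) by simp
    then have "summable (\<lambda>n. t ^ n * a n)" by (simp add: sums_iff)
    then have "summable (\<lambda>n. complex_of_real (t ^ n * a n))" by (rule summable_of_real)
    then have "summable (\<lambda>n. complex_of_real (a n) * of_real t ^ n)" by (simp add: mult.commute)
    then have "summable (\<lambda>n. complex_of_real (a n) * (z - of_real x) ^ n)"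
      by (rule powser_inside) (use t \<open>0 \<le> t\<close> in simp)
    then show ?thesis unfolding \<Theta>_def by (rule summable_sums)
  qed
  have "\<Theta> holomorphic_on rball x r"
    using sums by (rule power_series_holomorphic)
  moreover have "\<Theta> (of_real t) = of_real (f t)" if "\<bar>t - x\<bar> < r" for t
  proof -
    have "(\<lambda>n. complex_of_real ((t - x) ^ n *\<^sub>R a n)) sums of_real (f t)"
      using a[OF that] by (simp only: sums_of_real_iff)
    then have "(\<lambda>n. complex_of_real (a n) * (of_real t - of_real x) ^ n) sums of_real (f t)"
      by (simp add: mult.commute)
    moreover have "complex_of_real t \<in> rball x r"
      using that by (simp add: dist_norm abs_minus_commute flip: of_real_diff)
    ultimately show ?thesis using sums sums_unique2 by blast
  qed
  ultimately show "real_extends_at x f"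
    using r by blast
qed

lemma local_extension_deriv:
  assumes "r > 0" "\<Theta> holomorphic_on rball x r"
    "\<And>t. \<bar>t - x\<bar> < r \<Longrightarrow> \<Theta> (of_real t) = of_real (f t)" "\<bar>t - x\<bar> < r"
  shows "(f has_real_derivative Re (deriv \<Theta> (of_real t))) (at t)"
proof -
  have "complex_of_real t \<in> rball x r"
    using assms(4) by (simp add: dist_norm abs_minus_commute flip: of_real_diff)
  then have "(\<Theta> has_field_derivative deriv \<Theta> (of_real t)) (at (of_real t))"
    using assms(2) by (intro holomorphic_derivI) auto
  from has_vector_derivative_real_field[OF this]
  have "((\<lambda>u. \<Theta> (of_real u)) has_vector_derivative deriv \<Theta> (of_real t)) (at t)" .
  from bounded_linear.has_vector_derivative[OF bounded_linear_Re this]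
  have "((\<lambda>u. Re (\<Theta> (of_real u))) has_vector_derivative Re (deriv \<Theta> (of_real t))) (at t)" .
  moreover have "open {x - r<..<x + r}" "t \<in> {x - r<..<x + r}" using assms(4) by auto
  moreover have "Re (\<Theta> (of_real u)) = f u" if "u \<in> {x - r<..<x + r}" for u
  proof -
    have "\<bar>u - x\<bar> < r" using that by auto
    then show ?thesis using assms(3)[of u] by simp
  qed
  ultimately have "(f has_vector_derivative Re (deriv \<Theta> (of_real t))) (at t)"
    by (rule has_vector_derivative_transform_within_open)
  then show ?thesis by (simp add: has_real_derivative_iff_has_vector_derivative)
qed

lemma locally_extendable_has_derivative:
  assumes "locally_extendable f"
  shows "(f has_real_derivative deriv f x) (at x)"
proof -
  obtain r \<Theta> where "r > 0" "\<Theta> holomorphic_on rball x r"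
    "\<And>t. \<bar>t - x\<bar> < r \<Longrightarrow> \<Theta> (of_real t) = of_real (f t)"
    using locally_extendableE[OF assms, of x] by blast
  from local_extension_deriv[OF this, of x] \<open>r > 0\<close> show ?thesis
    using DERIV_imp_deriv by fastforce
qed

lemma locally_extendable_continuous:
  "locally_extendable f \<Longrightarrow> continuous_on UNIV f"
  using locally_extendable_has_derivative DERIV_isCont continuous_at_imp_continuous_on by blast

lemma locally_extendable_continuous_deriv:
  assumes "locally_extendable f"
  shows "continuous_on UNIV (deriv f)"
proof (intro continuous_at_imp_continuous_on ballI)
  fix x
  obtain r \<Theta> where r: "r > 0" and \<Theta>: "\<Theta> holomorphic_on rball x r"
    "\<And>t. \<bar>t - x\<bar> < r \<Longrightarrow> \<Theta> (of_real t) = of_real (f t)"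
    using locally_extendableE[OF assms, of x] by blast
  have "deriv \<Theta> holomorphic_on rball x r"
    using \<Theta>(1) by (rule holomorphic_deriv) simp
  then have "isCont (deriv \<Theta>) (of_real x)"
    using r holomorphic_on_imp_continuous_on by (metis centre_in_ball continuous_on_eq_continuous_at open_ball)
  then have c: "isCont (\<lambda>t. Re (deriv \<Theta> (of_real t))) x"
    by (intro isCont_Re isCont_o2[where g = "deriv \<Theta>" and f = complex_of_real]) (auto intro: continuous_intros)
  have "\<forall>\<^sub>F t in nhds x. \<bar>t - x\<bar> < r"
    unfolding eventually_nhds_metric using r by (auto simp: dist_real_def)
  then have "\<forall>\<^sub>F t in nhds x. Re (deriv \<Theta> (of_real t)) = deriv f t"
  proof eventually_elim
    case (elim t)
    from DERIV_imp_deriv[OF local_extension_deriv[OF r \<Theta> elim]] show ?case by simp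
  qed
  with c show "isCont (deriv f) x" using isCont_cong by metis
qed

lemma locally_extendable_half_diff:
  assumes f: "locally_extendable f" and g: "locally_extendable g" and h: "locally_extendable h"
  shows "locally_extendable (\<lambda>x. (f x - g x - h x) / 2)"
  unfolding locally_extendable_def
proof
  fix x
  obtain r F where F: "r > 0" "F holomorphic_on rball x r"
    "\<And>t. \<bar>t - x\<bar> < r \<Longrightarrow> F (of_real t) = of_real (f t)"
    using locally_extendableE[OF f, of x] by blast
  obtain s G where G: "s > 0" "G holomorphic_on rball x s"
    "\<And>t. \<bar>t - x\<bar> < s \<Longrightarrow> G (of_real t) = of_real (g t)"
    using locally_extendableE[OF g, of x] by blast
  obtain u H where H: "u > 0" "H holomorphic_on rball x u"
    "\<And>t. \<bar>t - x\<bar> < u \<Longrightarrow> H (of_real t) = of_real (h t)"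
    using locally_extendableE[OF h, of x] by blast
  define d where "d = min r (min s u)"
  have "(\<lambda>z. (F z - G z - H z) / 2) holomorphic_on rball x d"
    by (intro holomorphic_intros holomorphic_on_subset[OF F(2)] holomorphic_on_subset[OF G(2)] holomorphic_on_subset[OF H(2)])
      (auto simp: d_def)
  then show "real_extends_at x (\<lambda>t. (f t - g t - h t) / 2)"
    using F(1,3) G(1,3) H(1,3)
    by (intro exI[of _ d] conjI exI[of _ "\<lambda>z. (F z - G z - H z) / 2"]) (auto simp: d_def)
qed

text \<open>The set where an essential bound fails is open and negligible, hence empty.\<close>

lemma L_infty_continuous_bounded:
  assumes "h \<in> L_infty" "continuous_on UNIV h"
  shows "\<exists>B. \<forall>x. \<bar>h x\<bar> \<le> B"
proof -
  obtain B where B: "AE x in lebesgue. \<bar>h x\<bar> \<le> B" using assms(1) by (auto simp: L_infty_def)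
  have o: "open {x. \<bar>h x\<bar> > B}"
    using assms(2) by (intro open_Collect_less continuous_intros)
  have "negligible {x. \<bar>h x\<bar> > B}"
    using B unfolding negligible_iff_null_sets eventually_ae_filter
    by (auto intro: null_sets_subset completion.complete2 simp: not_le)
  then have "{x. \<bar>h x\<bar> > B} = {}" using open_not_negligible[OF o] by blast
  then show ?thesis by (intro exI[of _ B]) (auto simp: not_less)
qed

lemma mean_value_bound:
  assumes f: "\<And>x. (f has_real_derivative f' x) (at x)"
    and bd: "\<And>\<xi>. \<bar>\<xi> - x\<bar> \<le> d \<Longrightarrow> \<bar>f' \<xi>\<bar> \<le> K" and "\<bar>u - x\<bar> \<le> d" "\<bar>v - x\<bar> \<le> d"
  shows "\<bar>f u - f v\<bar> \<le> K * \<bar>u - v\<bar>"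
proof -
  have "norm (f u - f v) \<le> K * norm (u - v)"
  proof (rule field_differentiable_bound)
    show "convex (cball x d)" by simp
    show "(f has_field_derivative f' \<xi>) (at \<xi> within cball x d)" for \<xi>
      using f by (rule has_field_derivative_at_within)
  qed (use assms in \<open>auto simp: dist_real_def abs_minus_commute\<close>)
  then show ?thesis by simp
qed

lemma shift_power_le:
  fixes \<xi> x :: real
  assumes "\<bar>\<xi> - x\<bar> \<le> 1"
  shows "(1 + \<bar>\<xi>\<bar>) ^ k \<le> 2 ^ k * (1 + \<bar>x\<bar>) ^ k"
proof -
  have "1 + \<bar>\<xi>\<bar> \<le> 2 * (1 + \<bar>x\<bar>)" using assms by (simp add: abs_if split: if_splits)
  then have "(1 + \<bar>\<xi>\<bar>) ^ k \<le> (2 * (1 + \<bar>x\<bar>)) ^ k" by (intro power_mono) auto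
  then show ?thesis by (simp only: power_mult_distrib)
qed

text \<open>For \<open>|t - x| \<le> 1\<close> the mean value bound applies, and
  \<open>|t - x|\<close> is at most its square root; for larger distances \<open>2 * B\<close>
  suffices because the square root exceeds 1.\<close>

lemma tempered_phase_if_poly_growth:
  assumes deriv: "\<And>x. (\<theta> has_real_derivative \<theta>' x) (at x)" and growth: "poly_growth \<theta>'"
    and bd: "\<And>x. \<bar>\<theta> x\<bar> \<le> B"
  shows "\<exists>C k. tempered_phase \<theta> B C k"
proof -
  obtain K k where K: "K \<ge> 0" "\<And>x. \<bar>\<theta>' x\<bar> \<le> K * (1 + \<bar>x\<bar>) ^ k"
    using poly_growthE[OF growth] by blast
  have B: "B \<ge> 0" using bd[of 0] by linarith
  define C where "C = K * 2 ^ k + 2 * B + 1"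
  have pos: "0 \<le> K * 2 ^ k" using K(1) by simp
  then have C: "C \<ge> 1" "K * 2 ^ k \<le> C" "2 * B \<le> C" using B by (auto simp: C_def)
  have "tempered_phase \<theta> B C k"
  proof
    show "continuous_on UNIV \<theta>"
      using deriv DERIV_isCont continuous_at_imp_continuous_on by blast
    fix t x :: real
    show "\<bar>\<theta> t - \<theta> x\<bar> \<le> C * (1 + \<bar>x\<bar>) ^ k * sqrt \<bar>t - x\<bar>"
    proof (cases "\<bar>t - x\<bar> \<le> 1")
      case True
      have "\<bar>\<theta> t - \<theta> x\<bar> \<le> (K * 2 ^ k * (1 + \<bar>x\<bar>) ^ k) * \<bar>t - x\<bar>"
      proof (rule mean_value_bound[OF deriv])
        fix \<xi> assume "\<bar>\<xi> - x\<bar> \<le> 1"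
        from order.trans[OF K(2) mult_left_mono[OF shift_power_le[OF this] K(1)]]
        show "\<bar>\<theta>' \<xi>\<bar> \<le> K * 2 ^ k * (1 + \<bar>x\<bar>) ^ k" by (simp only: mult.assoc)
      qed (use True in auto)
      also have "\<dots> \<le> (C * (1 + \<bar>x\<bar>) ^ k) * sqrt \<bar>t - x\<bar>"
      proof (intro mult_mono mult_right_mono C)
        show "\<bar>t - x\<bar> \<le> sqrt \<bar>t - x\<bar>"
          using True by (intro real_le_rsqrt) (metis abs_ge_zero mult_left_le power2_abs power2_eq_square)
      qed (use C in auto)
      finally show ?thesis .
    next
      case False
      have "\<bar>\<theta> t - \<theta> x\<bar> \<le> 2 * B" using bd[of t] bd[of x] by linarith
      also have "\<dots> \<le> C * 1 * 1" using C by simp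
      also have "\<dots> \<le> C * (1 + \<bar>x\<bar>) ^ k * sqrt \<bar>t - x\<bar>"
        using C False by (intro mult_mono one_le_power) auto
      finally show ?thesis .
    qed
  qed (use bd C in auto)
  then show ?thesis by blast
qed

lemma H_infty_cong_AE:
  assumes "f \<in> H_infty" "AE x in lebesgue. f x = g x"
  shows "g \<in> H_infty"
proof -
  obtain F where F: "F holomorphic_on UHP" "bounded (F ` UHP)"
    "AE x in lebesgue. nontangential_limit F (f x) x"
    using assms(1) by (auto simp: H_infty_def)
  have "AE x in lebesgue. nontangential_limit F (g x) x"
    using F(3) assms(2) by eventually_elim simp
  with F show ?thesis unfolding H_infty_def by blast
qed

section \<open>The multiplier\<close>

text \<open>Points, weights and counts are built in the coordinate \<alpha> and pulled back. The
  Lipschitz constant \<open>K x\<close> of \<alpha> on the unit neighbourhood of \<open>x\<close>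
  converts distances, and its polynomial growth passes to \<open>1 / s\<close> and
  \<open>V\<close>.\<close>

lemma (in increasing_weight) clark_phase_exists:
  assumes growth: "poly_growth \<alpha>'" and sep: "separated \<delta> (\<alpha> ` \<Lambda>)"
    and dens: "upper_density \<alpha> \<Lambda> < ennreal (1 / (2 * pi))"
  shows "\<exists>L w s V n b. clark_phase L w s V n \<and> \<Lambda> \<subseteq> L \<and> infinite (L - \<Lambda>) \<and> (\<forall>l\<in>L. w l \<le> 1) \<and>
     (\<forall>x. \<bar>\<alpha> x - 2 * pi * of_int (n x)\<bar> \<le> b) \<and> poly_growth (\<lambda>x. 1 / s x) \<and> poly_growth V"
proof -
  have "filterlim (\<lambda>m. 2 * pi * real m) at_top sequentially" by real_asymp
  \<comment> \<open>The lengths \<open>2 * pi * m\<close> turn the critical density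
    \<open>1 / (2 * pi)\<close> into the count \<open>m\<close>.\<close>
  from eventually_compose_filterlim[OF upper_density_card_less[OF sep dens] this]
  have "\<forall>\<^sub>F m in sequentially. \<forall>u. real (card (\<alpha> ` \<Lambda> \<inter> {u..u + 2 * pi * real m})) < 1 / (2 * pi) * (2 * pi * real m)" .
  then obtain m where m: "\<And>u. card (\<alpha> ` \<Lambda> \<inter> {u..u + 2 * pi * real m}) < m"
    by (auto dest!: eventually_happens)
  have mpos: "m > 0" by (rule le_less_trans[OF le0 m])
  define l where "l = 2 * pi * real m"
  have lpos: "l > 0" using mpos by (simp add: l_def)
  have "card (\<alpha> ` \<Lambda> \<inter> {x. \<lfloor>x / l\<rfloor> = k}) < m" for k :: int
  proof -
    have "{x. \<lfloor>x / l\<rfloor> = k} \<subseteq> {l * of_int k..l * of_int k + l}"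
      using lpos by (auto simp: floor_eq_iff field_simps)
    then have "card (\<alpha> ` \<Lambda> \<inter> {x. \<lfloor>x / l\<rfloor> = k}) \<le> card (\<alpha> ` \<Lambda> \<inter> {l * of_int k..l * of_int k + l})"
      using separated_finite_card(1)[OF sep] lpos by (intro card_mono) auto
    with m[of "l * of_int k"] show ?thesis by (simp add: l_def)
  qed
  from separated_complete_blocks[OF sep l_def this]
  obtain A' \<delta>' where A': "\<alpha> ` \<Lambda> \<subseteq> A'" "separated \<delta>' A'" "infinite (A' - \<alpha> ` \<Lambda>)"
    "\<And>k::int. card (A' \<inter> {x. \<lfloor>x / l\<rfloor> = k}) = m" by blast
  obtain n0 :: "real \<Rightarrow> int" where n0: "\<And>u v. u \<le> v \<Longrightarrow> n0 v - n0 u = int (card (A' \<inter> {u..<v}))"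
    "\<And>u. \<bar>u - 2 * pi * of_int (n0 u)\<bar> \<le> l"
    using block_counting_function[OF A'(2) l_def mpos A'(4)] by blast
  obtain w0 C0 where w0: "\<And>a. a \<in> A' \<Longrightarrow> 0 < w0 a \<and> w0 a \<le> (1::real) \<and> 1 / w0 a \<le> C0 * (1 + \<bar>a\<bar>)\<^sup>2" "w0 summable_on A'"
    using separated_summable_weights[OF A'(2)] by blast
  obtain C k where C: "C \<ge> 0" "\<And>x. \<bar>\<alpha>' x\<bar> \<le> C * (1 + \<bar>x\<bar>) ^ k"
    using poly_growthE[OF growth] by blast
  have \<delta>': "\<delta>' > 0" using A'(2) by (simp add: separated_def)
  define L where "L = \<alpha> -` A'"
  define K where "K x = C * (2 ^ k * (1 + \<bar>x\<bar>) ^ k)" for x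
  have K0: "K x \<ge> 0" for x using C(1) by (simp add: K_def)
  have lip: "\<bar>\<alpha> u - \<alpha> v\<bar> \<le> K x * \<bar>u - v\<bar>" if "\<bar>u - x\<bar> \<le> 1" "\<bar>v - x\<bar> \<le> 1" for u v x
  proof (rule mean_value_bound[OF deriv])
    fix \<xi> assume "\<bar>\<xi> - x\<bar> \<le> 1"
    from order.trans[OF C(2) mult_left_mono[OF shift_power_le[OF this] C(1)]]
    show "\<bar>\<alpha>' \<xi>\<bar> \<le> K x" by (simp only: K_def)
  qed (use that in auto)
  \<comment> \<open>Two points within \<open>s x\<close> of \<open>x\<close> have images at distance
    at most \<open>K x * (2 * s x) \<le> \<delta>'\<close>, so they coincide. The extra \<delta>' in
    the denominator also ensures \<open>s x \<le> 1\<close> and makes \<open>1 / s x\<close> affine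
    in \<open>K x\<close>.\<close>
  define s where "s x = \<delta>' / (2 * K x + \<delta>')" for x
  have s: "0 < s x" "s x \<le> 1" "K x * (2 * s x) \<le> \<delta>'" for x
  proof -
    have pos: "2 * K x + \<delta>' > 0" using K0[of x] \<delta>' by simp
    then show "0 < s x" "s x \<le> 1" using \<delta>' K0[of x] by (auto simp: s_def)
    have "K x * (2 * s x) = (2 * K x) * \<delta>' / (2 * K x + \<delta>')" by (simp add: s_def)
    also have "\<dots> \<le> \<delta>'" using pos \<delta>' by (simp add: pos_divide_le_eq algebra_simps)
    finally show "K x * (2 * s x) \<le> \<delta>'" .
  qed
  \<comment> \<open>For \<open>|a - x| \<le> 1\<close> the value \<open>|\<alpha> a|\<close> is at
    most \<open>|\<alpha> x| + K x\<close>, so this dominates the quadratic bound on the inverse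
    weight.\<close>
  define V where "V x = \<bar>C0\<bar> * (1 + (\<bar>\<alpha> x\<bar> + K x))\<^sup>2" for x
  have surj_L: "\<alpha> ` L = A'" unfolding L_def using surj by (rule surj_image_vimage_eq)
  have "clark_phase L (\<lambda>x. w0 (\<alpha> x)) s V (\<lambda>x. n0 (\<alpha> x))"
  proof
    show "0 < w0 (\<alpha> x)" if "x \<in> L" for x using w0(1) that by (simp add: L_def)
    have "(w0 \<circ> \<alpha>) summable_on L"
      using w0(2) surj_L summable_on_reindex[of \<alpha> L w0] inj_on_subset[OF inj] by auto
    then show "(\<lambda>x. w0 (\<alpha> x)) summable_on L" by (simp add: o_def)
    show "0 < s x" for x by (rule s)
    show "a = b" if ab: "a \<in> L" "b \<in> L" "\<bar>a - x\<bar> < s x" "\<bar>b - x\<bar> < s x" for a b x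
    proof (rule ccontr)
      assume "a \<noteq> b"
      then have "\<alpha> a \<noteq> \<alpha> b" using inj by (auto dest: injD)
      then have "\<bar>\<alpha> a - \<alpha> b\<bar> > \<delta>'" using A'(2) ab by (auto simp: separated_def L_def)
      moreover have "\<bar>\<alpha> a - \<alpha> b\<bar> \<le> K x * \<bar>a - b\<bar>"
        using ab s(2)[of x] by (intro lip) auto
      moreover have "K x * \<bar>a - b\<bar> \<le> K x * (2 * s x)"
        using ab K0[of x] by (intro mult_left_mono) auto
      ultimately show False using s(3)[of x] by linarith
    qed
    show "1 / w0 (\<alpha> a) \<le> V x" if a: "a \<in> L" "\<bar>a - x\<bar> < s x" for a x
    proof -
      have "\<bar>a - x\<bar> \<le> 1" using a s(2)[of x] by linarith
      then have "\<bar>\<alpha> a - \<alpha> x\<bar> \<le> K x * \<bar>a - x\<bar>" by (intro lip) auto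
      also have "\<dots> \<le> K x" using K0[of x] \<open>\<bar>a - x\<bar> \<le> 1\<close> by (simp add: mult_left_le)
      finally have "1 + \<bar>\<alpha> a\<bar> \<le> 1 + (\<bar>\<alpha> x\<bar> + K x)" by linarith
      then have "(1 + \<bar>\<alpha> a\<bar>)\<^sup>2 \<le> (1 + (\<bar>\<alpha> x\<bar> + K x))\<^sup>2" by (intro power_mono) auto
      then have "\<bar>C0\<bar> * (1 + \<bar>\<alpha> a\<bar>)\<^sup>2 \<le> V x" unfolding V_def by (intro mult_left_mono) auto
      moreover have "1 / w0 (\<alpha> a) \<le> C0 * (1 + \<bar>\<alpha> a\<bar>)\<^sup>2" using w0(1) a by (simp add: L_def)
      moreover have "C0 * (1 + \<bar>\<alpha> a\<bar>)\<^sup>2 \<le> \<bar>C0\<bar> * (1 + \<bar>\<alpha> a\<bar>)\<^sup>2" by (intro mult_right_mono) auto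
      ultimately show ?thesis by linarith
    qed
    show "0 \<le> V x" for x by (simp add: V_def)
    show "n0 (\<alpha> v) - n0 (\<alpha> u) = int (card (L \<inter> {u..<v}))" if "u \<le> v" for u v
    proof -
      have "A' \<inter> {\<alpha> u..<\<alpha> v} = \<alpha> ` (L \<inter> {u..<v})"
      proof -
        have "\<alpha> ` (L \<inter> {u..<v}) = \<alpha> ` L \<inter> \<alpha> ` {u..<v}" using inj by (rule image_Int)
        also have "\<alpha> ` {u..<v} = {\<alpha> u..<\<alpha> v}"
        proof (intro equalityI subsetI)
          fix y assume y: "y \<in> {\<alpha> u..<\<alpha> v}"
          obtain x where "y = \<alpha> x" using surj by (metis surjD)
          with y show "y \<in> \<alpha> ` {u..<v}" using le_iff strict_mono by (auto simp: strict_mono_less)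
        qed (use le_iff strict_mono in \<open>auto simp: strict_mono_less\<close>)
        finally show ?thesis using surj_L by simp
      qed
      moreover have "card (\<alpha> ` (L \<inter> {u..<v})) = card (L \<inter> {u..<v})"
        by (rule card_image) (rule inj_on_subset[OF inj], simp)
      ultimately show ?thesis using n0(1)[of "\<alpha> u" "\<alpha> v"] that le_iff by simp
    qed
  qed
  moreover have "\<Lambda> \<subseteq> L" using A'(1) by (auto simp: L_def)
  moreover have "infinite (L - \<Lambda>)"
  proof
    assume "finite (L - \<Lambda>)"
    moreover have "A' - \<alpha> ` \<Lambda> \<subseteq> \<alpha> ` (L - \<Lambda>)" using surj_L by blast
    ultimately show False using A'(3) finite_surj by blast
  qed
  moreover have "\<forall>x\<in>L. w0 (\<alpha> x) \<le> 1" using w0(1) by (simp add: L_def)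
  moreover have pgK: "poly_growth K"
    unfolding K_def by (intro poly_growth_intros)
  moreover have "poly_growth (\<lambda>x. 1 / s x)"
  proof -
    have "1 / s x = 2 / \<delta>' * K x + 1" for x
      using \<delta>' K0[of x] by (simp add: s_def field_simps)
    moreover have "poly_growth (\<lambda>x. 2 / \<delta>' * K x + 1)" using pgK by (intro poly_growth_intros)
    ultimately show ?thesis by simp
  qed
  moreover have "poly_growth V"
  proof -
    have "poly_growth \<alpha>"
    proof (rule poly_growth_mono)
      show "poly_growth (\<lambda>x. \<bar>\<alpha> 0\<bar> + C * (1 + \<bar>x\<bar>) ^ k * \<bar>x\<bar>)" by (intro poly_growth_intros)
      fix x
      have "\<bar>\<alpha> x - \<alpha> 0\<bar> \<le> (C * (1 + \<bar>x\<bar>) ^ k) * \<bar>x - 0\<bar>"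
      proof (rule mean_value_bound[OF deriv, where x = 0 and d = "\<bar>x\<bar>"])
        fix \<xi> assume "\<bar>\<xi> - 0\<bar> \<le> \<bar>x\<bar>"
        then have "C * (1 + \<bar>\<xi>\<bar>) ^ k \<le> C * (1 + \<bar>x\<bar>) ^ k"
          using C(1) by (intro mult_left_mono power_mono) auto
        with C(2)[of \<xi>] show "\<bar>\<alpha>' \<xi>\<bar> \<le> C * (1 + \<bar>x\<bar>) ^ k" by linarith
      qed auto
      then show "\<bar>\<alpha> x\<bar> \<le> \<bar>\<alpha> 0\<bar> + C * (1 + \<bar>x\<bar>) ^ k * \<bar>x\<bar>" by simp
    qed
    then have "poly_growth (\<lambda>x. \<bar>\<alpha> x\<bar>)" by (simp add: poly_growth_def)
    then show ?thesis
      unfolding V_def using pgK by (intro poly_growth_intros)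
  qed
  ultimately show ?thesis using n0(2) by blast
qed

text \<open>The modulus of \<open>exp (\<i> * ext z)\<close> is \<open>exp (- Im (ext z))\<close>,
  and logarithmic growth of \<open>ext\<close> becomes polynomial both above and below. The degree
  \<open>N\<close> obtained here fixes the number of roots to be divided out.\<close>

lemma (in tempered_phase) exp_ext_bounds:
  obtains A N where "A > 0" "\<And>z. Im z \<ge> 0 \<Longrightarrow> norm (exp (\<i> * ext z)) \<le> A * (1 + norm z) ^ N"
    "\<And>z. Im z \<ge> 0 \<Longrightarrow> 1 \<le> A * (1 + norm z) ^ N * norm (exp (\<i> * ext z))"
proof -
  define a where "a = norm (schwarz \<i>) + 6 + B + 2 * B * ln C"
  define b where "b = B * (3 + 2 * real k)"
  define N where "N = nat \<lceil>b\<rceil>"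
  have bd: "exp (norm (ext z)) \<le> exp a * (1 + norm z) ^ N" if "Im z \<ge> 0" for z
  proof -
    have "b \<le> real N" unfolding N_def by (rule real_nat_ceiling_ge)
    moreover have "0 \<le> ln (1 + norm z)" by simp
    ultimately have "norm (ext z) \<le> a + real N * ln (1 + norm z)"
      using norm_ext_le[OF that] mult_right_mono[of b "real N" "ln (1 + norm z)"] by (simp add: a_def b_def)
    then have "exp (norm (ext z)) \<le> exp (a + real N * ln (1 + norm z))" by simp
    also have "\<dots> = exp a * (1 + norm z) ^ N"
      using norm_ge_zero[of z] by (simp add: exp_add exp_of_nat_mult add_pos_nonneg)
    finally show ?thesis .
  qed
  show ?thesis
  proof (rule that[of "exp a" N])
    fix z assume z: "Im z \<ge> 0"
    have "norm (exp (\<i> * ext z)) = exp (- Im (ext z))" by (simp add: norm_exp_eq_Re)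
    moreover have "- Im (ext z) \<le> norm (ext z)" "Im (ext z) \<le> norm (ext z)"
      using abs_Im_le_cmod[of "ext z"] by linarith+
    ultimately have "norm (exp (\<i> * ext z)) \<le> exp (norm (ext z))" "1 \<le> exp (norm (ext z)) * norm (exp (\<i> * ext z))"
      by (simp_all flip: exp_add)
    then show "norm (exp (\<i> * ext z)) \<le> exp a * (1 + norm z) ^ N"
      "1 \<le> exp a * (1 + norm z) ^ N * norm (exp (\<i> * ext z))"
      using bd[OF z] by (auto intro: order.trans mult_right_mono)
  qed simp
qed

lemma norm_prod_roots_le:
  assumes "finite M"
  shows "norm (\<Prod>\<mu>\<in>M. complex_of_real x - of_real \<mu>) \<le> (\<Prod>\<mu>\<in>M. 1 + \<bar>\<mu>\<bar>) * (1 + \<bar>x\<bar>) ^ card M"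
proof -
  have "norm (\<Prod>\<mu>\<in>M. complex_of_real x - of_real \<mu>) = (\<Prod>\<mu>\<in>M. \<bar>x - \<mu>\<bar>)"
    by (simp add: prod_norm[symmetric] flip: of_real_diff)
  also have "\<dots> \<le> (\<Prod>\<mu>\<in>M. (1 + \<bar>\<mu>\<bar>) * (1 + \<bar>x\<bar>))"
  proof (intro prod_mono conjI)
    fix \<mu>
    have "(1 + \<bar>\<mu>\<bar>) * (1 + \<bar>x\<bar>) = \<bar>x\<bar> + \<bar>\<mu>\<bar> + (1 + \<bar>\<mu>\<bar> * \<bar>x\<bar>)" by (simp add: algebra_simps)
    also have "\<dots> \<ge> \<bar>x\<bar> + \<bar>\<mu>\<bar>" by simp
    finally show "\<bar>x - \<mu>\<bar> \<le> (1 + \<bar>\<mu>\<bar>) * (1 + \<bar>x\<bar>)"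
      using abs_triangle_ineq4[of x \<mu>] by (rule order.trans[rotated])
  qed simp
  finally show ?thesis by (simp add: prod.distrib)
qed

theorem theorem2:
  fixes \<alpha> h :: "real \<Rightarrow> real" and U :: "real \<Rightarrow> complex" and \<Lambda> :: "real set" and K0 K1 :: real
  assumes "real_analytic \<alpha>" and "real_analytic h"
    and "U = (\<lambda>x. exp (\<i> * complex_of_real (- \<alpha> x + h x)))"
    and "regular_locally_doubling \<alpha>"
    and "K0 \<ge> 0"
    and "lesssim_on UNIV (\<lambda>x. 1) (deriv \<alpha>)"
    and "lesssim_on UNIV (deriv \<alpha>) (\<lambda>x. jbracket x powr K0)"
    and "h \<in> L_infty"
    and "K1 \<ge> 0"
    and "lesssim_on UNIV (\<lambda>x. \<bar>deriv h x\<bar>) (\<lambda>x. jbracket x powr K1)"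
    and "uniformly_separated \<alpha> \<Lambda>"
    and "upper_density \<alpha> \<Lambda> < ennreal (1 / (2 * pi))"
  shows "\<exists>T \<in> N_infty U. \<exists>N\<ge>0. real_analytic T \<and>
           (\<forall>l\<in>\<Lambda>. T l = 0) \<and>
           lesssim_on \<Lambda> (\<lambda>l. jbracket l powr (- N)) (\<lambda>l. cmod (vector_derivative T (at l)))"
proof -
  have loc_\<alpha>: "locally_extendable \<alpha>" and loc_h: "locally_extendable h"
    using assms(1,2) by (auto intro: real_analytic_locally_extendable)
  obtain C where C: "C > 0" "\<And>x. 1 \<le> C * deriv \<alpha> x"
    using assms(6) by (auto simp: lesssim_on_def)
  have lower: "1 / C \<le> deriv \<alpha> x" for x
    using C by (simp add: pos_divide_le_eq mult.commute)
  interpret increasing_weight \<alpha> "deriv \<alpha>" "1 / C"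
    using locally_extendable_has_derivative[OF loc_\<alpha>] locally_extendable_continuous_deriv[OF loc_\<alpha>] C(1) lower
    by unfold_locales auto
  have "0 < deriv \<alpha> x" for x using lower[of x] C(1) by (meson less_le_trans zero_less_divide_1_iff)
  then have "\<bar>deriv \<alpha> x\<bar> = deriv \<alpha> x" for x by (simp add: less_imp_le)
  then have pg_\<alpha>: "poly_growth (deriv \<alpha>)" using assms(7) by (intro poly_growth_lesssim[of _ K0]) simp
  have pg_h: "poly_growth (deriv h)" using assms(10) by (rule poly_growth_lesssim)
  obtain \<delta> where sep: "separated \<delta> (\<alpha> ` \<Lambda>)"
    using assms(11) unfolding uniformly_separated_def separated_def weight_dist_def by fast
  obtain Bh where Bh: "\<And>x. \<bar>h x\<bar> \<le> Bh"
    using L_infty_continuous_bounded[OF assms(8) locally_extendable_continuous[OF loc_h]] by blast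
  obtain L w s V n b where clark: "clark_phase L w s V n" and L: "\<Lambda> \<subseteq> L" "infinite (L - \<Lambda>)"
    and w_le: "\<And>l. l \<in> L \<Longrightarrow> w l \<le> 1" and nb: "\<And>x. \<bar>\<alpha> x - 2 * pi * of_int (n x)\<bar> \<le> b"
    and pg_s: "poly_growth (\<lambda>x. 1 / s x)" and pg_V: "poly_growth V"
    using clark_phase_exists[OF pg_\<alpha> sep assms(12)] by blast
  interpret clark_phase L w s V n by (rule clark)
  have loc_j: "locally_extendable j"
    unfolding locally_extendable_def by (metis j_local)
  have pg_j: "poly_growth (deriv j)"
  proof (rule poly_growth_mono)
    show "poly_growth (\<lambda>x. 4 * V x * (1 + (2 * W * (1 / s x))\<^sup>2) + 16 * W * (1 / s x)\<^sup>2)"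
      by (intro poly_growth_intros pg_V pg_s)
    fix x
    obtain d \<Theta> where d: "d > 0" "\<Theta> holomorphic_on rball x d" "\<And>t. \<bar>t - x\<bar> < d \<Longrightarrow> \<Theta> (of_real t) = of_real (j t)"
      "norm (deriv \<Theta> (of_real x)) \<le> slope' x"
      using j_local[of x] by blast
    from local_extension_deriv[OF d(1-3), of x] d(1) have "deriv j x = Re (deriv \<Theta> (of_real x))"
      by (intro DERIV_imp_deriv) simp
    then have "\<bar>deriv j x\<bar> \<le> norm (deriv \<Theta> (of_real x))" using abs_Re_le_cmod by simp
    with d(4) show "\<bar>deriv j x\<bar> \<le> 4 * V x * (1 + (2 * W * (1 / s x))\<^sup>2) + 16 * W * (1 / s x)\<^sup>2"
      by (simp add: power_divide)
  qed
  define \<theta> where "\<theta> x = (\<alpha> x - h x - j x) / 2" for x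
  have \<theta>_deriv: "(\<theta> has_real_derivative (deriv \<alpha> x - deriv h x - deriv j x) / 2) (at x)" for x
    unfolding \<theta>_def
    by (intro DERIV_cdivide DERIV_diff locally_extendable_has_derivative loc_\<alpha> loc_h loc_j)
  have pg_\<theta>: "poly_growth (\<lambda>x. (deriv \<alpha> x - deriv h x - deriv j x) / 2)"
  proof -
    have "poly_growth (\<lambda>x. (1 / 2) * (deriv \<alpha> x + (- 1) * deriv h x + (- 1) * deriv j x))"
      by (intro poly_growth_intros pg_\<alpha> pg_h pg_j)
    then show ?thesis by simp
  qed
  have "\<bar>\<theta> x\<bar> \<le> (b + Bh + 2 * pi) / 2" for x
  proof -
    have "\<bar>\<alpha> x - h x - j x\<bar> \<le> b + Bh + 2 * pi"
      using nb[of x] Bh[of x] j_bound[of x] by (simp only: abs_le_iff) linarith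
    then show ?thesis by (simp add: \<theta>_def)
  qed
  from tempered_phase_if_poly_growth[OF \<theta>_deriv pg_\<theta> this]
  obtain C\<theta> k\<theta> where "tempered_phase \<theta> ((b + Bh + 2 * pi) / 2) C\<theta> k\<theta>" by blast
  then interpret tempered_phase \<theta> "(b + Bh + 2 * pi) / 2" C\<theta> k\<theta> .
  have loc_\<theta>: "locally_extendable \<theta>"
    unfolding \<theta>_def by (rule locally_extendable_half_diff[OF loc_\<alpha> loc_h loc_j])
  have "upper_analytic ext"
  proof (rule upper_analyticI[OF ext_holomorphic])
    fix x :: real
    obtain r \<Theta> where "r > 0" "\<Theta> holomorphic_on rball x r"
      "\<And>t. \<bar>t - x\<bar> < r \<Longrightarrow> \<Theta> (of_real t) = of_real (\<theta> t)"
      using locally_extendableE[OF loc_\<theta>, of x] by blast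
    from ext_local_extension[OF this] \<open>r > 0\<close>
    show "extends_at x ext"
      by blast
  qed
  define E where "E z = exp (\<i> * ext z)" for z
  have E_analytic: "upper_analytic E"
    unfolding E_def by (rule upper_analytic_exp) fact
  obtain A N where A: "A > 0" and E_upper: "\<And>z. Im z \<ge> 0 \<Longrightarrow> norm (E z) \<le> A * (1 + norm z) ^ N"
    and E_lower: "\<And>z. Im z \<ge> 0 \<Longrightarrow> 1 \<le> A * (1 + norm z) ^ N * norm (E z)"
    using exp_ext_bounds unfolding E_def by blast
  obtain M where M: "M \<subseteq> L - \<Lambda>" "finite M" "card M = N"
    using infinite_arbitrarily_large[OF L(2)] by blast
  define P where "P z = (\<Prod>\<mu>\<in>M. z - complex_of_real \<mu>)" for z
  have "upper_analytic (\<lambda>z. E z * q z)" by (intro upper_analytic_mult E_analytic q_upper_analytic)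
  moreover have "E (of_real \<mu>) * q (of_real \<mu>) = 0" if "\<mu> \<in> M" for \<mu>
    using that M by (auto simp: q_def)
  ultimately obtain g where g: "upper_analytic g" "\<And>z. Im z \<ge> 0 \<Longrightarrow> E z * q z = P z * g z"
    using upper_analytic_divide_roots[OF M(2), of "\<lambda>z. E z * q z"] unfolding P_def by blast
  have "bounded (g ` UHP)"
  proof (rule bounded_quotient_by_roots[OF g(1) M(2), of "\<lambda>z. E z * q z" A])
    fix z :: complex
    assume z: "Im z > 0"
    have "norm (E z * q z) \<le> (A * (1 + norm z) ^ N) * 1"
      unfolding norm_mult using E_upper[of z] norm_q_le[OF z] z A by (intro mult_mono) auto
    then show "norm (E z * q z) \<le> A * (1 + norm z) ^ card M" using M(3) by simp
  qed (use g(2) P_def in auto)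
  define T where "T x = g (of_real x)" for x
  have T_H: "T \<in> H_infty"
    unfolding T_def by (rule upper_analytic_H_infty) fact+
  have P_nz: "P (of_real x) \<noteq> 0" if "x \<notin> M" for x
    using that M(2) by (auto simp: P_def)
  have T_eq: "T x = E (of_real x) * q (of_real x) / P (of_real x)" if "x \<notin> M" for x
    using g(2)[of "of_real x"] P_nz[OF that] by (simp add: T_def field_simps)
  \<comment> \<open>Division by \<open>P\<close> preserves the symmetry because its roots are real;
    the formula for \<open>T\<close> is available only off \<open>M\<close>.\<close>
  have cnj_T: "cnj (U x * T x) = T x" if x: "x \<notin> M" for x
  proof -
    have "ext (of_real x) = of_real (\<theta> x) + \<i> * of_real (Im (ext (of_real x)))"
      by (simp add: complex_eq_iff Re_ext_of_real)
    then obtain t where t: "ext (of_real x) = of_real (\<theta> x) + \<i> * of_real t" by blast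
    have "cnj (U x) * cnj (E (of_real x)) = exp (\<i> * of_real (\<alpha> x - h x)) * exp (- (\<i> * of_real (\<theta> x)) - of_real t)"
      by (simp add: assms(3) E_def t exp_cnj algebra_simps)
    also have "\<dots> = exp (\<i> * of_real (\<theta> x) - of_real t) * exp (\<i> * of_real (j x))"
    proof -
      \<comment> \<open>One copy of \<theta> cancels the phase of the conjugated exponential and the
        other restores \<open>E\<close>, which explains the factor 1/2 in \<theta>; the remaining
        \<open>j\<close> is absorbed by \<open>q_phase\<close>.\<close>
      have "\<alpha> x - h x = 2 * \<theta> x + j x" by (simp add: \<theta>_def field_simps)
      then show ?thesis by (simp add: algebra_simps flip: exp_add)
    qed
    also have "exp (\<i> * of_real (\<theta> x) - of_real t) = E (of_real x)"
      by (simp add: E_def t algebra_simps)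
    finally have "cnj (U x) * cnj (E (of_real x)) * cnj (q (of_real x)) = E (of_real x) * q (of_real x)"
      using q_phase[of x] by (simp add: mult.assoc)
    moreover have "cnj (P (of_real x)) = P (of_real x)" by (simp add: P_def)
    ultimately show ?thesis unfolding T_eq[OF x] by (simp add: mult.assoc)
  qed
  \<comment> \<open>The finite exceptional set \<open>M\<close> is null, which is enough for
    membership in \<open>H_infty\<close>.\<close>
  have "AE x in lebesgue. T x = cnj (U x * T x)"
  proof (rule AE_I')
    show "M \<in> null_sets lebesgue" using M(2) by (simp add: negligible_finite negligible_iff_null_sets[symmetric])
    show "{x \<in> space lebesgue. T x \<noteq> cnj (U x * T x)} \<subseteq> M"
      using cnj_T by (metis (mono_tags, lifting) mem_Collect_eq subsetI)
  qed
  then have "(\<lambda>x. cnj (U x * T x)) \<in> H_infty" by (rule H_infty_cong_AE[OF T_H])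
  then have "T \<in> N_infty U" using T_H by (simp add: N_infty_def)
  moreover have "real_analytic T"
    unfolding T_def by (rule upper_analytic_real_analytic) fact
  moreover have "T l = 0" if "l \<in> \<Lambda>" for l
  proof -
    have "l \<notin> M" "q (of_real l) = 0" using that M(1) L(1) by (auto simp: q_def)
    then show ?thesis using T_eq[of l] by simp
  qed
  moreover have "lesssim_on \<Lambda> (\<lambda>l. jbracket l powr (- real (2 * N))) (\<lambda>l. cmod (vector_derivative T (at l)))"
  proof -
    \<comment> \<open>The decay exponent \<open>2 * N\<close> collects \<open>N\<close> from the
      lower bound of \<open>E\<close> and \<open>N\<close> from the growth of \<open>P\<close>;
      \<open>4 ^ N\<close> comes from \<open>1 + |l| \<le> 2 * jbracket l\<close> raised to that
      exponent.\<close>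
    define D where "D = 4 ^ N * A * (\<Prod>\<mu>\<in>M. 1 + \<bar>\<mu>\<bar>)"
    have "D > 0" using A by (auto simp: D_def intro!: mult_pos_pos prod_pos add_pos_nonneg)
    moreover have "jbracket l powr (- real (2 * N)) \<le> D * cmod (vector_derivative T (at l))" if l: "l \<in> \<Lambda>" for l
    proof -
      have lL: "l \<in> L" and lM: "l \<notin> M" using l L(1) M(1) by auto
      obtain d r where r: "d > 0" "isCont r l" "r l = - 1 / complex_of_real (w l)"
        "\<And>y. \<bar>y - l\<bar> < d \<Longrightarrow> q (of_real y) = of_real (y - l) * r y"
        using q_at_pole[OF lL] by blast
      obtain d' where d': "d' > 0" "\<And>\<mu>. \<mu> \<in> M \<Longrightarrow> \<mu> \<noteq> l \<Longrightarrow> d' \<le> dist l \<mu>"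
        using finite_set_avoid[OF M(2), of l] by blast
      \<comment> \<open>Near \<open>l\<close>, away from \<open>M\<close>, this is
        \<open>T y / (y - l)\<close> with the zero of \<open>q\<close> divided out, so
        \<open>\<rho> l\<close> is the derivative of \<open>T\<close> at \<open>l\<close>.\<close>
      define \<rho> where "\<rho> y = r y * E (of_real y) / P (of_real y)" for y
      have "continuous_on UNIV (\<lambda>y::real. E (of_real y))"
        by (rule continuous_on_compose2[OF upper_analytic_continuous_on[OF E_analytic]]) (auto intro: continuous_intros)
      then have contE: "isCont (\<lambda>y::real. E (of_real y)) l" by (simp add: continuous_on_eq_continuous_at)
      have "isCont \<rho> l"
        unfolding \<rho>_def using r(2) contE P_nz[OF lM] unfolding P_def by (intro continuous_intros) auto
      then have "(T has_vector_derivative \<rho> l) (at l)"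
      proof (rule has_vector_derivative_at_root[rotated 2])
        show "min d d' > 0" using r(1) d'(1) by simp
        fix y assume y: "\<bar>y - l\<bar> < min d d'"
        then have "y \<notin> M" using d'(2)[of y] lM by (auto simp: dist_real_def abs_minus_commute)
        then show "T y = of_real (y - l) * \<rho> y"
          using r(4)[of y] y by (simp add: T_eq \<rho>_def mult_ac)
      qed
      then have "cmod (vector_derivative T (at l)) = cmod (\<rho> l)" by (simp add: vector_derivative_at)
      also have "\<dots> = 1 / w l * norm (E (of_real l)) / norm (P (of_real l))"
        using w_pos[OF lL] by (simp add: \<rho>_def r(3) norm_mult norm_divide)
      finally have deriv_eq: "cmod (vector_derivative T (at l)) = 1 / w l * norm (E (of_real l)) / norm (P (of_real l))" .
      define Q where "Q = (1 + \<bar>l\<bar>) ^ N"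
      define p where "p = (\<Prod>\<mu>\<in>M. 1 + \<bar>\<mu>\<bar>)"
      have Q: "Q > 0" by (simp add: Q_def add_pos_nonneg)
      have p: "p > 0" by (auto simp: p_def intro!: prod_pos add_pos_nonneg)
      have P_pos: "norm (P (of_real l)) > 0" using P_nz[OF lM] by simp
      have P_le: "norm (P (of_real l)) \<le> p * Q"
        unfolding P_def p_def Q_def M(3)[symmetric] by (rule norm_prod_roots_le[OF M(2)])
      have "1 / (A * p * Q\<^sup>2) \<le> norm (E (of_real l)) / norm (P (of_real l))"
      proof -
        have "1 * norm (P (of_real l)) \<le> (A * Q * norm (E (of_real l))) * (p * Q)"
          using E_lower[of "of_real l"] P_le by (intro mult_mono) (auto simp: Q_def)
        then show ?thesis using A p Q P_pos by (simp add: divide_simps power2_eq_square mult_ac)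
      qed
      also have "\<dots> = 1 * (norm (E (of_real l)) / norm (P (of_real l)))" by simp
      also have "\<dots> \<le> 1 / w l * (norm (E (of_real l)) / norm (P (of_real l)))"
        using w_pos[OF lL] w_le[OF lL] by (intro mult_right_mono) (auto simp: divide_simps)
      finally have "1 / (A * p * Q\<^sup>2) \<le> cmod (vector_derivative T (at l))" unfolding deriv_eq by simp
      then have "D * (1 / (A * p * Q\<^sup>2)) \<le> D * cmod (vector_derivative T (at l))"
        using \<open>D > 0\<close> by (intro mult_left_mono) auto
      moreover have "D * (1 / (A * p * Q\<^sup>2)) = 4 ^ N / Q\<^sup>2"
        using A p by (simp add: D_def p_def)
      moreover have "jbracket l powr (- real (2 * N)) \<le> 4 ^ N / Q\<^sup>2"
      proof -
        have "Q\<^sup>2 = (1 + \<bar>l\<bar>) ^ (2 * N)" by (simp add: Q_def power_mult[symmetric] mult.commute)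
        also have "\<dots> \<le> (2 * jbracket l) ^ (2 * N)" using jbracket_ge[of l] by (intro power_mono) auto
        also have "\<dots> = 4 ^ N * jbracket l ^ (2 * N)" by (simp add: power_mult_distrib power_mult)
        finally have le: "Q\<^sup>2 \<le> 4 ^ N * jbracket l ^ (2 * N)" .
        have powr: "jbracket l powr (- real (2 * N)) = 1 / jbracket l ^ (2 * N)"
          using jbracket_ge_1[of l] by (simp add: powr_minus powr_realpow divide_inverse del: of_nat_mult)
        have "1 / J \<le> c / r" if "0 < J" "0 < r" "r \<le> c * J" for J c r :: real
          using that by (simp add: field_simps)
        then have "1 / jbracket l ^ (2 * N) \<le> 4 ^ N / Q\<^sup>2"
          using le Q jbracket_ge_1[of l] by simp
        then show ?thesis unfolding powr .
      qed
      ultimately show ?thesis by linarith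
    qed
    ultimately show ?thesis unfolding lesssim_on_def by blast
  qed
  ultimately show ?thesis
    by (intro bexI[of _ T] exI[of _ "real (2 * N)"]) auto
qed

end
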